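(* For discrete time convex function chasing in Euclidean $\mathbb R^d$ with requests $f_1,\dots,f_N$, the discrete time functional Steiner point algorithm is $\min(d,O(\sqrt{d\log N}))$ competitive.
   Context: Discrete-time chasing: requests convex $f_n:\mathbb R^d\to\mathbb R^+$, start $x_0=0$, cost $\sum_n f_n(x_n)+\|x_n-x_{n-1}\|_2$. Algorithm: set $f_t=f_n$ for $t\in[n-1,n)$, work function $W_t(x)=\inf_{x_s:[0,t]\to\mathbb R^d,\,x_0=0}\int_0^t f_s(x_s)+\|x'_s\|\,ds$ over paths ending at $x$, continuous path $x_t=s(W_t)$ with functional Steiner point $s(W)=\frac{1}{\mathrm{vol}(B_1)}\int_{v\in B_1}v^*\,dv=-d\,\frac{1}{|\mathbb S^{d-1}|}\int_{\mathbb S^{d-1}}W^*(\theta)\theta\,d\theta$, where $W^*(v)=\min_w(W(w)-v^Tw)$ and $v^*=\arg\min_w(W(w)-v^Tw)$; the discrete algorithm plays $x_n=x_{t_n}$ with $t_n$ minimizing $f_n(x_t)$ over $t\in[n-1,n)$.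
   Formalization: For the total cost the first term of the minimum is d+1 instead of d, since ratio d fails (d=1, requests 0, 0.6|x-1|, 0.6|x-1|); ratio d is proved for the movement cost alone. log N is read as log max(2,N), since log 1 = 0. *)

theory Defs
  imports "HOL-Analysis.Analysis"
begin

text \<open>Requests are \<open>f 1, f 2, \<dots>\<close>; the value \<open>f 0\<close> is never used.
  A play is a sequence \<open>x\<close> with \<open>x 0 = 0\<close>.\<close>

definition movement_cost :: "nat \<Rightarrow> (nat \<Rightarrow> 'a::real_normed_vector) \<Rightarrow> real" where
  "movement_cost N x = (\<Sum>n=1..N. norm (x n - x (n - 1)))"

definition total_cost :: "(nat \<Rightarrow> 'a::real_normed_vector \<Rightarrow> real) \<Rightarrow> nat \<Rightarrow> (nat \<Rightarrow> 'a) \<Rightarrow> real" where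
  "total_cost f N x = (\<Sum>n=1..N. f n (x n) + norm (x n - x (n - 1)))"

definition offline_opt :: "(nat \<Rightarrow> 'a::real_normed_vector \<Rightarrow> real) \<Rightarrow> nat \<Rightarrow> real" where
  "offline_opt f N = (INF x\<in>{x. x 0 = 0}. total_cost f N x)"

text \<open>The request in force at time \<open>s \<ge> 0\<close>: \<open>f n\<close> for \<open>s \<in> [n - 1, n)\<close>.\<close>

definition request_at :: "(nat \<Rightarrow> 'b) \<Rightarrow> real \<Rightarrow> 'b" where
  "request_at f s = f (nat \<lfloor>s\<rfloor> + 1)"

text \<open>Paths are continuous and piecewise continuously differentiable. Such a path may have infinite
  length near one of the exceptional points, so its cost is taken in \<open>[0, \<infinity>]\<close>. At time
  \<open>0\<close> the work function is \<open>0\<close> at the origin and \<open>\<infinity>\<close> (infimum over the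
  empty set) elsewhere; at positive times it is finite.\<close>

definition work_paths :: "real \<Rightarrow> 'a::real_normed_vector \<Rightarrow> (real \<Rightarrow> 'a) set" where
  "work_paths t y = {p. p piecewise_C1_differentiable_on {0..t} \<and> p 0 = 0 \<and> p t = y}"

definition work_function ::
    "(nat \<Rightarrow> 'a::real_normed_vector \<Rightarrow> real) \<Rightarrow> real \<Rightarrow> 'a \<Rightarrow> ennreal" where
  "work_function f t y = (INF p\<in>work_paths t y.
     \<integral>\<^sup>+ s\<in>{0..t}. ennreal (request_at f s (p s) + norm (vector_derivative p (at s))) \<partial>lborel)"

text \<open>The point \<open>v\<^sup>*\<close>. For a work function the minimum is attained whenever
  \<open>norm v < 1\<close>, and the minimizer is unique for almost every such \<open>v\<close>, so the choice
  made by \<open>arg_min\<close> does not affect the integral below.\<close>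

definition conjugate_point :: "('a::real_inner \<Rightarrow> ennreal) \<Rightarrow> 'a \<Rightarrow> 'a" where
  "conjugate_point W v = (ARG_MIN (\<lambda>w. enn2ereal (W w) - ereal (v \<bullet> w)) w. True)"

definition functional_steiner_point :: "('a::euclidean_space \<Rightarrow> ennreal) \<Rightarrow> 'a" where
  "functional_steiner_point W =
     (1 / measure lebesgue (ball (0::'a) 1)) *\<^sub>R (LINT v:ball 0 1|lebesgue. conjugate_point W v)"

definition steiner_path :: "(nat \<Rightarrow> 'a::euclidean_space \<Rightarrow> real) \<Rightarrow> real \<Rightarrow> 'a" where
  "steiner_path f t = functional_steiner_point (work_function f t)"

text \<open>A minimum of \<open>f n\<close> along the path over the half-open interval \<open>[n - 1, n)\<close> need not be
  attained. The time \<open>t\<close> may therefore also be \<open>n\<close>, provided it does at least as well as every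
  time in \<open>[n - 1, n)\<close>; every minimizer over \<open>[n - 1, n)\<close> is admitted, and ties are broken
  arbitrarily.\<close>

definition discrete_steiner_play ::
    "(nat \<Rightarrow> 'a::euclidean_space \<Rightarrow> real) \<Rightarrow> nat \<Rightarrow> (nat \<Rightarrow> 'a) \<Rightarrow> bool" where
  "discrete_steiner_play f N x \<longleftrightarrow> x 0 = 0 \<and>
     (\<forall>n\<in>{1..N}. \<exists>t\<in>{real n - 1..real n}. x n = steiner_path f t \<and>
        (\<forall>u\<in>{real n - 1..<real n}. f n (steiner_path f t) \<le> f n (steiner_path f u)))"

end

theory Submission
  imports Defs
begin

text \<open>For \<open>norm v < 1\<close> let \<open>\<phi>\<^sub>t v\<close> be the minimum of \<open>W\<^sub>t w - v \<bullet> w\<close>. It is concave in \<open>v\<close>, its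
  supergradients are the negated minimizers, and it increases with \<open>t\<close>, from \<open>0\<close> to at most
  \<open>W\<^sub>N w - v \<bullet> w\<close> for any \<open>w\<close>.

  Movement: integration by parts over the ball expresses the Steiner point as a limit of integrals of
  \<open>- \<phi>\<^sub>t v *\<^sub>R sgn v\<close> over thin shells at the unit sphere. Hence the displacement between two times is
  at most the mean over a shell of the increment of \<open>\<phi>\<close>, weighted with \<open>d\<close> times the absolute cosine
  of the angle to the direction of displacement. The increments telescope. Bounding the cosines by \<open>1\<close>
  gives the factor \<open>d\<close>; bounding the maximum of the \<open>N\<close> cosines, which concentrates at order \<open>sqrt (ln N / d)\<close>,
  gives the factor \<open>O (sqrt (d * ln N))\<close>, because \<open>\<phi>\<^sub>N\<close> is at most twice the optimum.

  Service: for almost every \<open>v\<close>, near minimizers of \<open>W\<^sub>t w - v \<bullet> w\<close> are close to the minimizer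
  \<open>v\<^sup>*\<close>, and then \<open>\<phi>\<^sub>t v\<close> grows at rate at least \<open>f n v\<^sup>*\<close>. By Jensen's inequality the mean of \<open>\<phi>\<^sub>t\<close>
  over the ball grows at least at the rate \<open>f n\<close> takes at the Steiner point, and this mean is at most the optimum
  at time \<open>N\<close>.\<close>

section \<open>Integration by parts by translation\<close>

text \<open>The minimizers \<open>m v\<close> come from an arbitrary choice: nothing is known in
  advance about their measurability, and they may be unbounded near the sphere. No differentiability
  theorem for concave functions is invoked. Instead, the forward and backward difference quotients
  of \<open>\<phi>\<close> enclose \<open>- (m v \<bullet> u)\<close>, and translating the
  integration variable shows that both have the same limit against a test function, so the mean
  width of the enclosure vanishes. This single fact yields measurability of \<open>m\<close>,
  integration by parts, and the almost everywhere stability of minimizers on which the service bound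
  rests. The sphere has surface \<open>d\<close> times the volume of the ball, which is where
  \<open>d\<close> enters. With layers of height \<open>2 * sqrt (ln N / d)\<close> the union bound
  over \<open>N\<close> cosines decays geometrically from layer to layer, so that the maximum has a
  mean of the order of a single layer.\<close>

definition cutoff :: "real \<Rightarrow> real \<Rightarrow> 'a::real_normed_vector \<Rightarrow> real" where
  "cutoff a b v = max 0 (min 1 ((b - norm v) / (b - a)))"

lemma cutoff_bounds: "0 \<le> cutoff a b v" "cutoff a b v \<le> 1"
  by (auto simp: cutoff_def)

lemma cutoff_eq_0: "a < b \<Longrightarrow> b \<le> norm v \<Longrightarrow> cutoff a b v = 0"
  unfolding cutoff_def using divide_nonpos_pos[of "b - norm v" "b - a"] by linarith

lemma cutoff_eq_1: "a < b \<Longrightarrow> norm v \<le> a \<Longrightarrow> cutoff a b v = 1"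
  by (simp add: cutoff_def max_def min_def divide_simps)

lemma cutoff_pos: "a < b \<Longrightarrow> norm v < b \<Longrightarrow> 0 < cutoff a b v"
  by (simp add: cutoff_def max_def min_def)

lemma cutoff_Lipschitz:
  assumes "a < b"
  shows "\<bar>cutoff a b v - cutoff a b w\<bar> \<le> norm (v - w) / (b - a)"
proof -
  have "\<bar>cutoff a b v - cutoff a b w\<bar> \<le> \<bar>(b - norm v) / (b - a) - (b - norm w) / (b - a)\<bar>"
    by (auto simp: cutoff_def max_def min_def)
  also have "\<dots> = \<bar>norm v - norm w\<bar> / (b - a)"
    using assms by (simp add: diff_divide_distrib[symmetric])
  also have "\<dots> \<le> norm (v - w) / (b - a)"
    using assms by (intro divide_right_mono norm_triangle_ineq3) auto
  finally show ?thesis .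
qed

lemma borel_measurable_cutoff [measurable]: "cutoff a b \<in> borel_measurable borel"
  unfolding cutoff_def by measurable

text \<open>The derivative of \<open>cutoff\<close> at \<open>v\<close> in direction
  \<open>u\<close>, with value 0 on the two spheres where there is none. Its support in the shell is
  what turns integration by parts against \<open>cutoff\<close> into an integral over the shell,
  weighted by a cosine when \<open>u\<close> is a unit vector.\<close>

definition cutoff_slope :: "real \<Rightarrow> real \<Rightarrow> 'a::real_inner \<Rightarrow> 'a \<Rightarrow> real" where
  "cutoff_slope a b v u = (if a < norm v \<and> norm v < b then - ((v \<bullet> u) / norm v) / (b - a) else 0)"

lemma borel_measurable_cutoff_slope [measurable]:
  "(\<lambda>v::'a::euclidean_space. cutoff_slope a b v u) \<in> borel_measurable borel"
  unfolding cutoff_slope_def by measurable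

lemma cutoff_slope_self: "a < b \<Longrightarrow> cutoff_slope a b v v \<le> 0"
  by (simp add: cutoff_slope_def)

lemma abs_cutoff_slope:
  assumes "a < b" shows "\<bar>cutoff_slope a b v u\<bar> \<le> norm u / (b - a)"
proof -
  have "\<bar>v \<bullet> u\<bar> \<le> norm v * norm u" by (rule Cauchy_Schwarz_ineq2)
  then have "v \<noteq> 0 \<Longrightarrow> \<bar>v \<bullet> u\<bar> / norm v \<le> norm u"
    by (simp add: divide_simps mult.commute)
  then show ?thesis using assms divide_right_mono[of "\<bar>v \<bullet> u\<bar> / norm v" "norm u" "b - a"]
    by (cases "v = 0") (auto simp: cutoff_slope_def abs_divide)
qed

lemma has_derivative_cutoff:
  fixes v :: "'a::euclidean_space"
  assumes "0 < a" "a < b" "norm v \<noteq> a" "norm v \<noteq> b"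
  shows "(cutoff a b has_derivative cutoff_slope a b v) (at v)"
proof -
  consider "norm v < a" | "a < norm v" "norm v < b" | "b < norm v" using assms by linarith
  then show ?thesis
  proof cases
    case 1
    have "cutoff_slope a b v = (\<lambda>u. 0)" using 1 by (auto simp: cutoff_slope_def)
    moreover have "(cutoff a b has_derivative (\<lambda>u. 0)) (at v)"
      by (rule has_derivative_transform_within_open[of "\<lambda>v. 1" _ _ _ "ball 0 a"])
        (use 1 assms in \<open>auto simp: cutoff_eq_1\<close>)
    ultimately show ?thesis by simp
  next
    case 3
    have "cutoff_slope a b v = (\<lambda>u. 0)" using 3 by (auto simp: cutoff_slope_def)
    moreover have "(cutoff a b has_derivative (\<lambda>u. 0)) (at v)"
      by (rule has_derivative_transform_within_open[of "\<lambda>v. 0" _ _ _ "- cball 0 b"])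
        (use 3 assms in \<open>auto simp: cutoff_eq_0\<close>)
    ultimately show ?thesis by simp
  next
    case 2
    have "v \<noteq> 0" using 2 assms by auto
    have "((\<lambda>v. (b - norm v) / (b - a)) has_derivative (\<lambda>u. (0 - u \<bullet> sgn v) / (b - a))) (at v)"
      using assms \<open>v \<noteq> 0\<close> by (auto intro!: derivative_eq_intros has_derivative_norm simp: divide_simps)
    moreover have "(\<lambda>u. (0 - u \<bullet> sgn v) / (b - a)) = cutoff_slope a b v"
      using 2 by (auto simp: cutoff_slope_def sgn_div_norm inner_commute divide_simps)
    ultimately have "((\<lambda>v. (b - norm v) / (b - a)) has_derivative cutoff_slope a b v) (at v)" by simp
    then show ?thesis
    proof (rule has_derivative_transform_within_open[of _ _ _ _ "ball 0 b - cball 0 a"])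
      fix x :: 'a assume "x \<in> ball 0 b - cball 0 a"
      then show "(b - norm x) / (b - a) = cutoff a b x"
        using assms by (auto simp: cutoff_def max_def min_def divide_simps)
    qed (use 2 in auto)
  qed
qed

lemma AE_norm_neq: "AE v in lebesgue. norm (v::'a::euclidean_space) \<noteq> r"
proof -
  have "sphere (0::'a) r \<in> null_sets lebesgue"
    using negligible_sphere[of 0 r] by (simp add: negligible_iff_null_sets)
  from AE_not_in[OF this] show ?thesis by eventually_elim auto
qed

lemma AE_has_derivative_cutoff:
  assumes "0 < a" "a < b"
  shows "AE v::'a::euclidean_space in lebesgue. (cutoff a b has_derivative cutoff_slope a b v) (at v)"
  using AE_norm_neq[of a] AE_norm_neq[of b]
  by eventually_elim (use assms in \<open>auto intro: has_derivative_cutoff\<close>)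

lemma integral_lebesgue_translation:
  fixes g :: "'a::euclidean_space \<Rightarrow> real"
  assumes "g \<in> borel_measurable borel"
  shows "(\<integral>v. g (v + w) \<partial>lebesgue) = (\<integral>v. g v \<partial>lebesgue)"
proof -
  have "(\<integral>v. g v \<partial>lebesgue) = (\<integral>v. g v \<partial>distr lborel borel ((+) w))"
    using assms by (simp add: integral_completion lborel_distr_plus)
  also have "\<dots> = (\<integral>v. g (w + v) \<partial>lborel)"
    using assms by (subst integral_distr) auto
  also have "\<dots> = (\<integral>v. g (v + w) \<partial>lebesgue)"
    using assms by (subst integral_completion) (auto simp: add.commute)
  finally show ?thesis by simp
qed

lemma borel_measurable_lebesgueI:
  "f \<in> borel_measurable borel \<Longrightarrow> f \<in> borel_measurable lebesgue"
  by (simp add: measurable_completion)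

lemma integrable_lebesgue_bounded:
  fixes g :: "'a::euclidean_space \<Rightarrow> 'b::{banach, second_countable_topology}"
  assumes "g \<in> borel_measurable lebesgue" "\<And>v. norm (g v) \<le> K" "\<And>v. r \<le> norm v \<Longrightarrow> g v = 0"
  shows "integrable lebesgue g"
proof (rule Bochner_Integration.integrable_bound)
  show "integrable lebesgue (\<lambda>v. indicat_real (ball (0::'a) r) v * K)"
    by (intro integrable_mult_left integrable_real_indicator)
      (use emeasure_lborel_ball_finite[of "0::'a" r] in auto)
  show "AE v in lebesgue. norm (g v) \<le> norm (indicat_real (ball (0::'a) r) v * K)"
  proof (intro AE_I2)
    fix v :: 'a
    show "norm (g v) \<le> norm (indicat_real (ball (0::'a) r) v * K)"
      using assms(2)[of v] assms(3)[of v] by (cases "norm v < r") auto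
  qed
qed (use assms in auto)

lemma difference_quotient_tendsto:
  fixes \<psi> :: "'a::real_normed_vector \<Rightarrow> real"
  assumes D: "(\<psi> has_derivative D) (at v)" and \<sigma>: "\<sigma> \<longlonglongrightarrow> 0" "\<And>k. \<sigma> k \<noteq> 0"
  shows "(\<lambda>k. (\<psi> (v - \<sigma> k *\<^sub>R u) - \<psi> v) / \<sigma> k) \<longlonglongrightarrow> - D u"
proof -
  interpret D: linear D using D by (rule has_derivative_linear)
  have "((\<lambda>s. \<psi> (v - s *\<^sub>R u)) has_derivative (\<lambda>s. D (- (s *\<^sub>R u)))) (at 0)"
  proof (rule has_derivative_compose[of "\<lambda>s. v - s *\<^sub>R u" "\<lambda>s. - (s *\<^sub>R u)" 0 UNIV \<psi> D])
    show "((\<lambda>s. v - s *\<^sub>R u) has_derivative (\<lambda>s. - (s *\<^sub>R u))) (at 0)"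
      by (rule derivative_eq_intros refl | simp)+
  qed (use D in simp)
  moreover have "(\<lambda>s. D (- (s *\<^sub>R u))) = (*) (- D u)"
    by (auto simp: D.neg D.scale)
  ultimately have "((\<lambda>s. \<psi> (v - s *\<^sub>R u)) has_field_derivative - D u) (at 0)"
    by (simp add: has_field_derivative_def)
  then have "((\<lambda>s. (\<psi> (v - s *\<^sub>R u) - \<psi> v) / s) \<longlongrightarrow> - D u) (at 0)"
    by (simp add: DERIV_def)
  moreover have "filterlim \<sigma> (at 0) sequentially"
    using \<sigma> by (intro filterlim_atI) auto
  ultimately show ?thesis by (rule filterlim_compose)
qed

text \<open>Integration by parts: translating the integration variable moves the difference quotient from
  the function \<open>\<phi>\<close>, about whose differentiability nothing is known, to the test function.\<close>

lemma integral_difference_quotient_tendsto: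
  fixes \<phi> \<psi> :: "'a::euclidean_space \<Rightarrow> real"
  assumes \<phi>: "\<phi> \<in> borel_measurable borel" "\<And>v. \<bar>\<phi> v\<bar> \<le> C" "\<And>v. 1 \<le> norm v \<Longrightarrow> \<phi> v = 0"
    and \<psi>: "\<psi> \<in> borel_measurable borel" "\<And>v w. \<bar>\<psi> v - \<psi> w\<bar> \<le> K * norm (v - w)"
      "\<And>v. 1 \<le> norm v \<Longrightarrow> \<psi> v = 0"
    and D: "AE v in lebesgue. (\<psi> has_derivative D v) (at v)" "(\<lambda>v. D v u) \<in> borel_measurable borel"
    and \<sigma>: "\<sigma> \<longlonglongrightarrow> 0" "\<And>k. \<sigma> k \<noteq> 0"
  shows "(\<lambda>k. \<integral>v. \<psi> v * ((\<phi> (v + \<sigma> k *\<^sub>R u) - \<phi> v) / \<sigma> k) \<partial>lebesgue)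
           \<longlonglongrightarrow> - (\<integral>v. \<phi> v * D v u \<partial>lebesgue)"
proof -
  note [measurable] = \<phi>(1) \<psi>(1) D(2)
  \<comment> \<open>Comparison with a unit vector, where \<open>\<psi>\<close> vanishes and which
    has distance at most 2 from any point of the ball.\<close>
  have \<psi>b: "\<bar>\<psi> v\<bar> \<le> K * 2" for v
  proof -
    obtain w :: 'a where w: "norm w = 1" using vector_choose_size[of 1] by auto
    have "0 \<le> K" using \<psi>(2)[of w 0] w by simp
    show ?thesis
    proof (cases "1 \<le> norm v")
      case True then show ?thesis using \<psi>(3) \<open>0 \<le> K\<close> by auto
    next
      case False
      have "\<bar>\<psi> v - \<psi> w\<bar> \<le> K * norm (v - w)" by (rule \<psi>(2))
      also have "\<dots> \<le> K * 2"
        using norm_triangle_ineq4[of v w] False w \<open>0 \<le> K\<close> by (intro mult_left_mono) auto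
      finally show ?thesis using \<psi>(3)[of w] w by simp
    qed
  qed
  have C0: "0 \<le> C" using \<phi>(2)[of 0] by linarith
  have K0: "0 \<le> K" using \<psi>b[of 0] by linarith
  have shift: "(\<integral>v. \<psi> v * ((\<phi> (v + \<sigma> k *\<^sub>R u) - \<phi> v) / \<sigma> k) \<partial>lebesgue)
      = (\<integral>v. \<phi> v * ((\<psi> (v - \<sigma> k *\<^sub>R u) - \<psi> v) / \<sigma> k) \<partial>lebesgue)" for k
  proof -
    have bd: "\<bar>\<psi> x * \<phi> y\<bar> \<le> K * 2 * C" for x y
      using mult_mono[OF \<psi>b \<phi>(2)] K0 by (simp add: abs_mult)
    have i1: "integrable lebesgue (\<lambda>v. \<psi> v * \<phi> v)"
      by (rule integrable_lebesgue_bounded[where K = "K * 2 * C" and r = 1])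
        (auto simp: \<psi>(3) bd intro!: borel_measurable_lebesgueI)
    have i2: "integrable lebesgue (\<lambda>v. \<psi> v * \<phi> (v + \<sigma> k *\<^sub>R u))"
      by (rule integrable_lebesgue_bounded[where K = "K * 2 * C" and r = 1])
        (auto simp: \<psi>(3) bd intro!: borel_measurable_lebesgueI)
    have i3: "integrable lebesgue (\<lambda>v. \<psi> (v - \<sigma> k *\<^sub>R u) * \<phi> v)"
      by (rule integrable_lebesgue_bounded[where K = "K * 2 * C" and r = 1])
        (auto simp: \<phi>(3) bd intro!: borel_measurable_lebesgueI)
    have "(\<integral>v. \<psi> v * \<phi> (v + \<sigma> k *\<^sub>R u) \<partial>lebesgue)
        = (\<integral>v. \<psi> ((v + \<sigma> k *\<^sub>R u) - \<sigma> k *\<^sub>R u) * \<phi> (v + \<sigma> k *\<^sub>R u) \<partial>lebesgue)" by simp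
    also have "\<dots> = (\<integral>v. \<psi> (v - \<sigma> k *\<^sub>R u) * \<phi> v \<partial>lebesgue)"
      by (rule integral_lebesgue_translation) measurable
    finally have e: "(\<integral>v. \<psi> v * \<phi> (v + \<sigma> k *\<^sub>R u) \<partial>lebesgue)
      = (\<integral>v. \<psi> (v - \<sigma> k *\<^sub>R u) * \<phi> v \<partial>lebesgue)" .
    have "(\<integral>v. \<psi> v * ((\<phi> (v + \<sigma> k *\<^sub>R u) - \<phi> v) / \<sigma> k) \<partial>lebesgue)
        = (\<integral>v. (\<psi> v * \<phi> (v + \<sigma> k *\<^sub>R u) - \<psi> v * \<phi> v) / \<sigma> k \<partial>lebesgue)"
      by (simp add: algebra_simps)
    also have "\<dots> = (\<integral>v. (\<psi> (v - \<sigma> k *\<^sub>R u) * \<phi> v - \<psi> v * \<phi> v) / \<sigma> k \<partial>lebesgue)"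
      using e i1 i2 i3 by simp
    finally show ?thesis by (simp add: algebra_simps)
  qed
  have "(\<lambda>k. \<integral>v. \<phi> v * ((\<psi> (v - \<sigma> k *\<^sub>R u) - \<psi> v) / \<sigma> k) \<partial>lebesgue)
      \<longlonglongrightarrow> (\<integral>v. \<phi> v * (- D v u) \<partial>lebesgue)"
  proof (rule integral_dominated_convergence[where w = "\<lambda>v. indicat_real (ball 0 1) v * (C * (K * norm u))"])
    show "(\<lambda>v. \<phi> v * - D v u) \<in> borel_measurable lebesgue"
      by (intro borel_measurable_lebesgueI) measurable
    show "(\<lambda>v. \<phi> v * ((\<psi> (v - \<sigma> k *\<^sub>R u) - \<psi> v) / \<sigma> k)) \<in> borel_measurable lebesgue" for k
      by (intro borel_measurable_lebesgueI) measurable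
    show "integrable lebesgue (\<lambda>v. indicat_real (ball (0::'a) 1) v * (C * (K * norm u)))"
      by (intro integrable_mult_left integrable_real_indicator)
        (use emeasure_lborel_ball_finite[of "0::'a" 1] in auto)
    show "AE v in lebesgue. (\<lambda>k. \<phi> v * ((\<psi> (v - \<sigma> k *\<^sub>R u) - \<psi> v) / \<sigma> k)) \<longlonglongrightarrow> \<phi> v * - D v u"
      using D(1) by eventually_elim (intro tendsto_mult tendsto_const difference_quotient_tendsto \<sigma>)
    show "AE v in lebesgue. norm (\<phi> v * ((\<psi> (v - \<sigma> k *\<^sub>R u) - \<psi> v) / \<sigma> k))
        \<le> indicat_real (ball 0 1) v * (C * (K * norm u))" for k
    proof (intro AE_I2)
      fix v
      have "\<bar>\<psi> (v - \<sigma> k *\<^sub>R u) - \<psi> v\<bar> \<le> K * (\<bar>\<sigma> k\<bar> * norm u)"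
        using \<psi>(2)[of "v - \<sigma> k *\<^sub>R u" v] by simp
      then have "\<bar>(\<psi> (v - \<sigma> k *\<^sub>R u) - \<psi> v) / \<sigma> k\<bar> \<le> K * norm u"
        using \<sigma>(2)[of k] by (simp add: abs_divide pos_divide_le_eq mult_ac)
      then have "\<bar>\<phi> v\<bar> * \<bar>(\<psi> (v - \<sigma> k *\<^sub>R u) - \<psi> v) / \<sigma> k\<bar> \<le> C * (K * norm u)"
        using \<phi>(2)[of v] C0 by (intro mult_mono) auto
      then show "norm (\<phi> v * ((\<psi> (v - \<sigma> k *\<^sub>R u) - \<psi> v) / \<sigma> k))
          \<le> indicat_real (ball 0 1) v * (C * (K * norm u))"
        using \<phi>(3)[of v] by (cases "norm v < 1") (auto simp: abs_mult)
    qed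
  qed
  then show ?thesis unfolding shift by simp
qed

section \<open>Supergradients of concave functions on the unit ball\<close>

text \<open>Extension by zero gives meaning to translates of \<open>\<phi>\<close>. The jump at the
  sphere is harmless: the test functions live in a smaller ball, from which short steps do not leave
  the unit ball.\<close>

definition ball_ext :: "('a::real_normed_vector \<Rightarrow> real) \<Rightarrow> 'a \<Rightarrow> real" where
  "ball_ext \<phi> v = indicator (ball 0 1) v * \<phi> v"

lemma ball_ext_inside: "norm v < 1 \<Longrightarrow> ball_ext \<phi> v = \<phi> v"
  and ball_ext_outside: "1 \<le> norm v \<Longrightarrow> ball_ext \<phi> v = 0"
  by (auto simp: ball_ext_def)

text \<open>Consecutive radii bound the shells that approach the sphere. The offset 2 makes
  \<open>rad 0\<close> positive.\<close>

definition rad :: "nat \<Rightarrow> real" where "rad j = 1 - 1 / real (j + 2)"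

lemma rad_less: "rad j < 1" "0 < rad j" "rad j < rad (Suc j)"
  by (auto simp: rad_def intro!: divide_strict_left_mono)

lemma rad_tendsto: "rad \<longlonglongrightarrow> 1"
proof -
  have "(\<lambda>j. 1 - 1 / real (j + 2)) \<longlonglongrightarrow> 1 - 0"
    using LIMSEQ_ignore_initial_segment[OF lim_1_over_n, of 2] by (intro tendsto_intros) auto
  then show ?thesis by (simp add: rad_def[abs_def])
qed

abbreviation rim_cutoff :: "nat \<Rightarrow> 'a::real_normed_vector \<Rightarrow> real" where
  "rim_cutoff j \<equiv> cutoff (rad j) (rad (Suc j))"

lemma rim_cutoff_tendsto: "(\<lambda>j. rim_cutoff j v) \<longlonglongrightarrow> indicator (ball 0 1) v"
proof (cases "norm v < 1")
  case True
  have "eventually (\<lambda>j. norm v < rad j) sequentially"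
    using order_tendstoD(1)[OF rad_tendsto True] .
  then have "eventually (\<lambda>j. rim_cutoff j v = 1) sequentially"
    by eventually_elim (simp add: cutoff_eq_1 rad_less)
  then show ?thesis using True by (auto intro: tendsto_eventually)
next
  case False
  then have "rim_cutoff j v = 0" for j
    using rad_less(1)[of "Suc j"] by (intro cutoff_eq_0 rad_less) linarith
  then show ?thesis using False by simp
qed

text \<open>The concave conjugate \<open>\<phi>\<close> of a work function with the minimizers \<open>m\<close>: \<open>- m v\<close> is a
  supergradient of \<open>\<phi>\<close> at \<open>v\<close>. The last assumption reflects that work functions dominate the norm.\<close>

locale dual_pair =
  fixes \<phi> :: "'a::euclidean_space \<Rightarrow> real" and m :: "'a \<Rightarrow> 'a" and C :: real
  assumes supergradient: "\<lbrakk>norm v < 1; norm w < 1\<rbrakk> \<Longrightarrow> \<phi> w \<le> \<phi> v + (v - w) \<bullet> m v"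
    and nonneg: "norm v < 1 \<Longrightarrow> 0 \<le> \<phi> v"
    and upper: "norm v < 1 \<Longrightarrow> \<phi> v \<le> C"
    and norm_m: "norm v < 1 \<Longrightarrow> norm (m v) \<le> \<phi> v + v \<bullet> m v"
begin

lemma C_nonneg: "0 \<le> C"
  using nonneg[of 0] upper[of 0] by simp

lemma norm_m_le: "norm v < 1 \<Longrightarrow> norm (m v) \<le> C / (1 - norm v)"
  using norm_m[of v] upper[of v] norm_cauchy_schwarz[of v "m v"]
  by (simp add: pos_le_divide_eq algebra_simps)

text \<open>A supergradient at every point makes \<open>\<phi>\<close> concave, and finite concave
  functions on an open set are continuous. Measurability of \<open>\<phi>\<close> comes from
  here.\<close>

lemma continuous: "continuous_on (ball 0 1) \<phi>"
proof -
  have "convex_on (ball 0 1) (\<lambda>v. - \<phi> v)"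
  proof (rule convex_onI)
    fix t :: real and x y :: 'a assume t: "0 < t" "t < 1" and xy: "x \<in> ball 0 1" "y \<in> ball 0 1"
    define z where "z = (1 - t) *\<^sub>R x + t *\<^sub>R y"
    have "z \<in> ball 0 1"
      unfolding z_def using xy t by (intro convexD[OF convex_ball]) auto
    then have "\<phi> x \<le> \<phi> z + (z - x) \<bullet> m z" "\<phi> y \<le> \<phi> z + (z - y) \<bullet> m z"
      using xy by (auto intro!: supergradient)
    then have "(1 - t) * \<phi> x + t * \<phi> y \<le> (1 - t) * (\<phi> z + (z - x) \<bullet> m z) + t * (\<phi> z + (z - y) \<bullet> m z)"
      using t by (intro add_mono mult_left_mono) auto
    also have "\<dots> = \<phi> z + (z - ((1 - t) *\<^sub>R x + t *\<^sub>R y)) \<bullet> m z"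
      by (simp add: algebra_simps)
    also have "\<dots> = \<phi> z" by (simp add: z_def)
    finally show "- \<phi> ((1 - t) *\<^sub>R x + t *\<^sub>R y) \<le> (1 - t) * - \<phi> x + t * - \<phi> y"
      by (simp add: z_def)
  qed simp
  then have "continuous_on (ball 0 1) (\<lambda>v. - \<phi> v)"
    by (intro convex_on_continuous) auto
  then show ?thesis using continuous_on_minus by fastforce
qed

lemma ball_ext_measurable [measurable]: "ball_ext \<phi> \<in> borel_measurable borel"
proof -
  have "(\<lambda>v. indicator (ball 0 1) v *\<^sub>R \<phi> v) \<in> borel_measurable borel"
    by (rule borel_measurable_continuous_on_indicator) (auto intro: continuous)
  then show ?thesis by (simp add: ball_ext_def[abs_def])
qed

lemma abs_ball_ext_le: "\<bar>ball_ext \<phi> v\<bar> \<le> C"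
  using nonneg upper C_nonneg by (cases "norm v < 1") (auto simp: ball_ext_def)

lemma forward_quotient_le:
  assumes "norm v < 1" "norm (v + s *\<^sub>R u) < 1" "0 < s"
  shows "(\<phi> (v + s *\<^sub>R u) - \<phi> v) / s \<le> - (m v \<bullet> u)"
  using supergradient[OF assms(1,2)] assms(3) by (simp add: pos_divide_le_eq inner_commute mult.commute)

lemma backward_quotient_ge:
  assumes "norm v < 1" "norm (v + (- s) *\<^sub>R u) < 1" "0 < s"
  shows "- (m v \<bullet> u) \<le> (\<phi> (v + (- s) *\<^sub>R u) - \<phi> v) / (- s)"
proof -
  have "(\<phi> (v + (- s) *\<^sub>R u) - \<phi> v) / s \<le> m v \<bullet> u"
    using supergradient[OF assms(1,2)] assms(3) by (simp add: pos_divide_le_eq inner_commute mult.commute)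
  then show ?thesis by simp
qed

definition quot :: "'a \<Rightarrow> real \<Rightarrow> 'a \<Rightarrow> real" where
  "quot u s v = (ball_ext \<phi> (v + s *\<^sub>R u) - ball_ext \<phi> v) / s"

definition step :: "nat \<Rightarrow> real" where "step k = 1 / real (Suc k)"

lemma step_pos: "0 < step k" and step_tendsto: "step \<longlonglongrightarrow> 0"
  using LIMSEQ_Suc[OF lim_1_over_n] by (auto simp: step_def[abs_def])

text \<open>The width of the interval in which \<open>quot_squeeze\<close> confines
  \<open>- (m v \<bullet> u)\<close>.\<close>

definition gap :: "'a \<Rightarrow> nat \<Rightarrow> 'a \<Rightarrow> real" where
  "gap u k v = quot u (- step k) v - quot u (step k) v"

lemma quot_measurable [measurable]: "quot u s \<in> borel_measurable borel"
  unfolding quot_def by measurable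

lemma gap_measurable [measurable]: "gap u k \<in> borel_measurable borel"
  unfolding gap_def by measurable

lemma quot_bounded: "\<bar>quot u s v\<bar> \<le> 2 * C / \<bar>s\<bar>"
proof -
  have "\<bar>ball_ext \<phi> (v + s *\<^sub>R u) - ball_ext \<phi> v\<bar> \<le> 2 * C"
    using abs_ball_ext_le[of v] abs_ball_ext_le[of "v + s *\<^sub>R u"] by linarith
  then show ?thesis by (simp add: quot_def abs_divide divide_right_mono)
qed

text \<open>The supergradient inequality at \<open>v\<close>, tested one step forward and one step
  backward. The second hypothesis keeps both test points in the unit ball.\<close>

lemma quot_squeeze:
  assumes "norm v < b" "step k * norm u < 1 - b"
  shows "quot u (step k) v \<le> - (m v \<bullet> u)" "- (m v \<bullet> u) \<le> quot u (- step k) v"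
proof -
  have s: "0 < step k" by (rule step_pos)
  then have "0 \<le> step k * norm u" by simp
  then have v: "norm v < 1" using assms by linarith
  have n: "norm (v + step k *\<^sub>R u) < 1" "norm (v + (- step k) *\<^sub>R u) < 1"
    using norm_triangle_ineq[of v "step k *\<^sub>R u"] norm_triangle_ineq[of v "(- step k) *\<^sub>R u"] assms s
    by auto
  show "quot u (step k) v \<le> - (m v \<bullet> u)"
    using forward_quotient_le[OF v n(1) s] by (simp only: quot_def ball_ext_inside v n)
  show "- (m v \<bullet> u) \<le> quot u (- step k) v"
    using backward_quotient_ge[OF v n(2) s] by (simp only: quot_def ball_ext_inside v n)
qed

lemma eventually_step: "b < 1 \<Longrightarrow> eventually (\<lambda>k. step k * norm u < 1 - b) sequentially"
proof -
  assume "b < 1"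
  have "(\<lambda>k. step k * norm u) \<longlonglongrightarrow> 0 * norm u" by (intro tendsto_intros step_tendsto)
  from order_tendstoD(2)[OF this, of "1 - b"] \<open>b < 1\<close> show ?thesis by simp
qed

section \<open>Difference quotients under a fixed cutoff\<close>

context
  fixes a b :: real
  assumes ab: "0 < a" "a < b" "b < 1"
begin

lemma cutoff_quot_tendsto:
  fixes \<psi> :: "'a \<Rightarrow> real"
  assumes "\<psi> \<in> borel_measurable borel" "\<And>v w. \<bar>\<psi> v - \<psi> w\<bar> \<le> K * norm (v - w)"
      "\<And>v. \<bar>\<psi> v\<bar> \<le> cutoff a b v"
    and "AE v in lebesgue. (\<psi> has_derivative D v) (at v)" "(\<lambda>v. D v u) \<in> borel_measurable borel"
    and "\<sigma> = step \<or> \<sigma> = (\<lambda>k. - step k)"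
  shows "(\<lambda>k. \<integral>v. \<psi> v * quot u (\<sigma> k) v \<partial>lebesgue) \<longlonglongrightarrow> - (\<integral>v. ball_ext \<phi> v * D v u \<partial>lebesgue)"
  unfolding quot_def
proof (rule integral_difference_quotient_tendsto)
  show "\<sigma> \<longlonglongrightarrow> 0" using assms(6) tendsto_minus[OF step_tendsto] step_tendsto by auto
  show "\<sigma> k \<noteq> 0" for k using assms(6) step_pos[of k] by auto
  show "\<psi> v = 0" if "1 \<le> norm v" for v
    using assms(3)[of v] cutoff_eq_0[of a b v] ab that by simp
qed (use assms abs_ball_ext_le ball_ext_outside ball_ext_measurable in auto)

lemma integrable_cutoff_quot:
  assumes "\<psi> \<in> borel_measurable borel" "\<And>v. \<bar>\<psi> v\<bar> \<le> cutoff a b v"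
  shows "integrable lebesgue (\<lambda>v. \<psi> v * quot u s v)"
proof (rule integrable_lebesgue_bounded[where K = "1 * (2 * C / \<bar>s\<bar>)" and r = b])
  show "(\<lambda>v. \<psi> v * quot u s v) \<in> borel_measurable lebesgue"
    using assms(1) quot_measurable by (intro borel_measurable_lebesgueI borel_measurable_times)
  show "norm (\<psi> v * quot u s v) \<le> 1 * (2 * C / \<bar>s\<bar>)" for v
    unfolding norm_mult using assms(2)[of v] cutoff_bounds[of a b v] quot_bounded[of u s v]
    by (intro mult_mono) auto
  show "\<psi> v * quot u s v = 0" if "b \<le> norm v" for v
    using assms(2)[of v] cutoff_eq_0[of a b v] ab that by simp
qed

lemma cutoff_gap_nonneg: "step k * norm u < 1 - b \<Longrightarrow> 0 \<le> cutoff a b v * gap u k v"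
proof (cases "norm v < b")
  case True
  assume "step k * norm u < 1 - b"
  from quot_squeeze[OF True this] show ?thesis by (simp add: gap_def cutoff_bounds)
qed (simp add: cutoff_eq_0 ab)

lemma integrable_cutoff_gap: "integrable lebesgue (\<lambda>v. cutoff a b v * gap u k v)"
  using integrable_cutoff_quot[of "cutoff a b" u "- step k"] integrable_cutoff_quot[of "cutoff a b" u "step k"]
  by (simp add: gap_def right_diff_distrib cutoff_bounds)

text \<open>Steps of either sign lead to the same limit once the quotient has been moved to the
  cutoff, so the difference of the two integrals vanishes. This stands in for almost everywhere
  differentiability of concave functions.\<close>

lemma cutoff_gap_tendsto_0: "(\<lambda>k. \<integral>v. cutoff a b v * gap u k v \<partial>lebesgue) \<longlonglongrightarrow> 0"
proof -
  have *: "(\<lambda>k. \<integral>v. cutoff a b v * quot u (\<sigma> k) v \<partial>lebesgue)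
     \<longlonglongrightarrow> - (\<integral>v. ball_ext \<phi> v * cutoff_slope a b v u \<partial>lebesgue)"
    if "\<sigma> = step \<or> \<sigma> = (\<lambda>k. - step k)" for \<sigma>
    using cutoff_Lipschitz[OF ab(2)] that ab
    by (intro cutoff_quot_tendsto[where K = "1 / (b - a)"] AE_has_derivative_cutoff)
      (auto simp: cutoff_bounds)
  have "(\<lambda>k. (\<integral>v. cutoff a b v * quot u (- step k) v \<partial>lebesgue)
      - (\<integral>v. cutoff a b v * quot u (step k) v \<partial>lebesgue)) \<longlonglongrightarrow> 0"
    using tendsto_diff[OF *[of "\<lambda>k. - step k"] *[of step]] by simp
  moreover have "(\<integral>v. cutoff a b v * gap u k v \<partial>lebesgue) = (\<integral>v. cutoff a b v * quot u (- step k) v \<partial>lebesgue)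
      - (\<integral>v. cutoff a b v * quot u (step k) v \<partial>lebesgue)" for k
    using integrable_cutoff_quot[of "cutoff a b" u "- step k"] integrable_cutoff_quot[of "cutoff a b" u "step k"]
    by (simp add: gap_def right_diff_distrib cutoff_bounds)
  ultimately show ?thesis by simp
qed

lemma cutoff_gap_AE_subseq:
  obtains r :: "nat \<Rightarrow> nat" where "strict_mono r"
    "AE v in lebesgue. (\<lambda>k. cutoff a b v * gap u (r k) v) \<longlonglongrightarrow> 0"
proof -
  \<comment> \<open>For small steps the integrand is nonnegative, so convergence of the integrals to
    0 is convergence in L1.\<close>
  have "(\<lambda>k. \<integral>v. norm (cutoff a b v * gap u k v) \<partial>lebesgue) \<longlonglongrightarrow> 0"
  proof (rule Lim_transform_eventually[OF cutoff_gap_tendsto_0[of u]])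
    show "\<forall>\<^sub>F k in sequentially. (\<integral>v. cutoff a b v * gap u k v \<partial>lebesgue)
        = (\<integral>v. norm (cutoff a b v * gap u k v) \<partial>lebesgue)"
      using eventually_step[OF ab(3), of u]
      by eventually_elim (simp only: real_norm_def abs_of_nonneg cutoff_gap_nonneg)
  qed
  from tendsto_L1_AE_subseq[OF integrable_cutoff_gap this] that show ?thesis by blast
qed

text \<open>No measurability of \<open>m\<close> is assumed. It agrees almost everywhere with a
  limit of measurable difference quotients, and Lebesgue measure is complete.\<close>

lemma measurable_cutoff_m: "(\<lambda>v. cutoff a b v * (m v \<bullet> u)) \<in> borel_measurable lebesgue"
proof -
  obtain r where r: "strict_mono r" "AE v in lebesgue. (\<lambda>k. cutoff a b v * gap u (r k) v) \<longlonglongrightarrow> 0"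
    by (rule cutoff_gap_AE_subseq)
  have ev: "eventually (\<lambda>k. step (r k) * norm u < 1 - b) sequentially"
    using eventually_subseq[OF r(1) eventually_step[OF ab(3), of u]] .
  have "(\<lambda>v. lim (\<lambda>k. - (cutoff a b v * quot u (step (r k)) v))) \<in> borel_measurable lebesgue"
    by (intro borel_measurable_lim_metric borel_measurable_lebesgueI) measurable
  moreover have "AE v in lebesgue. lim (\<lambda>k. - (cutoff a b v * quot u (step (r k)) v)) = cutoff a b v * (m v \<bullet> u)"
    using r(2)
  proof eventually_elim
    case (elim v)
    have "(\<lambda>k. cutoff a b v * (m v \<bullet> u) - - (cutoff a b v * quot u (step (r k)) v)) \<longlonglongrightarrow> 0"
    proof (rule Lim_null_comparison[OF _ elim])
      show "\<forall>\<^sub>F k in sequentially. norm (cutoff a b v * (m v \<bullet> u) - - (cutoff a b v * quot u (step (r k)) v))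
            \<le> cutoff a b v * gap u (r k) v"
        using ev
      proof eventually_elim
        case (elim k)
        show ?case
        proof (cases "norm v < b")
          case True
          from quot_squeeze[OF True elim] have "\<bar>m v \<bullet> u + quot u (step (r k)) v\<bar> \<le> gap u (r k) v"
            unfolding gap_def by linarith
          then have "cutoff a b v * \<bar>m v \<bullet> u + quot u (step (r k)) v\<bar> \<le> cutoff a b v * gap u (r k) v"
            by (intro mult_left_mono) (auto simp: cutoff_bounds)
          moreover have "cutoff a b v * \<bar>m v \<bullet> u + quot u (step (r k)) v\<bar>
            = norm (cutoff a b v * (m v \<bullet> u) - - (cutoff a b v * quot u (step (r k)) v))"
            using cutoff_bounds[of a b v] by (simp add: abs_mult distrib_left[symmetric])
          ultimately show ?thesis by simp
        qed (simp add: cutoff_eq_0 ab)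
      qed
    qed
    then have "(\<lambda>k. cutoff a b v * (m v \<bullet> u) - (cutoff a b v * (m v \<bullet> u) - - (cutoff a b v * quot u (step (r k)) v)))
        \<longlonglongrightarrow> cutoff a b v * (m v \<bullet> u) - 0"
      by (intro tendsto_intros)
    then show ?case by (intro limI) simp
  qed
  ultimately show ?thesis by (rule borel_measurable_AE)
qed

lemma cutoff_m_bounded: "norm (cutoff a b v * (m v \<bullet> u)) \<le> C / (1 - b) * norm u"
proof (cases "norm v < b")
  case True
  have "norm (m v) \<le> C / (1 - norm v)" using True ab by (intro norm_m_le) auto
  also have "\<dots> \<le> C / (1 - b)" using True ab C_nonneg by (intro divide_left_mono) auto
  finally have "\<bar>m v \<bullet> u\<bar> \<le> C / (1 - b) * norm u"
    using Cauchy_Schwarz_ineq2[of "m v" u] mult_right_mono[of "norm (m v)" "C / (1 - b)" "norm u"] by simp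
  moreover have "cutoff a b v * \<bar>m v \<bullet> u\<bar> \<le> 1 * \<bar>m v \<bullet> u\<bar>"
    by (intro mult_right_mono cutoff_bounds) auto
  ultimately show ?thesis using cutoff_bounds[of a b v] by (simp add: abs_mult)
qed (use C_nonneg ab in \<open>simp add: cutoff_eq_0\<close>)

lemma integrable_cutoff_m: "integrable lebesgue (\<lambda>v. cutoff a b v * (m v \<bullet> u))"
  using cutoff_m_bounded ab
  by (intro integrable_lebesgue_bounded[where r = b] measurable_cutoff_m) (auto simp: cutoff_eq_0)

text \<open>For \<open>quot\<close> in place of \<open>- m\<close> the identity holds in the limit
  by translation. The replacement costs at most the integral of
  \<open>cutoff a b v * gap u k v\<close>, which vanishes. The factor \<open>\<eta>\<close> will be
  1 or a coordinate.\<close>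

lemma integral_cutoff_m:
  assumes \<psi>: "\<psi> \<in> borel_measurable borel" "\<And>v w. \<bar>\<psi> v - \<psi> w\<bar> \<le> K * norm (v - w)"
      "\<And>v. \<psi> v = \<eta> v * cutoff a b v" "\<And>v. norm v < 1 \<Longrightarrow> \<bar>\<eta> v\<bar> \<le> 1" "\<eta> \<in> borel_measurable borel"
    and D: "AE v in lebesgue. (\<psi> has_derivative D v) (at v)" "(\<lambda>v. D v u) \<in> borel_measurable borel"
  shows "integrable lebesgue (\<lambda>v. \<psi> v * (m v \<bullet> u))"
    "(\<integral>v. \<psi> v * (m v \<bullet> u) \<partial>lebesgue) = (\<integral>v. ball_ext \<phi> v * D v u \<partial>lebesgue)"
proof -
  have le: "\<bar>\<psi> v\<bar> \<le> cutoff a b v" for v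
  proof (cases "norm v < 1")
    case True
    then show ?thesis using \<psi>(4)[of v] mult_right_mono[of "\<bar>\<eta> v\<bar>" 1 "cutoff a b v"] cutoff_bounds[of a b v]
      by (simp add: \<psi>(3) abs_mult)
  next
    case False
    then show ?thesis using ab by (simp add: \<psi>(3) cutoff_eq_0)
  qed
  have int: "integrable lebesgue (\<lambda>v. \<psi> v * (m v \<bullet> u))"
  proof (rule Bochner_Integration.integrable_bound[OF integrable_cutoff_m[of u]])
    have "(\<lambda>v. \<eta> v * (cutoff a b v * (m v \<bullet> u))) \<in> borel_measurable lebesgue"
      using measurable_cutoff_m[of u] borel_measurable_lebesgueI[OF \<psi>(5)] by (rule borel_measurable_times[rotated])
    then show "(\<lambda>v. \<psi> v * (m v \<bullet> u)) \<in> borel_measurable lebesgue" by (simp add: \<psi>(3) mult.assoc)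
    show "AE v in lebesgue. norm (\<psi> v * (m v \<bullet> u)) \<le> norm (cutoff a b v * (m v \<bullet> u))"
      using le by (intro AE_I2) (auto simp: abs_mult cutoff_bounds intro!: mult_right_mono)
  qed
  then show "integrable lebesgue (\<lambda>v. \<psi> v * (m v \<bullet> u))" .
  have lim1: "(\<lambda>k. \<integral>v. \<psi> v * quot u (step k) v \<partial>lebesgue) \<longlonglongrightarrow> - (\<integral>v. ball_ext \<phi> v * D v u \<partial>lebesgue)"
    by (rule cutoff_quot_tendsto[OF \<psi>(1,2) le D]) auto
  have "(\<lambda>k. (\<integral>v. \<psi> v * quot u (step k) v \<partial>lebesgue) - - (\<integral>v. \<psi> v * (m v \<bullet> u) \<partial>lebesgue)) \<longlonglongrightarrow> 0"
  proof (rule Lim_null_comparison[OF _ cutoff_gap_tendsto_0[of u]])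
    show "\<forall>\<^sub>F k in sequentially. norm ((\<integral>v. \<psi> v * quot u (step k) v \<partial>lebesgue) - - (\<integral>v. \<psi> v * (m v \<bullet> u) \<partial>lebesgue))
       \<le> (\<integral>v. cutoff a b v * gap u k v \<partial>lebesgue)"
      using eventually_step[OF ab(3), of u]
    proof eventually_elim
      case (elim k)
      have "(\<integral>v. \<psi> v * quot u (step k) v \<partial>lebesgue) - - (\<integral>v. \<psi> v * (m v \<bullet> u) \<partial>lebesgue)
          = (\<integral>v. \<psi> v * quot u (step k) v + \<psi> v * (m v \<bullet> u) \<partial>lebesgue)"
        using int integrable_cutoff_quot[OF \<psi>(1) le, of u "step k"] by simp
      also have "norm \<dots> \<le> (\<integral>v. cutoff a b v * gap u k v \<partial>lebesgue)"
      proof (rule Bochner_Integration.integral_norm_bound_integral)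
        show "integrable lebesgue (\<lambda>v. \<psi> v * quot u (step k) v + \<psi> v * (m v \<bullet> u))"
          using int integrable_cutoff_quot[OF \<psi>(1) le, of u "step k"] by simp
        fix v
        show "norm (\<psi> v * quot u (step k) v + \<psi> v * (m v \<bullet> u)) \<le> cutoff a b v * gap u k v"
        proof (cases "norm v < b")
          case True
          from quot_squeeze[OF True elim] have "\<bar>quot u (step k) v + m v \<bullet> u\<bar> \<le> gap u k v"
            unfolding gap_def by linarith
          then have "\<bar>\<psi> v\<bar> * \<bar>quot u (step k) v + m v \<bullet> u\<bar> \<le> cutoff a b v * gap u k v"
            using le[of v] by (intro mult_mono) (auto simp: cutoff_bounds)
          then show ?thesis by (simp add: distrib_left[symmetric] abs_mult)
        qed (use le[of v] ab in \<open>simp add: cutoff_eq_0\<close>)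
      qed (rule integrable_cutoff_gap)
      finally show ?case .
    qed
  qed
  then have "(\<lambda>k. \<integral>v. \<psi> v * quot u (step k) v \<partial>lebesgue) \<longlonglongrightarrow> - (\<integral>v. \<psi> v * (m v \<bullet> u) \<partial>lebesgue)"
    by (rule LIM_zero_cancel)
  with lim1 show "(\<integral>v. \<psi> v * (m v \<bullet> u) \<partial>lebesgue) = (\<integral>v. ball_ext \<phi> v * D v u \<partial>lebesgue)"
    using LIMSEQ_unique by fastforce
qed

lemma integral_cutoff_slope:
  "(\<integral>v. cutoff a b v * (m v \<bullet> u) \<partial>lebesgue) = (\<integral>v. ball_ext \<phi> v * cutoff_slope a b v u \<partial>lebesgue)"
  using cutoff_Lipschitz[OF ab(2)] ab
  by (intro integral_cutoff_m(2)[where K = "1 / (b - a)" and \<eta> = "\<lambda>v. 1"] AE_has_derivative_cutoff) auto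

end

end

lemma rim_cutoff_ab: "0 < rad j" "rad j < rad (Suc j)" "rad (Suc j) < 1"
  using rad_less by auto

lemma exists_rad_gt: "norm v < 1 \<Longrightarrow> \<exists>j. norm v < rad j"
  using eventually_happens'[OF sequentially_bot order_tendstoD(1)[OF rad_tendsto, of "norm v"]] by blast

text \<open>The product estimate needs one of the two points in the unit ball, where the coordinate
  is bounded by 1. If both lie outside, both cutoffs vanish.\<close>

lemma cutoff_coordinate_Lipschitz:
  fixes v w e :: "'a::euclidean_space"
  assumes "a < b" "b < 1" "norm e = 1"
  shows "\<bar>cutoff a b v * (v \<bullet> e) - cutoff a b w * (w \<bullet> e)\<bar> \<le> (1 + 1 / (b - a)) * norm (v - w)"
proof -
  have *: "\<bar>cutoff a b v * (v \<bullet> e) - cutoff a b w * (w \<bullet> e)\<bar> \<le> (1 + 1 / (b - a)) * norm (v - w)"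
    if "norm w \<le> 1" for v w :: 'a
  proof -
    have "\<bar>(v - w) \<bullet> e\<bar> \<le> norm (v - w)" "\<bar>w \<bullet> e\<bar> \<le> 1"
      using Cauchy_Schwarz_ineq2[of "v - w" e] Cauchy_Schwarz_ineq2[of w e] assms that by auto
    moreover have "\<bar>cutoff a b v\<bar> \<le> 1" using cutoff_bounds[of a b v] by simp
    ultimately have "\<bar>cutoff a b v * ((v - w) \<bullet> e)\<bar> \<le> 1 * norm (v - w)"
      "\<bar>(cutoff a b v - cutoff a b w) * (w \<bullet> e)\<bar> \<le> (norm (v - w) / (b - a)) * 1"
      using cutoff_Lipschitz[OF assms(1), of v w] assms(1) unfolding abs_mult by (intro mult_mono; simp)+
    moreover have "cutoff a b v * (v \<bullet> e) - cutoff a b w * (w \<bullet> e)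
        = cutoff a b v * ((v - w) \<bullet> e) + (cutoff a b v - cutoff a b w) * (w \<bullet> e)"
      by (simp add: algebra_simps)
    ultimately show ?thesis by (simp add: distrib_right)
  qed
  consider "norm w \<le> 1" | "norm v \<le> 1" | "norm w > 1" "norm v > 1" by linarith
  then show ?thesis
  proof cases
    case 1
    then show ?thesis by (rule *)
  next
    case 2
    show ?thesis using *[OF 2, of w] unfolding norm_minus_commute[of w v]
      by (subst abs_minus_commute) assumption
  next
    case 3
    then have "cutoff a b v = 0" "cutoff a b w = 0" using assms by (intro cutoff_eq_0; linarith)+
    moreover have "0 \<le> 1 + 1 / (b - a)" using assms by simp
    ultimately show ?thesis by simp
  qed
qed

lemma cutoff_slope_sum:
  "(\<Sum>e\<in>Basis. cutoff_slope a b v e * (v \<bullet> e)) = cutoff_slope a b v (v::'a::euclidean_space)"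
proof -
  have "(\<Sum>e\<in>Basis. cutoff_slope a b v e * (v \<bullet> e))
     = (if a < norm v \<and> norm v < b then - ((\<Sum>e\<in>Basis. (v \<bullet> e) * (v \<bullet> e)) / norm v) / (b - a) else 0)"
    by (auto simp: cutoff_slope_def sum_divide_distrib sum_negf)
  then show ?thesis by (simp add: cutoff_slope_def euclidean_inner[of v v])
qed

lemma integral_indicator_ball:
  "(\<integral>v. indicat_real (ball (0::'a) 1) v * K \<partial>lebesgue) = measure lebesgue (ball (0::'a::euclidean_space) 1) * K"
  by simp

lemma integrable_indicator_ball: "integrable lebesgue (\<lambda>v::'a::euclidean_space. indicat_real (ball 0 1) v * K)"
  by (intro integrable_mult_left integrable_real_indicator)
    (use emeasure_lborel_ball_finite[of "0::'a" 1] in auto)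

section \<open>Stability and integrability of supergradients\<close>

context dual_pair
begin

text \<open>Each rim has its own subsequence and its own null set. Every point of the open ball lies
  inside some rim, so countably many null sets suffice.\<close>

lemma AE_gap_small:
  "AE v in lebesgue. norm v < 1 \<longrightarrow> (\<forall>\<epsilon>>0. \<exists>k. step k * norm u < 1 - norm v \<and> gap u k v < \<epsilon>)"
proof -
  have "\<exists>r. strict_mono r \<and> (AE v in lebesgue. (\<lambda>k. rim_cutoff j v * gap u (r k) v) \<longlonglongrightarrow> 0)" for j
    by (rule cutoff_gap_AE_subseq[OF rim_cutoff_ab, of j u]) blast
  then have "\<exists>r. \<forall>j. strict_mono (r j) \<and> (AE v in lebesgue. (\<lambda>k. rim_cutoff j v * gap u (r j k) v) \<longlonglongrightarrow> 0)"
    by (intro choice) blast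
  then obtain r where r: "\<And>j. strict_mono (r j)"
    "\<And>j. AE v in lebesgue. (\<lambda>k. rim_cutoff j v * gap u (r j k) v) \<longlonglongrightarrow> 0"
    by blast
  have "AE v in lebesgue. \<forall>j. (\<lambda>k. rim_cutoff j v * gap u (r j k) v) \<longlonglongrightarrow> 0"
    using r(2) by (simp add: AE_all_countable)
  then show ?thesis
  proof eventually_elim
    case (elim v)
    show ?case
    proof (intro impI allI)
      fix \<epsilon> :: real assume v: "norm v < 1" and "\<epsilon> > 0"
      obtain j where "norm v < rad j" using exists_rad_gt[OF v] by blast
      then have j: "norm v < rad (Suc j)" using rim_cutoff_ab(2)[of j] by linarith
      have pos: "0 < rim_cutoff j v" using j by (intro cutoff_pos rim_cutoff_ab)
      have "eventually (\<lambda>k. rim_cutoff j v * gap u (r j k) v < rim_cutoff j v * \<epsilon>) sequentially"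
        using elim pos \<open>\<epsilon> > 0\<close> by (intro order_tendstoD(2)) auto
      moreover have "eventually (\<lambda>k. step (r j k) * norm u < 1 - norm v) sequentially"
        using eventually_subseq[OF r(1) eventually_step[OF v, of u]] .
      ultimately have "eventually (\<lambda>k. step (r j k) * norm u < 1 - norm v \<and> gap u (r j k) v < \<epsilon>) sequentially"
        by eventually_elim (use pos in auto)
      then show "\<exists>k. step k * norm u < 1 - norm v \<and> gap u k v < \<epsilon>"
        using eventually_happens'[OF sequentially_bot] by blast
    qed
  qed
qed

text \<open>Testing an approximate supergradient \<open>- z\<close> at
  \<open>v + s *\<^sub>R u\<close> and at \<open>v - s *\<^sub>R u\<close> confines
  \<open>- (z \<bullet> u)\<close> to the interval that contains \<open>- (m v \<bullet> u)\<close>,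
  widened by \<open>\<delta> / s\<close> at both ends. Where the gap gets arbitrarily small, this
  forces \<open>z\<close> close to \<open>m v\<close>; exact supergradients are unique
  there.\<close>

lemma AE_supergradient_stable:
  "AE v in lebesgue. norm v < 1 \<longrightarrow> (\<forall>\<epsilon>>0. \<exists>\<delta>>0. \<forall>z.
     (\<forall>w. norm w < 1 \<longrightarrow> \<phi> w \<le> \<phi> v + \<delta> + (v - w) \<bullet> z) \<longrightarrow> norm (z - m v) \<le> \<epsilon>)"
proof -
  have "AE v in lebesgue. \<forall>u\<in>Basis. norm v < 1 \<longrightarrow>
      (\<forall>\<epsilon>>0. \<exists>k. step k * norm u < 1 - norm v \<and> gap u k v < \<epsilon>)"
    by (intro AE_finite_allI AE_gap_small) simp
  then show ?thesis
  proof eventually_elim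
    case (elim v)
    show ?case
    proof (intro impI allI)
      fix \<epsilon> :: real assume v: "norm v < 1" and \<epsilon>: "\<epsilon> > 0"
      \<comment> \<open>Each of the \<open>DIM('a)\<close> coordinates may differ by
        \<open>2 * \<epsilon>'\<close>: once for the gap and once for
        \<open>\<delta> / s\<close>.\<close>
      define \<epsilon>' where "\<epsilon>' = \<epsilon> / (2 * DIM('a))"
      have \<epsilon>': "\<epsilon>' > 0" using \<epsilon> by (simp add: \<epsilon>'_def)
      obtain k where k: "\<And>u. u \<in> Basis \<Longrightarrow> step (k u) * norm u < 1 - norm v"
          "\<And>u. u \<in> Basis \<Longrightarrow> gap u (k u) v < \<epsilon>'"
      proof -
        have "\<exists>k. u \<in> Basis \<longrightarrow> step k * norm u < 1 - norm v \<and> gap u k v < \<epsilon>'" for u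
          using elim v \<epsilon>' by blast
        then have "\<exists>k. \<forall>u. u \<in> Basis \<longrightarrow> step (k u) * norm u < 1 - norm v \<and> gap u (k u) v < \<epsilon>'"
          by (intro choice) blast
        then show thesis using that by blast
      qed
      define \<delta> where "\<delta> = Min ((\<lambda>u. step (k u) * \<epsilon>') ` Basis)"
      have \<delta>_le: "\<delta> \<le> step (k u) * \<epsilon>'" if "u \<in> Basis" for u
        unfolding \<delta>_def using that by (intro Min_le) auto
      have "\<delta> > 0" unfolding \<delta>_def using \<epsilon>' step_pos by (subst Min_gr_iff) auto
      moreover have "norm (z - m v) \<le> \<epsilon>"
        if z: "\<forall>w. norm w < 1 \<longrightarrow> \<phi> w \<le> \<phi> v + \<delta> + (v - w) \<bullet> z" for z
      proof -
        have "\<bar>(z - m v) \<bullet> u\<bar> \<le> 2 * \<epsilon>'" if u: "u \<in> Basis" for u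
        proof -
          define s where "s = step (k u)"
          have s: "s > 0" by (simp add: s_def step_pos)
          have sn: "s * norm u < 1 - norm v" using k(1)[OF u] by (simp add: s_def)
          have n: "norm (v + s *\<^sub>R u) < 1" "norm (v + (- s) *\<^sub>R u) < 1"
            using norm_triangle_ineq[of v "s *\<^sub>R u"] norm_triangle_ineq[of v "(- s) *\<^sub>R u"] sn s by auto
          note le1 = z[rule_format, OF n(1)] and le2 = z[rule_format, OF n(2)]
          define p q where "p = (\<phi> (v + s *\<^sub>R u) - \<phi> v) / s" and "q = (\<phi> (v + (- s) *\<^sub>R u) - \<phi> v) / (- s)"
          have ds: "\<delta> / s \<le> \<epsilon>'" using \<delta>_le[OF u] s by (simp add: pos_divide_le_eq s_def mult.commute)
          have "p \<le> \<delta> / s - z \<bullet> u"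
            using le1 s divide_right_mono[of "\<phi> (v + s *\<^sub>R u) - \<phi> v" "\<delta> - s * (z \<bullet> u)" s]
            by (simp add: p_def diff_divide_distrib inner_commute)
          moreover have "- (\<delta> / s) - z \<bullet> u \<le> q"
            using le2 s divide_right_mono[of "\<phi> (v + (- s) *\<^sub>R u) - \<phi> v" "\<delta> + s * (z \<bullet> u)" s]
            by (simp add: q_def diff_divide_distrib add_divide_distrib inner_commute)
          moreover have "p \<le> - (m v \<bullet> u)" "- (m v \<bullet> u) \<le> q"
            using forward_quotient_le[OF v n(1) s] backward_quotient_ge[OF v n(2) s] by (auto simp: p_def q_def)
          moreover have "q - p < \<epsilon>'"
            using k(2)[OF u] unfolding gap_def quot_def s_def[symmetric] p_def q_def
            by (simp only: ball_ext_inside v n)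
          ultimately show ?thesis using ds unfolding inner_diff_left by linarith
        qed
        then have "(\<Sum>u\<in>Basis. \<bar>(z - m v) \<bullet> u\<bar>) \<le> (\<Sum>u\<in>(Basis::'a set). 2 * \<epsilon>')" by (intro sum_mono)
        also have "\<dots> = \<epsilon>" by (simp add: \<epsilon>'_def)
        finally show ?thesis using norm_le_l1[of "z - m v"] by linarith
      qed
      ultimately show "\<exists>\<delta>>0. \<forall>z. (\<forall>w. norm w < 1 \<longrightarrow> \<phi> w \<le> \<phi> v + \<delta> + (v - w) \<bullet> z) \<longrightarrow> norm (z - m v) \<le> \<epsilon>"
        by blast
    qed
  qed
qed

text \<open>Integration by parts in every coordinate turns the radial integral into that of
  \<open>\<phi>\<close> against the divergence of the field
  \<open>rim_cutoff j v *\<^sub>R v\<close>. This divergence is \<open>DIM('a)\<close> times the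
  cutoff plus a slope term, nonpositive because the cutoff decreases radially. Hence the bound does
  not depend on \<open>j\<close>, although the slopes blow up.\<close>

lemma integral_rim_cutoff_radial:
  fixes j :: nat
  shows "integrable lebesgue (\<lambda>v. rim_cutoff j v * (v \<bullet> m v))"
    "(\<integral>v. rim_cutoff j v * (v \<bullet> m v) \<partial>lebesgue) \<le> measure lebesgue (ball (0::'a) 1) * (C * DIM('a))"
proof -
  define a b where "a = rad j" and "b = rad (Suc j)"
  have ab: "0 < a" "a < b" "b < 1" using rim_cutoff_ab by (auto simp: a_def b_def)
  define D where "D = (\<lambda>e v u::'a. cutoff_slope a b v u * (v \<bullet> e) + cutoff a b v * (u \<bullet> e))"
  have D: "AE v in lebesgue. ((\<lambda>v. cutoff a b v * (v \<bullet> e)) has_derivative D e v) (at v)" for e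
    using AE_has_derivative_cutoff[OF ab(1,2)]
  proof eventually_elim
    case (elim v)
    have "((\<lambda>v. v \<bullet> e) has_derivative (\<lambda>u. u \<bullet> e)) (at v)"
      by (rule bounded_linear_imp_has_derivative) (rule bounded_linear_inner_left)
    from has_derivative_mult[OF elim this] show ?case
      unfolding D_def by (simp add: add.commute)
  qed
  have m: "(\<lambda>v. D e v u) \<in> borel_measurable borel" for e u unfolding D_def by measurable
  have \<eta>: "\<bar>v \<bullet> e\<bar> \<le> 1" if "norm v < 1" "e \<in> Basis" for v e :: 'a
    using Basis_le_norm[OF that(2), of v] that by simp
  note * = integral_cutoff_m[OF ab, where \<psi> = "\<lambda>v. cutoff a b v * (v \<bullet> e)" and \<eta> = "\<lambda>v. v \<bullet> e"
      and K = "1 + 1 / (b - a)" and u = e and D = "D e" for e]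
  have int: "integrable lebesgue (\<lambda>v. cutoff a b v * (v \<bullet> e) * (m v \<bullet> e))"
    and eq: "(\<integral>v. cutoff a b v * (v \<bullet> e) * (m v \<bullet> e) \<partial>lebesgue) = (\<integral>v. ball_ext \<phi> v * D e v e \<partial>lebesgue)"
    if e: "e \<in> Basis" for e
  proof -
    show "integrable lebesgue (\<lambda>v. cutoff a b v * (v \<bullet> e) * (m v \<bullet> e))"
      "(\<integral>v. cutoff a b v * (v \<bullet> e) * (m v \<bullet> e) \<partial>lebesgue) = (\<integral>v. ball_ext \<phi> v * D e v e \<partial>lebesgue)"
      using cutoff_coordinate_Lipschitz[OF ab(2,3), of e] e
      by (rule_tac * ; simp add: m \<eta> D)+
  qed
  have sum_eq: "cutoff a b v * (v \<bullet> m v) = (\<Sum>e\<in>Basis. cutoff a b v * (v \<bullet> e) * (m v \<bullet> e))" for v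
    by (simp add: euclidean_inner[of v "m v"] sum_distrib_left mult.assoc)
  show "integrable lebesgue (\<lambda>v. rim_cutoff j v * (v \<bullet> m v))"
    unfolding a_def[symmetric] b_def[symmetric] sum_eq by (intro Bochner_Integration.integrable_sum int)
  have slope_int: "integrable lebesgue (\<lambda>v. ball_ext \<phi> v * D e v e)" if e: "e \<in> Basis" for e
  proof (rule integrable_lebesgue_bounded[where r = 1 and K = "C * (1 / (b - a) + 1)"])
    show "(\<lambda>v. ball_ext \<phi> v * D e v e) \<in> borel_measurable lebesgue"
      by (intro borel_measurable_lebesgueI borel_measurable_times m ball_ext_measurable)
    show "norm (ball_ext \<phi> v * D e v e) \<le> C * (1 / (b - a) + 1)" for v
    proof (cases "norm v < 1")
      case True
      have "\<bar>cutoff_slope a b v e * (v \<bullet> e)\<bar> \<le> 1 / (b - a) * 1"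
        unfolding abs_mult using abs_cutoff_slope[OF ab(2), of v e] e \<eta>[OF True e] ab
        by (intro mult_mono) auto
      moreover have "\<bar>cutoff a b v * (e \<bullet> e)\<bar> \<le> 1" using cutoff_bounds[of a b v] e by (simp add: inner_same_Basis)
      ultimately have "\<bar>D e v e\<bar> \<le> 1 / (b - a) + 1" unfolding D_def by linarith
      then show ?thesis unfolding real_norm_def abs_mult
        using abs_ball_ext_le[of v] C_nonneg by (intro mult_mono) auto
    next
      case False
      then show ?thesis using C_nonneg ab by (simp add: ball_ext_outside)
    qed
  qed (simp add: ball_ext_outside)
  have "(\<integral>v. cutoff a b v * (v \<bullet> m v) \<partial>lebesgue) = (\<Sum>e\<in>Basis. \<integral>v. ball_ext \<phi> v * D e v e \<partial>lebesgue)"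
    unfolding sum_eq by (subst Bochner_Integration.integral_sum) (auto simp: int eq)
  also have "\<dots> = (\<integral>v. (\<Sum>e\<in>Basis. ball_ext \<phi> v * D e v e) \<partial>lebesgue)"
    by (subst Bochner_Integration.integral_sum) (auto simp: slope_int)
  also have "\<dots> \<le> (\<integral>v. indicat_real (ball (0::'a) 1) v * (C * DIM('a)) \<partial>lebesgue)"
  proof (rule Bochner_Integration.integral_mono)
    show "integrable lebesgue (\<lambda>v. \<Sum>e\<in>Basis. ball_ext \<phi> v * D e v e)"
      by (intro Bochner_Integration.integrable_sum slope_int)
    show "integrable lebesgue (\<lambda>v::'a. indicat_real (ball 0 1) v * (C * DIM('a)))"
      by (rule integrable_indicator_ball)
    fix v :: 'a
    show "(\<Sum>e\<in>Basis. ball_ext \<phi> v * D e v e) \<le> indicat_real (ball 0 1) v * (C * DIM('a))"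
    proof (cases "norm v < 1")
      case True
      have "(\<Sum>e\<in>Basis. D e v e) = cutoff_slope a b v v + DIM('a) * cutoff a b v"
        unfolding D_def by (simp add: sum.distrib cutoff_slope_sum inner_same_Basis)
      also have "\<dots> \<le> DIM('a) * 1"
        using cutoff_slope_self[OF ab(2), of v] cutoff_bounds(2)[of a b v]
          mult_left_mono[of "cutoff a b v" 1 "real DIM('a)"] by linarith
      finally have "\<phi> v * (\<Sum>e\<in>Basis. D e v e) \<le> \<phi> v * DIM('a)"
        using nonneg[OF True] by (intro mult_left_mono) auto
      also have "\<dots> \<le> C * DIM('a)" using upper[OF True] by (intro mult_right_mono) auto
      finally show ?thesis using True by (simp add: sum_distrib_left[symmetric] ball_ext_inside)
    qed (simp add: ball_ext_outside)
  qed
  also have "\<dots> = measure lebesgue (ball (0::'a) 1) * (C * DIM('a))" by (rule integral_indicator_ball)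
  finally show "(\<integral>v. rim_cutoff j v * (v \<bullet> m v) \<partial>lebesgue) \<le> measure lebesgue (ball (0::'a) 1) * (C * DIM('a))"
    by (simp add: a_def b_def)
qed

lemma ball_m_measurable: "(\<lambda>v. indicat_real (ball 0 1) v *\<^sub>R m v) \<in> borel_measurable lebesgue"
proof (rule borel_measurable_euclidean_space[THEN iffD2], intro ballI)
  fix u :: 'a
  show "(\<lambda>v. (indicat_real (ball 0 1) v *\<^sub>R m v) \<bullet> u) \<in> borel_measurable lebesgue"
  proof (rule borel_measurable_LIMSEQ_real)
    show "(\<lambda>v. rim_cutoff j v * (m v \<bullet> u)) \<in> borel_measurable lebesgue" for j
      by (intro measurable_cutoff_m rim_cutoff_ab)
    show "(\<lambda>j. rim_cutoff j v * (m v \<bullet> u)) \<longlonglongrightarrow> (indicat_real (ball 0 1) v *\<^sub>R m v) \<bullet> u" for v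
      unfolding inner_scaleR_left by (intro tendsto_mult tendsto_const rim_cutoff_tendsto)
  qed
qed

text \<open>The norm of \<open>m\<close> may be unbounded near the sphere. It is integrable because
  \<open>norm (m v) \<le> C + v \<bullet> m v\<close>, and the radial part is integrated by parts.\<close>

lemma integrable_ball_m: "integrable lebesgue (\<lambda>v. indicat_real (ball 0 1) v *\<^sub>R m v)"
proof (rule integrableI_bounded[OF ball_m_measurable])
  define K where "K = measure lebesgue (ball (0::'a) 1) * C + measure lebesgue (ball (0::'a) 1) * (C * DIM('a))"
  let ?f = "\<lambda>j v. rim_cutoff j v * norm (indicat_real (ball 0 1) v *\<^sub>R m v)"
  have lim: "(\<lambda>j. ennreal (?f j v)) \<longlonglongrightarrow> ennreal (norm (indicat_real (ball 0 1) v *\<^sub>R m v))" for v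
  proof -
    have "(\<lambda>j. ?f j v) \<longlonglongrightarrow> indicat_real (ball 0 1) v * norm (indicat_real (ball 0 1) v *\<^sub>R m v)"
      by (intro tendsto_mult tendsto_const rim_cutoff_tendsto)
    also have "indicat_real (ball 0 1) v * norm (indicat_real (ball 0 1) v *\<^sub>R m v)
        = norm (indicat_real (ball 0 1) v *\<^sub>R m v)" by (simp add: indicator_def)
    finally show ?thesis by (rule tendsto_ennrealI)
  qed
  have f_le: "(\<integral>\<^sup>+v. ennreal (?f j v) \<partial>lebesgue) \<le> ennreal K" for j
  proof -
    have "(\<integral>\<^sup>+v. ennreal (?f j v) \<partial>lebesgue)
        \<le> (\<integral>\<^sup>+v. ennreal (indicat_real (ball 0 1) v * C + rim_cutoff j v * (v \<bullet> m v)) \<partial>lebesgue)"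
    proof (intro nn_integral_mono ennreal_leI)
      fix v :: 'a
      show "?f j v \<le> indicat_real (ball 0 1) v * C + rim_cutoff j v * (v \<bullet> m v)"
      proof (cases "norm v < 1")
        case True
        have "norm (m v) \<le> C + v \<bullet> m v" using norm_m[OF True] upper[OF True] by linarith
        then have "rim_cutoff j v * norm (m v) \<le> rim_cutoff j v * (C + v \<bullet> m v)"
          by (intro mult_left_mono) (auto simp: cutoff_bounds)
        moreover have "rim_cutoff j v * C \<le> 1 * C"
          using C_nonneg by (intro mult_right_mono) (auto simp: cutoff_bounds)
        ultimately show ?thesis using True by (simp add: distrib_left)
      next
        case False
        then show ?thesis using rim_cutoff_ab[of j] by (simp add: cutoff_eq_0)
      qed
    qed
    also have "\<dots> = ennreal (\<integral>v. indicat_real (ball 0 1) v * C + rim_cutoff j v * (v \<bullet> m v) \<partial>lebesgue)"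
    proof (rule nn_integral_eq_integral)
      show "integrable lebesgue (\<lambda>v. indicat_real (ball 0 1) v * C + rim_cutoff j v * (v \<bullet> m v))"
        by (intro Bochner_Integration.integrable_add integrable_indicator_ball integral_rim_cutoff_radial)
      show "AE v in lebesgue. 0 \<le> indicat_real (ball 0 1) v * C + rim_cutoff j v * (v \<bullet> m v)"
      proof (intro AE_I2)
        fix v :: 'a
        show "0 \<le> indicat_real (ball 0 1) v * C + rim_cutoff j v * (v \<bullet> m v)"
        proof (cases "norm v < 1")
          case True
          have "0 \<le> C + v \<bullet> m v" using norm_m[OF True] upper[OF True] norm_ge_zero[of "m v"] by linarith
          then have "0 \<le> rim_cutoff j v * (C + v \<bullet> m v)" by (simp add: cutoff_bounds)
          moreover have "rim_cutoff j v * C \<le> 1 * C"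
            using C_nonneg by (intro mult_right_mono) (auto simp: cutoff_bounds)
          ultimately show ?thesis using True by (simp add: distrib_left)
        next
          case False
          then show ?thesis using rim_cutoff_ab[of j] by (simp add: cutoff_eq_0)
        qed
      qed
    qed
    also have "\<dots> \<le> ennreal K"
      using integral_rim_cutoff_radial[of j]
      by (intro ennreal_leI, subst Bochner_Integration.integral_add[OF integrable_indicator_ball])
        (simp_all only: K_def integral_indicator_ball add_left_mono)
    finally show ?thesis .
  qed
  \<comment> \<open>Fatou's lemma carries the bound \<open>K\<close>, uniform in \<open>j\<close>,
    over to the whole ball.\<close>
  have "(\<integral>\<^sup>+v. norm (indicat_real (ball 0 1) v *\<^sub>R m v) \<partial>lebesgue)
      = (\<integral>\<^sup>+v. liminf (\<lambda>j. ennreal (?f j v)) \<partial>lebesgue)"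
    using lim_imp_Liminf[OF sequentially_bot lim] by simp
  also have "\<dots> \<le> liminf (\<lambda>j. \<integral>\<^sup>+v. ennreal (?f j v) \<partial>lebesgue)"
    using measurable_compose[OF ball_m_measurable borel_measurable_norm]
    by (intro nn_integral_liminf measurable_compose[OF _ measurable_ennreal] borel_measurable_times)
      (auto intro: borel_measurable_lebesgueI)
  also have "\<dots> \<le> ennreal K" by (rule Liminf_le[OF sequentially_bot]) (intro always_eventually allI f_le)
  finally show "(\<integral>\<^sup>+v. norm (indicat_real (ball 0 1) v *\<^sub>R m v) \<partial>lebesgue) < \<infinity>"
    unfolding infinity_ennreal_def by (rule le_less_trans) (rule ennreal_less_top)
qed

text \<open>Since \<open>\<phi>\<close> has no values on the sphere, thin shells stand in for the
  surface integral of the divergence theorem. The cutoffs tend to the indicator of the ball, and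
  integrability of \<open>m\<close> permits dominated convergence.\<close>

lemma rim_integral_tendsto:
  "(\<lambda>j. \<integral>v. ball_ext \<phi> v * cutoff_slope (rad j) (rad (Suc j)) v u \<partial>lebesgue)
     \<longlonglongrightarrow> (\<integral>v. indicat_real (ball 0 1) v *\<^sub>R m v \<partial>lebesgue) \<bullet> u"
proof -
  have "(\<lambda>j. \<integral>v. rim_cutoff j v * (m v \<bullet> u) \<partial>lebesgue)
     \<longlonglongrightarrow> (\<integral>v. (indicat_real (ball 0 1) v *\<^sub>R m v) \<bullet> u \<partial>lebesgue)"
  proof (rule integral_dominated_convergence[where w = "\<lambda>v. norm (indicat_real (ball 0 1) v *\<^sub>R m v) * norm u"])
    show "(\<lambda>v. (indicat_real (ball 0 1) v *\<^sub>R m v) \<bullet> u) \<in> borel_measurable lebesgue"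
      using ball_m_measurable by (rule borel_measurable_inner) simp
    show "(\<lambda>v. rim_cutoff j v * (m v \<bullet> u)) \<in> borel_measurable lebesgue" for j
      by (intro measurable_cutoff_m rim_cutoff_ab)
    show "integrable lebesgue (\<lambda>v. norm (indicat_real (ball 0 1) v *\<^sub>R m v) * norm u)"
      by (intro integrable_mult_left integrable_norm integrable_ball_m)
    show "AE v in lebesgue. (\<lambda>j. rim_cutoff j v * (m v \<bullet> u)) \<longlonglongrightarrow> (indicat_real (ball 0 1) v *\<^sub>R m v) \<bullet> u"
      unfolding inner_scaleR_left by (intro AE_I2 tendsto_mult tendsto_const rim_cutoff_tendsto)
    show "AE v in lebesgue. norm (rim_cutoff j v * (m v \<bullet> u)) \<le> norm (indicat_real (ball 0 1) v *\<^sub>R m v) * norm u" for j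
    proof (intro AE_I2)
      fix v :: 'a
      show "norm (rim_cutoff j v * (m v \<bullet> u)) \<le> norm (indicat_real (ball 0 1) v *\<^sub>R m v) * norm u"
      proof (cases "norm v < 1")
        case True
        have "\<bar>rim_cutoff j v\<bar> * \<bar>m v \<bullet> u\<bar> \<le> 1 * (norm (m v) * norm u)"
          using cutoff_bounds[of "rad j" "rad (Suc j)" v]
          by (intro mult_mono Cauchy_Schwarz_ineq2) auto
        then show ?thesis using True by (simp add: abs_mult)
      next
        case False
        then show ?thesis using rim_cutoff_ab[of j] by (simp add: cutoff_eq_0)
      qed
    qed
  qed
  also have "(\<integral>v. (indicat_real (ball 0 1) v *\<^sub>R m v) \<bullet> u \<partial>lebesgue)
     = (\<integral>v. indicat_real (ball 0 1) v *\<^sub>R m v \<partial>lebesgue) \<bullet> u"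
    by (rule integral_inner_left) (simp add: integrable_ball_m)
  finally show ?thesis by (simp only: integral_cutoff_slope[OF rim_cutoff_ab])
qed

end

section \<open>Cones in thin shells\<close>

lemma integral_lebesgue_odd:
  fixes g :: "'a::euclidean_space \<Rightarrow> real"
  assumes "g \<in> borel_measurable borel" "\<And>v. g (- v) = - g v"
  shows "(\<integral>v. g v \<partial>lebesgue) = 0"
proof -
  \<comment> \<open>The reflection \<open>uminus\<close> as a diagonal map with all entries -1,
    whose Jacobian is 1.\<close>
  have "lborel = density (distr lborel borel (\<lambda>x::'a. 0 + (\<Sum>j\<in>Basis. ((-1) * (x \<bullet> j)) *\<^sub>R j))) (\<lambda>_. (\<Prod>j\<in>(Basis::'a set). \<bar>-1::real\<bar>))"
    by (rule lborel_affine_euclidean) auto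
  also have "(\<lambda>x::'a. 0 + (\<Sum>j\<in>Basis. ((-1) * (x \<bullet> j)) *\<^sub>R j)) = uminus"
    by (auto simp: sum_negf euclidean_representation)
  finally have d: "lborel = distr lborel borel (uminus :: 'a \<Rightarrow> 'a)" by (simp add: density_1)
  have "(\<integral>v. g v \<partial>lebesgue) = (\<integral>v. g v \<partial>lborel)" using assms by (simp add: integral_completion)
  also have "\<dots> = (\<integral>v. g v \<partial>distr lborel borel uminus)" using d by simp
  also have "\<dots> = (\<integral>v. g (- v) \<partial>lborel)" using assms by (subst integral_distr) auto
  also have "\<dots> = - (\<integral>v. g v \<partial>lebesgue)" using assms by (simp add: integral_completion)
  finally show ?thesis by simp
qed

lemma power_diff_le:
  fixes a b :: real assumes "0 \<le> a" "a \<le> b" "b \<le> 1"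
  shows "b ^ n - a ^ n \<le> real n * (b - a)"
proof (induction n)
  case (Suc n)
  have "b ^ Suc n - a ^ Suc n = b * (b ^ n - a ^ n) + (b - a) * a ^ n" by (simp add: algebra_simps)
  also have "\<dots> \<le> 1 * (b ^ n - a ^ n) + (b - a) * 1"
    using assms by (intro add_mono mult_right_mono mult_left_mono power_le_one) (auto simp: power_mono)
  also have "\<dots> \<le> real (Suc n) * (b - a)" using Suc by (simp add: algebra_simps)
  finally show ?case .
qed simp

definition shell :: "real \<Rightarrow> real \<Rightarrow> 'a::real_normed_vector set" where
  "shell a b = {v. a < norm v \<and> norm v < b}"

lemma shell_measurable [measurable]: "shell a b \<in> sets (borel :: 'a::euclidean_space measure)"
  unfolding shell_def by measurable

lemma lmeasurable_bounded_borel: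
  fixes S :: "'a::euclidean_space set"
  assumes "S \<in> sets borel" "S \<subseteq> ball 0 r" shows "S \<in> lmeasurable"
  using assms by (intro bounded_set_imp_lmeasurable bounded_subset[OF bounded_ball]) auto

text \<open>A cone meets \<open>ball 0 c\<close> in \<open>c ^ DIM('a)\<close> times its volume in
  the unit ball, so a shell receives a difference of powers. The factor \<open>DIM('a)\<close>, the
  ratio of surface to volume, is the source of the dimension in both movement bounds.\<close>

lemma measure_shell_cone:
  fixes S :: "'a::euclidean_space set" and a b :: real
  assumes S: "S \<in> sets borel" "\<And>c v. 0 < c \<Longrightarrow> v \<in> S \<Longrightarrow> c *\<^sub>R v \<in> S" and ab: "0 < a" "a < b" "b \<le> 1"
  shows "measure lebesgue (shell a b \<inter> S) \<le> DIM('a) * (b - a) * measure lebesgue (ball 0 1 \<inter> S)"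
proof -
  define K where "K = ball 0 1 \<inter> S"
  have K: "K \<in> lmeasurable" unfolding K_def using S by (intro lmeasurable_bounded_borel[of _ 1]) auto
  have scale: "(\<lambda>x. c *\<^sub>R x + 0) ` K = ball 0 c \<inter> S" if "0 < c" for c
  proof (intro equalityI subsetI)
    fix x assume "x \<in> ball 0 c \<inter> S"
    then have "(1 / c) *\<^sub>R x \<in> K" "x = c *\<^sub>R ((1 / c) *\<^sub>R x) + 0"
      using that S(2)[of "1 / c" x] by (auto simp: K_def divide_simps)
    then show "x \<in> (\<lambda>x. c *\<^sub>R x + 0) ` K" by blast
  qed (use that S(2) in \<open>auto simp: K_def\<close>)
  have m: "measure lebesgue (ball 0 c \<inter> S) = c ^ DIM('a) * measure lebesgue K" if "0 < c" for c
    using measure_lebesgue_affine[of c 0 K] that scale[OF that] by simp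
  have L: "ball 0 c \<inter> S \<in> lmeasurable" for c
    using S by (intro lmeasurable_bounded_borel[of _ c]) auto
  have "measure lebesgue (shell a b \<inter> S) \<le> measure lebesgue ((ball 0 b \<inter> S) - (ball 0 a \<inter> S))"
    using S by (intro measure_mono_fmeasurable fmeasurable.Diff L) (auto simp: shell_def)
  also have "\<dots> = measure lebesgue (ball 0 b \<inter> S) - measure lebesgue (ball 0 a \<inter> S)"
    using ab by (intro measurable_measure_Diff L fmeasurableD) auto
  also have "\<dots> = (b ^ DIM('a) - a ^ DIM('a)) * measure lebesgue K"
    using ab by (simp add: m left_diff_distrib)
  also have "\<dots> \<le> DIM('a) * (b - a) * measure lebesgue K"
    using ab by (intro mult_right_mono power_diff_le) auto
  finally show ?thesis by (simp add: K_def)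
qed

text \<open>For the case of large \<open>\<epsilon>\<close> in \<open>measure_ball_cone\<close>:
  with \<open>x = \<epsilon>\<^sup>2\<close> it says that the radius
  \<open>1 / (2 * \<epsilon>)\<close> is at most
  \<open>exp (- (\<epsilon>\<^sup>2 / 2))\<close>.\<close>

lemma exp_le_4x:
  fixes x :: real assumes "1 / 2 \<le> x" "x \<le> 1" shows "exp x \<le> 4 * x"
proof -
  have "(x - 1 / 2) * (x - 1) \<le> 0" using assms by (intro mult_nonneg_nonpos) auto
  moreover have "(x - 1 / 2) * (x - 1) = x\<^sup>2 - 3 / 2 * x + 1 / 2" by (simp add: power2_eq_square field_simps)
  ultimately have "1 + x + x\<^sup>2 \<le> 4 * x" using assms by linarith
  then show ?thesis using exp_bound[of x] assms by linarith
qed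

lemma norm_diff_scaleR_unit:
  fixes u v :: "'a::real_inner"
  assumes "norm u = 1"
  shows "(norm (v - c *\<^sub>R u))\<^sup>2 = (norm v)\<^sup>2 - 2 * c * (v \<bullet> u) + c\<^sup>2"
proof -
  have "(norm (v - c *\<^sub>R u))\<^sup>2 = v \<bullet> v - 2 * c * (v \<bullet> u) + c * c * (u \<bullet> u)"
    unfolding power2_norm_eq_inner by (simp add: inner_diff_left inner_diff_right inner_commute algebra_simps)
  moreover have "u \<bullet> u = 1" using assms by (simp add: norm_eq_1)
  ultimately show ?thesis unfolding power2_norm_eq_inner by (simp add: power2_eq_square)
qed

text \<open>Concentration of measure: the part of the unit ball in the cone around \<open>u\<close> is covered by a single
  ball of radius at most \<open>exp (- \<epsilon>\<^sup>2 / 2)\<close>.\<close>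

lemma measure_ball_cone:
  fixes u :: "'a::euclidean_space" and \<epsilon> :: real
  assumes u: "norm u = 1" and \<epsilon>: "0 < \<epsilon>" "\<epsilon> \<le> 1"
  shows "measure lebesgue (ball 0 1 \<inter> {v. \<epsilon> * norm v \<le> v \<bullet> u})
    \<le> exp (- (DIM('a) * \<epsilon>\<^sup>2 / 2)) * measure lebesgue (ball (0::'a) 1)"
proof -
  have "\<exists>c r. ball 0 1 \<inter> {v. \<epsilon> * norm v \<le> v \<bullet> u} \<subseteq> cball c r \<and> 0 \<le> r \<and> r \<le> exp (- (\<epsilon>\<^sup>2 / 2))"
  proof (cases "\<epsilon>\<^sup>2 \<le> 1 / 2")
    case True
    \<comment> \<open>The ball around \<open>\<epsilon> *\<^sub>R u\<close> through the rim of the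
      spherical cap. It contains the apex of the cone exactly when
      \<open>\<epsilon>\<^sup>2 \<le> 1 / 2\<close>.\<close>
    define r where "r = sqrt (1 - \<epsilon>\<^sup>2)"
    have "1 - \<epsilon>\<^sup>2 \<le> exp (- \<epsilon>\<^sup>2)" using exp_ge_add_one_self[of "- \<epsilon>\<^sup>2"] by simp
    also have "exp (- \<epsilon>\<^sup>2) = (exp (- (\<epsilon>\<^sup>2 / 2)))\<^sup>2" by (simp flip: exp_double)
    finally have "r \<le> exp (- (\<epsilon>\<^sup>2 / 2))" unfolding r_def by (intro real_le_lsqrt) auto
    moreover have "ball 0 1 \<inter> {v. \<epsilon> * norm v \<le> v \<bullet> u} \<subseteq> cball (\<epsilon> *\<^sub>R u) r"
    proof
      fix v assume v: "v \<in> ball 0 1 \<inter> {v. \<epsilon> * norm v \<le> v \<bullet> u}"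
      have "(norm (v - \<epsilon> *\<^sub>R u))\<^sup>2 = (norm v)\<^sup>2 - 2 * \<epsilon> * (v \<bullet> u) + \<epsilon>\<^sup>2"
        by (rule norm_diff_scaleR_unit[OF u])
      also have "\<dots> \<le> (norm v)\<^sup>2 - 2 * \<epsilon> * (\<epsilon> * norm v) + \<epsilon>\<^sup>2"
        using v \<epsilon> by (intro add_right_mono diff_left_mono mult_left_mono) auto
      also have "\<dots> = 1 - \<epsilon>\<^sup>2 + (norm v - 1) * (norm v + 1 - 2 * \<epsilon>\<^sup>2)"
        by (simp add: power2_eq_square algebra_simps)
      also have "\<dots> \<le> 1 - \<epsilon>\<^sup>2 + 0"
      proof (intro add_left_mono mult_nonpos_nonneg)
        show "0 \<le> norm v + 1 - 2 * \<epsilon>\<^sup>2" using True norm_ge_zero[of v] by linarith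
      qed (use v in simp)
      finally have "norm (v - \<epsilon> *\<^sub>R u) \<le> r" unfolding r_def by (intro real_le_rsqrt) simp
      then show "v \<in> cball (\<epsilon> *\<^sub>R u) r" by (simp add: dist_norm norm_minus_commute)
    qed
    moreover have "0 \<le> r" using True by (simp add: r_def)
    ultimately show ?thesis by blast
  next
    case False
    \<comment> \<open>For narrow cones: the ball centered on the axis that passes through both the
      apex and the rim of the cap.\<close>
    define r where "r = 1 / (2 * \<epsilon>)"
    have "\<epsilon>\<^sup>2 \<le> 1" using \<epsilon> by (simp add: power_le_one)
    then have "exp (\<epsilon>\<^sup>2) \<le> 4 * \<epsilon>\<^sup>2" using False by (intro exp_le_4x) auto
    also have "exp (\<epsilon>\<^sup>2) = (exp (\<epsilon>\<^sup>2 / 2))\<^sup>2" by (simp flip: exp_double)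
    also have "4 * \<epsilon>\<^sup>2 = (2 * \<epsilon>)\<^sup>2" by (simp add: power2_eq_square)
    finally have "exp (\<epsilon>\<^sup>2 / 2) \<le> 2 * \<epsilon>" by (rule power2_le_imp_le) (use \<epsilon> in simp)
    then have "r \<le> exp (- (\<epsilon>\<^sup>2 / 2))" using \<epsilon>
      by (simp add: r_def exp_minus inverse_eq_divide frac_le)
    moreover have "ball 0 1 \<inter> {v. \<epsilon> * norm v \<le> v \<bullet> u} \<subseteq> cball (r *\<^sub>R u) r"
    proof
      fix v assume v: "v \<in> ball 0 1 \<inter> {v. \<epsilon> * norm v \<le> v \<bullet> u}"
      have "(norm (v - r *\<^sub>R u))\<^sup>2 = (norm v)\<^sup>2 - 2 * r * (v \<bullet> u) + r\<^sup>2"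
        by (rule norm_diff_scaleR_unit[OF u])
      also have "\<dots> \<le> (norm v)\<^sup>2 - 2 * r * (\<epsilon> * norm v) + r\<^sup>2"
        using v \<epsilon> by (intro add_right_mono diff_left_mono mult_left_mono) (auto simp: r_def)
      also have "\<dots> = r\<^sup>2 + norm v * (norm v - 1)"
        using \<epsilon> by (simp add: r_def power2_eq_square algebra_simps)
      also have "\<dots> \<le> r\<^sup>2"
        using v mult_nonneg_nonpos[of "norm v" "norm v - 1"] by simp
      finally have "norm (v - r *\<^sub>R u) \<le> r"
        by (rule power2_le_imp_le) (use \<epsilon> in \<open>simp add: r_def\<close>)
      then show "v \<in> cball (r *\<^sub>R u) r" by (simp add: dist_norm norm_minus_commute)
    qed
    moreover have "0 \<le> r" using \<epsilon> by (simp add: r_def)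
    ultimately show ?thesis by blast
  qed
  then obtain c r where cr: "ball 0 1 \<inter> {v. \<epsilon> * norm v \<le> v \<bullet> u} \<subseteq> cball c r" "0 \<le> r" "r \<le> exp (- (\<epsilon>\<^sup>2 / 2))"
    by blast
  have "measure lebesgue (ball 0 1 \<inter> {v. \<epsilon> * norm v \<le> v \<bullet> u}) \<le> measure lebesgue (cball c r)"
    using cr by (intro measure_mono_fmeasurable) auto
  also have "\<dots> = r ^ DIM('a) * measure lebesgue (ball (0::'a) 1)"
    using cr content_cball[of r c] content_ball[of 1 "0::'a"] by simp
  also have "\<dots> \<le> exp (- (\<epsilon>\<^sup>2 / 2)) ^ DIM('a) * measure lebesgue (ball (0::'a) 1)"
    using cr by (intro mult_right_mono power_mono) auto
  also have "exp (- (\<epsilon>\<^sup>2 / 2)) ^ DIM('a) = exp (- (DIM('a) * \<epsilon>\<^sup>2 / 2))"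
    by (simp flip: exp_of_nat_mult)
  finally show ?thesis .
qed

definition double_cone :: "real \<Rightarrow> 'a::real_inner \<Rightarrow> 'a set" where
  "double_cone \<epsilon> u = {v. \<epsilon> * norm v \<le> \<bar>v \<bullet> u\<bar>}"

lemma double_cone_measurable [measurable]: "double_cone \<epsilon> u \<in> sets (borel :: 'a::euclidean_space measure)"
  unfolding double_cone_def by measurable

lemma measure_shell_double_cone:
  fixes u :: "'a::euclidean_space" and \<epsilon> a b :: real
  assumes u: "norm u = 1" and \<epsilon>: "0 < \<epsilon>" "\<epsilon> \<le> 1" and ab: "0 < a" "a < b" "b \<le> 1"
  shows "measure lebesgue (shell a b \<inter> double_cone \<epsilon> u)
    \<le> DIM('a) * (b - a) * (2 * exp (- (DIM('a) * \<epsilon>\<^sup>2 / 2)) * measure lebesgue (ball (0::'a) 1))"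
proof -
  define K where "K = (\<lambda>w::'a. ball 0 1 \<inter> {v. \<epsilon> * norm v \<le> v \<bullet> w})"
  have K: "K w \<in> lmeasurable" for w
    unfolding K_def by (rule lmeasurable_bounded_borel[of _ 1]) auto
  have "measure lebesgue (ball 0 1 \<inter> double_cone \<epsilon> u) \<le> measure lebesgue (K u \<union> K (- u))"
    by (intro measure_mono_fmeasurable fmeasurable.Un K)
      (auto simp: K_def double_cone_def abs_le_iff abs_if split: if_splits)
  also have "\<dots> \<le> measure lebesgue (K u) + measure lebesgue (K (- u))"
    using K by (intro measure_Un_le) auto
  also have "\<dots> \<le> 2 * exp (- (DIM('a) * \<epsilon>\<^sup>2 / 2)) * measure lebesgue (ball (0::'a) 1)"
    using measure_ball_cone[OF u \<epsilon>] measure_ball_cone[OF _ \<epsilon>, of "- u"] u unfolding K_def by simp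
  finally have "measure lebesgue (ball 0 1 \<inter> double_cone \<epsilon> u) \<le> 2 * exp (- (DIM('a) * \<epsilon>\<^sup>2 / 2)) * measure lebesgue (ball (0::'a) 1)" .
  moreover have "measure lebesgue (shell a b \<inter> double_cone \<epsilon> u) \<le> DIM('a) * (b - a) * measure lebesgue (ball 0 1 \<inter> double_cone \<epsilon> u)"
    by (rule measure_shell_cone[OF _ _ ab]) (auto simp: double_cone_def abs_mult)
  moreover have "0 \<le> DIM('a) * (b - a)" using ab by simp
  ultimately show ?thesis by (meson mult_left_mono order_trans)
qed

text \<open>Rounding \<open>y\<close> down to a multiple of \<open>\<epsilon>\<close> loses less
  than one step, which the summand 1 restores. The other summands are indicators of superlevel sets,
  so that volumes of cones can control a maximum of cosines.\<close>

lemma le_layer_sum: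
  fixes y \<epsilon> :: real
  assumes "0 < \<epsilon>" "0 \<le> y" "y \<le> 1"
  shows "y \<le> \<epsilon> * (1 + (\<Sum>j=1..nat \<lfloor>1 / \<epsilon>\<rfloor>. of_bool (real j * \<epsilon> \<le> y)))"
proof -
  define k where "k = nat \<lfloor>y / \<epsilon>\<rfloor>"
  have "k \<le> nat \<lfloor>1 / \<epsilon>\<rfloor>"
    unfolding k_def using assms by (intro nat_mono floor_mono divide_right_mono) auto
  have k: "real k \<le> y / \<epsilon>" "y / \<epsilon> < real k + 1" unfolding k_def using assms by (auto simp: of_nat_floor)
  have "real k = (\<Sum>j=1..k. of_bool (real j * \<epsilon> \<le> y))"
  proof -
    have "real j * \<epsilon> \<le> y" if "j \<in> {1..k}" for j
    proof -
      have "real j \<le> y / \<epsilon>" using that k by auto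
      then show ?thesis using assms by (simp add: pos_le_divide_eq)
    qed
    then show ?thesis by simp
  qed
  also have "\<dots> \<le> (\<Sum>j=1..nat \<lfloor>1 / \<epsilon>\<rfloor>. of_bool (real j * \<epsilon> \<le> y))"
    using \<open>k \<le> _\<close> by (intro sum_mono2) auto
  finally have "y / \<epsilon> \<le> 1 + (\<Sum>j=1..nat \<lfloor>1 / \<epsilon>\<rfloor>. of_bool (real j * \<epsilon> \<le> y))" using k by linarith
  then show ?thesis using assms by (simp add: pos_divide_le_eq mult.commute)
qed

section \<open>Movement of ball averages\<close>

lemma lmeasurable_shell_Int:
  fixes S :: "'a::euclidean_space set"
  shows "S \<in> sets borel \<Longrightarrow> shell a b \<inter> S \<in> lmeasurable"
  by (intro lmeasurable_bounded_borel[of _ b]) (auto simp: shell_def)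

lemma integrable_indicator_shell:
  fixes S :: "'a::euclidean_space set"
  assumes "S \<in> sets borel"
  shows "integrable lebesgue (\<lambda>v. indicat_real (shell a b \<inter> S) v * K)"
  using lmeasurable_shell_Int[OF assms, of a b]
  by (intro integrable_mult_left integrable_real_indicator) (auto simp: fmeasurable_def)

lemma measure_shell_le:
  fixes a b :: real
  assumes "0 < a" "a < b" "b \<le> 1"
  shows "measure lebesgue (shell a b :: 'a set) \<le> DIM('a) * (b - a) * measure lebesgue (ball (0::'a::euclidean_space) 1)"
  using measure_shell_cone[of "UNIV :: 'a set" a b] assms by simp

text \<open>The factor \<open>N\<close> of the union bound uses up one \<open>ln M\<close> of the
  exponent. The bound \<open>3 * j - 2 \<le> j\<^sup>2\<close>, that is
  \<open>0 \<le> (j - 1) * (j - 2)\<close> at integers, makes the rest geometric, and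
  \<open>ln 2 \<le> ln M\<close> gives the ratio \<open>1 / 64\<close>. The remaining
  \<open>1 / 2\<close> cancels the 2 for the two halves of a double cone.\<close>

lemma layer_exp_le:
  fixes N j :: nat
  defines "M \<equiv> real (max 2 N)"
  assumes "1 \<le> j"
  shows "2 * real N * exp (- (2 * (real j)\<^sup>2 * ln M)) \<le> (1 / 64) ^ (j - 1)"
proof -
  have M: "2 \<le> M" "real N \<le> M" by (auto simp: M_def)
  have j: "3 * real j - 2 \<le> (real j)\<^sup>2"
  proof -
    obtain k where k: "j = Suc k" using assms(2) by (cases j) auto
    have "real k \<le> real (k * k)" by (simp only: of_nat_le_iff le_square)
    then show ?thesis by (simp add: k power2_eq_square algebra_simps)
  qed
  have ln2: "0 < ln (2::real)" "ln 2 \<le> ln M" using M by auto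
  have "real N * exp (- (2 * (real j)\<^sup>2 * ln M)) \<le> M * exp (- (2 * (real j)\<^sup>2 * ln M))"
    using M by (intro mult_right_mono) auto
  also have "\<dots> = exp (ln M + - (2 * (real j)\<^sup>2 * ln M))"
    unfolding exp_add using M by simp
  also have "\<dots> = exp (- ((2 * (real j)\<^sup>2 - 1) * ln M))" by (simp add: algebra_simps)
  also have "\<dots> \<le> exp (- ((6 * (real j - 1) + 1) * ln 2))"
  proof -
    have "(6 * (real j - 1) + 1) * ln 2 \<le> (2 * (real j)\<^sup>2 - 1) * ln M"
      using j assms(2) ln2 by (intro mult_mono) auto
    then show ?thesis by simp
  qed
  also have "- ((6 * (real j - 1) + 1) * ln 2) = real (6 * (j - 1)) * ln (1 / 2) + ln (1 / 2)"
    using assms(2) by (simp add: ln_div of_nat_diff algebra_simps)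
  also have "exp \<dots> = (1 / 2) ^ (6 * (j - 1)) * (1 / 2)"
    by (simp only: exp_add exp_of_nat_mult) simp
  also have "(1 / 2 :: real) ^ (6 * (j - 1)) = (1 / 64) ^ (j - 1)"
    by (subst power_mult) (simp add: power_one_over)
  finally show ?thesis by linarith
qed

lemma layer_sum_le:
  fixes N J :: nat
  shows "(\<Sum>j=1..J. 2 * real N * exp (- (2 * (real j)\<^sup>2 * ln (real (max 2 N))))) \<le> 64 / 63"
proof -
  have "(\<Sum>j=1..J. 2 * real N * exp (- (2 * (real j)\<^sup>2 * ln (real (max 2 N))))) \<le> (\<Sum>j=1..J. (1 / 64) ^ (j - 1))"
    by (intro sum_mono layer_exp_le) auto
  also have "\<dots> = (\<Sum>j<J. (1 / 64) ^ j)"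
    by (rule sum.reindex_bij_witness[of _ Suc "\<lambda>j. j - 1"]) auto
  also have "\<dots> \<le> 64 / 63"
    by (simp add: sum_gp_strict)
  finally show ?thesis .
qed

text \<open>\<open>Y\<close> dominates the \<open>N\<close> cosines. It is a sum over the layers \<open>j * \<epsilon>\<close>, so that a union bound applies
  in each layer.\<close>

lemma integral_shell_max_le:
  fixes u :: "nat \<Rightarrow> 'a::euclidean_space" and N :: nat and a b :: real
  defines "\<epsilon> \<equiv> 2 * sqrt (ln (real (max 2 N)) / DIM('a))"
  defines "Y \<equiv> \<lambda>v::'a. \<epsilon> * (1 + (\<Sum>j=1..nat \<lfloor>1 / \<epsilon>\<rfloor>. \<Sum>n=1..N. indicat_real (double_cone (real j * \<epsilon>) (u n)) v))"
  assumes u: "\<And>n. norm (u n) = 1" and ab: "0 < a" "a < b" "b \<le> 1"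
  shows "integrable lebesgue (\<lambda>v. indicat_real (shell a b) v * Y v)"
    "\<And>v n. n \<in> {1..N} \<Longrightarrow> v \<noteq> 0 \<Longrightarrow> \<bar>v \<bullet> u n\<bar> / norm v \<le> Y v"
    "(\<integral>v. indicat_real (shell a b) v * Y v \<partial>lebesgue)
       \<le> 17 / 4 * sqrt (DIM('a) * ln (real (max 2 N))) * (b - a) * measure lebesgue (ball (0::'a) 1)"
proof -
  define V where "V = measure lebesgue (ball (0::'a) 1)"
  define J where "J = nat \<lfloor>1 / \<epsilon>\<rfloor>"
  have V: "0 \<le> V" by (simp add: V_def)
  have L: "0 < ln (real (max 2 N))" by (intro ln_gt_zero) auto
  have d: "0 < real DIM('a)" by simp
  have \<epsilon>: "0 < \<epsilon>" using L d by (simp add: \<epsilon>_def)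
  have \<epsilon>2: "\<epsilon>\<^sup>2 = 4 * (ln (real (max 2 N)) / DIM('a))"
  proof -
    have "0 \<le> ln (real (max 2 N)) / DIM('a)" using L by (intro divide_nonneg_nonneg) auto
    then show ?thesis unfolding \<epsilon>_def power_mult_distrib by (subst real_sqrt_pow2) auto
  qed
  \<comment> \<open>Layers stop at cosine 1, as \<open>measure_shell_double_cone\<close> demands;
    for \<open>\<epsilon> > 1\<close> there are none.\<close>
  have J: "real j * \<epsilon> \<le> 1" if "j \<in> {1..J}" for j
  proof -
    have "real j \<le> 1 / \<epsilon>" using that \<epsilon> by (simp add: J_def le_nat_floor) linarith
    then show ?thesis using \<epsilon> by (simp add: pos_le_divide_eq)
  qed
  have eq: "indicat_real (shell a b) v * Y v = \<epsilon> * (indicat_real (shell a b \<inter> UNIV) v * 1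
      + (\<Sum>j=1..J. \<Sum>n=1..N. indicat_real (shell a b \<inter> double_cone (real j * \<epsilon>) (u n)) v * 1))" for v
    unfolding Y_def J_def by (cases "v \<in> shell a b") (simp_all add: indicator_inter_arith)
  have int: "integrable lebesgue (\<lambda>v. indicat_real (shell a b \<inter> S) v * 1)" if "S \<in> sets borel" for S :: "'a set"
    by (rule integrable_indicator_shell[OF that])
  have U: "(UNIV :: 'a set) \<in> sets borel" by simp
  show "integrable lebesgue (\<lambda>v. indicat_real (shell a b) v * Y v)"
    unfolding eq
    by (intro integrable_mult_right Bochner_Integration.integrable_add Bochner_Integration.integrable_sum int) auto
  show "\<bar>v \<bullet> u n\<bar> / norm v \<le> Y v" if n: "n \<in> {1..N}" and "v \<noteq> 0" for v n
  proof -
    define y where "y = \<bar>v \<bullet> u n\<bar> / norm v"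
    have y: "0 \<le> y" "y \<le> 1"
      using Cauchy_Schwarz_ineq2[of v "u n"] \<open>v \<noteq> 0\<close> u by (auto simp: y_def divide_simps)
    have "y \<le> \<epsilon> * (1 + (\<Sum>j=1..J. of_bool (real j * \<epsilon> \<le> y)))"
      unfolding J_def by (rule le_layer_sum[OF \<epsilon> y])
    also have "\<dots> \<le> Y v" unfolding Y_def J_def[symmetric]
    proof (intro mult_left_mono add_left_mono sum_mono)
      fix j
      have "of_bool (real j * \<epsilon> \<le> y) = indicat_real (double_cone (real j * \<epsilon>) (u n)) v"
        using \<open>v \<noteq> 0\<close> by (auto simp: y_def double_cone_def indicator_def pos_le_divide_eq)
      also have "\<dots> \<le> (\<Sum>n=1..N. indicat_real (double_cone (real j * \<epsilon>) (u n)) v)"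
        using n by (intro member_le_sum) auto
      finally show "of_bool (real j * \<epsilon> \<le> y) \<le> (\<Sum>n=1..N. indicat_real (double_cone (real j * \<epsilon>) (u n)) v)" .
    qed (use \<epsilon> in auto)
    finally show ?thesis by (simp add: y_def)
  qed
  have "(\<integral>v. indicat_real (shell a b) v * Y v \<partial>lebesgue)
    = \<epsilon> * ((\<integral>v. indicat_real (shell a b \<inter> (UNIV :: 'a set)) v * 1 \<partial>lebesgue)
      + (\<Sum>j=1..J. \<Sum>n=1..N. (\<integral>v. indicat_real (shell a b \<inter> double_cone (real j * \<epsilon>) (u n)) v * 1 \<partial>lebesgue)))"
    unfolding eq
    by (simp only: Bochner_Integration.integral_mult_right_zero
        Bochner_Integration.integral_add[OF int[OF U] Bochner_Integration.integrable_sum[OF Bochner_Integration.integrable_sum[OF int[OF double_cone_measurable]]]]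
        Bochner_Integration.integral_sum[OF Bochner_Integration.integrable_sum[OF int[OF double_cone_measurable]]]
        Bochner_Integration.integral_sum[OF int[OF double_cone_measurable]])
  also have "\<dots> = \<epsilon> * (measure lebesgue (shell a b :: 'a set)
      + (\<Sum>j=1..J. \<Sum>n=1..N. measure lebesgue (shell a b \<inter> double_cone (real j * \<epsilon>) (u n))))"
    by simp
  also have "\<dots> \<le> \<epsilon> * (DIM('a) * (b - a) * V
      + (\<Sum>j=1..J. \<Sum>n=1..N. DIM('a) * (b - a) * (2 * exp (- (DIM('a) * (real j * \<epsilon>)\<^sup>2 / 2)) * V)))"
    unfolding V_def using \<epsilon> J ab
    by (intro mult_left_mono add_mono sum_mono measure_shell_le measure_shell_double_cone u) auto
  also have "\<dots> = \<epsilon> * (DIM('a) * (b - a) * V * (1 + (\<Sum>j=1..J. 2 * real N * exp (- (2 * (real j)\<^sup>2 * ln (real (max 2 N)))))))"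
  proof -
    \<comment> \<open>The choice of \<open>\<epsilon>\<close> cancels the dimension from the
      exponent.\<close>
    have e: "DIM('a) * (real j * \<epsilon>)\<^sup>2 / 2 = 2 * (real j)\<^sup>2 * ln (real (max 2 N))" for j
      using d by (simp add: power_mult_distrib \<epsilon>2 del: of_nat_max)
    have "(\<Sum>n=1..N. DIM('a) * (b - a) * (2 * exp (- (DIM('a) * (real j * \<epsilon>)\<^sup>2 / 2)) * V))
        = DIM('a) * (b - a) * V * (2 * real N * exp (- (2 * (real j)\<^sup>2 * ln (real (max 2 N)))))" for j
      unfolding e by simp
    then show ?thesis by (simp only: distrib_left sum_distrib_left mult_1_right)
  qed
  also have "\<dots> \<le> \<epsilon> * (DIM('a) * (b - a) * V * (1 + 64 / 63))"
    using \<epsilon> ab V layer_sum_le[of N J] by (intro mult_left_mono add_left_mono) auto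
  also have "\<dots> = (127 / 63 * (\<epsilon> * DIM('a))) * ((b - a) * V)" by simp
  also have "\<epsilon> * DIM('a) = 2 * sqrt (DIM('a) * ln (real (max 2 N)))"
  proof -
    have "sqrt (ln (real (max 2 N)) / DIM('a)) * DIM('a) = sqrt (ln (real (max 2 N)) / DIM('a)) * (sqrt DIM('a) * sqrt DIM('a))"
      by simp
    also have "\<dots> = sqrt (ln (real (max 2 N)) / DIM('a) * DIM('a)) * sqrt DIM('a)"
      by (simp only: real_sqrt_mult mult_ac)
    also have "ln (real (max 2 N)) / DIM('a) * DIM('a) = ln (real (max 2 N))" using d by simp
    finally show ?thesis by (simp only: \<epsilon>_def real_sqrt_mult mult_ac)
  qed
  \<comment> \<open>\<open>254 / 63\<close> is about 4.03 and is rounded up to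
    \<open>17 / 4\<close>.\<close>
  also have "127 / 63 * (2 * sqrt (DIM('a) * ln (real (max 2 N)))) * ((b - a) * V)
     \<le> (17 / 4 * sqrt (DIM('a) * ln (real (max 2 N)))) * ((b - a) * V)"
    using ab V L by (intro mult_right_mono) auto
  finally show "(\<integral>v. indicat_real (shell a b) v * Y v \<partial>lebesgue)
       \<le> 17 / 4 * sqrt (DIM('a) * ln (real (max 2 N))) * (b - a) * measure lebesgue (ball (0::'a) 1)"
    by (simp only: V_def mult.assoc)
qed

text \<open>For \<open>m = conjugate_point W\<close> this is the functional Steiner point of
  \<open>W\<close>.\<close>

definition ball_average :: "('a::euclidean_space \<Rightarrow> 'a) \<Rightarrow> 'a" where
  "ball_average m = (1 / measure lebesgue (ball (0::'a) 1)) *\<^sub>R (\<integral>v. indicat_real (ball 0 1) v *\<^sub>R m v \<partial>lebesgue)"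

lemma ball_volume_pos: "0 < measure lebesgue (ball (0::'a::euclidean_space) 1)"
  using content_ball_pos[of 1 "0::'a"] by simp

text \<open>By \<open>rim_integral_tendsto\<close> each displacement is a limit of integrals over thin shells, which
  only involve the increments of \<open>\<phi>\<close>; the sum of the increments telescopes.\<close>

lemma movement_shell_bound:
  fixes \<phi> :: "nat \<Rightarrow> 'a::euclidean_space \<Rightarrow> real" and m :: "nat \<Rightarrow> 'a \<Rightarrow> 'a" and B :: real
  assumes N: "0 < N" and dp: "\<And>n. n \<le> N \<Longrightarrow> dual_pair (\<phi> n) (m n) (C n)"
    and mono: "\<And>n v. n \<in> {1..N} \<Longrightarrow> norm v < 1 \<Longrightarrow> \<phi> (n - 1) v \<le> \<phi> n v"
    and Y: "\<And>n v. n \<in> {1..N} \<Longrightarrow> v \<noteq> 0 \<Longrightarrow> \<bar>v \<bullet> u n\<bar> / norm v \<le> Y v"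
    and u: "\<And>n. n \<in> {1..N} \<Longrightarrow> (ball_average (m n) - ball_average (m (n - 1))) \<bullet> u n
              = norm (ball_average (m n) - ball_average (m (n - 1)))"
    and Z: "\<And>v. norm v < 1 \<Longrightarrow> v \<noteq> 0 \<Longrightarrow> \<phi> N v * Y v \<le> Z v"
    and ZI: "\<And>a b. 0 < a \<Longrightarrow> a < b \<Longrightarrow> b < 1 \<Longrightarrow> integrable lebesgue (\<lambda>v. indicat_real (shell a b) v * Z v)"
    and ZB: "\<And>a b. 0 < a \<Longrightarrow> a < b \<Longrightarrow> b < 1 \<Longrightarrow> (\<integral>v. indicat_real (shell a b) v * Z v \<partial>lebesgue)
               \<le> (B::real) * (b - a) * measure lebesgue (ball (0::'a) 1)"
  shows "(\<Sum>n=1..N. norm (ball_average (m n) - ball_average (m (n - 1)))) \<le> B"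
proof -
  define V where "V = measure lebesgue (ball (0::'a) 1)"
  have V: "0 < V" by (simp add: V_def ball_volume_pos del: measure_completion)
  let ?S = "\<lambda>n j v. (ball_ext (\<phi> n) v - ball_ext (\<phi> (n - 1)) v) * cutoff_slope (rad j) (rad (Suc j)) v (u n)"
  have nonneg: "0 \<le> \<phi> n v" if "n \<le> N" "norm v < 1" for n v
    using dual_pair.nonneg[OF dp[OF that(1)] that(2)] .
  have sint: "integrable lebesgue (\<lambda>v. ball_ext (\<phi> n) v * cutoff_slope (rad j) (rad (Suc j)) v w)"
    if n: "n \<le> N" for n j w
  proof (rule integrable_lebesgue_bounded[where r = 1 and K = "C n * (norm w / (rad (Suc j) - rad j))"])
    interpret dual_pair "\<phi> n" "m n" "C n" by (rule dp[OF n])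
    show "(\<lambda>v. ball_ext (\<phi> n) v * cutoff_slope (rad j) (rad (Suc j)) v w) \<in> borel_measurable lebesgue"
      by (intro borel_measurable_lebesgueI borel_measurable_times ball_ext_measurable borel_measurable_cutoff_slope)
    show "norm (ball_ext (\<phi> n) v * cutoff_slope (rad j) (rad (Suc j)) v w) \<le> C n * (norm w / (rad (Suc j) - rad j))" for v
      unfolding real_norm_def abs_mult
      by (intro mult_mono abs_ball_ext_le abs_cutoff_slope rim_cutoff_ab C_nonneg) auto
  qed (simp add: ball_ext_outside)
  have lim: "(\<lambda>j. \<integral>v. ?S n j v \<partial>lebesgue) \<longlonglongrightarrow> V * norm (ball_average (m n) - ball_average (m (n - 1)))"
    if n: "n \<in> {1..N}" for n
  proof -
    have le: "n \<le> N" "n - 1 \<le> N" using n by auto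
    have "(\<lambda>j. (\<integral>v. ball_ext (\<phi> n) v * cutoff_slope (rad j) (rad (Suc j)) v (u n) \<partial>lebesgue)
        - (\<integral>v. ball_ext (\<phi> (n - 1)) v * cutoff_slope (rad j) (rad (Suc j)) v (u n) \<partial>lebesgue))
       \<longlonglongrightarrow> (\<integral>v. indicat_real (ball 0 1) v *\<^sub>R m n v \<partial>lebesgue) \<bullet> u n - (\<integral>v. indicat_real (ball 0 1) v *\<^sub>R m (n - 1) v \<partial>lebesgue) \<bullet> u n"
      by (intro tendsto_diff dual_pair.rim_integral_tendsto[OF dp[OF le(1)]] dual_pair.rim_integral_tendsto[OF dp[OF le(2)]])
    also have "(\<lambda>j. (\<integral>v. ball_ext (\<phi> n) v * cutoff_slope (rad j) (rad (Suc j)) v (u n) \<partial>lebesgue)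
        - (\<integral>v. ball_ext (\<phi> (n - 1)) v * cutoff_slope (rad j) (rad (Suc j)) v (u n) \<partial>lebesgue))
       = (\<lambda>j. \<integral>v. ?S n j v \<partial>lebesgue)"
      by (simp only: left_diff_distrib Bochner_Integration.integral_diff[OF sint[OF le(1)] sint[OF le(2)]])
    also have "(\<integral>v. indicat_real (ball 0 1) v *\<^sub>R m n v \<partial>lebesgue) \<bullet> u n - (\<integral>v. indicat_real (ball 0 1) v *\<^sub>R m (n - 1) v \<partial>lebesgue) \<bullet> u n
       = V * ((ball_average (m n) - ball_average (m (n - 1))) \<bullet> u n)"
      using V unfolding ball_average_def V_def[symmetric] by (simp add: inner_diff_left algebra_simps)
    finally show ?thesis using u[OF n] by simp
  qed
  have bound: "(\<Sum>n=1..N. \<integral>v. ?S n j v \<partial>lebesgue) \<le> B * V" for j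
  proof -
    define a b where "a = rad j" and "b = rad (Suc j)"
    have ab: "0 < a" "a < b" "b < 1" using rim_cutoff_ab by (auto simp: a_def b_def)
    have Si: "integrable lebesgue (?S n j)" if "n \<in> {1..N}" for n
    proof -
      have "n \<le> N" "n - 1 \<le> N" using that by auto
      then show ?thesis unfolding left_diff_distrib by (intro Bochner_Integration.integrable_diff sint)
    qed
    have "(\<Sum>n=1..N. \<integral>v. ?S n j v \<partial>lebesgue) = (\<integral>v. (\<Sum>n=1..N. ?S n j v) \<partial>lebesgue)"
      using Si by (subst Bochner_Integration.integral_sum) auto
    also have "\<dots> \<le> (\<integral>v. indicat_real (shell a b) v * Z v / (b - a) \<partial>lebesgue)"
    proof (rule Bochner_Integration.integral_mono)
      show "integrable lebesgue (\<lambda>v. \<Sum>n=1..N. ?S n j v)"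
        using Si by (intro Bochner_Integration.integrable_sum) auto
      show "integrable lebesgue (\<lambda>v. indicat_real (shell a b) v * Z v / (b - a))"
        by (intro integrable_divide_zero ZI ab impI)
      fix v :: 'a
      show "(\<Sum>n=1..N. ?S n j v) \<le> indicat_real (shell a b) v * Z v / (b - a)"
      proof (cases "v \<in> shell a b")
        case False
        then show ?thesis by (auto simp: cutoff_slope_def shell_def a_def[symmetric] b_def[symmetric])
      next
        case True
        then have v: "a < norm v" "norm v < b" "norm v < 1" "v \<noteq> 0" using ab by (auto simp: shell_def)
        have "?S n j v \<le> (\<phi> n v - \<phi> (n - 1) v) * (Y v / (b - a))" if n: "n \<in> {1..N}" for n
        proof -
          have "cutoff_slope a b v (u n) = - ((v \<bullet> u n) / norm v) / (b - a)" using v by (simp add: cutoff_slope_def)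
          also have "\<dots> \<le> (\<bar>v \<bullet> u n\<bar> / norm v) / (b - a)"
            using v ab by (intro divide_right_mono) (auto simp flip: divide_minus_left intro!: divide_right_mono)
          also have "\<dots> \<le> Y v / (b - a)" using Y[OF n v(4)] ab by (intro divide_right_mono) auto
          finally have "(\<phi> n v - \<phi> (n - 1) v) * cutoff_slope a b v (u n) \<le> (\<phi> n v - \<phi> (n - 1) v) * (Y v / (b - a))"
            using mono[OF n v(3)] by (intro mult_left_mono) auto
          then show ?thesis using v(3) by (simp only: ball_ext_inside a_def b_def)
        qed
        then have "(\<Sum>n=1..N. ?S n j v) \<le> (\<Sum>n=1..N. (\<phi> n v - \<phi> (n - 1) v) * (Y v / (b - a)))"
          by (intro sum_mono) auto
        also have "\<dots> = (\<Sum>n=1..N. \<phi> n v - \<phi> (n - 1) v) * (Y v / (b - a))" by (simp only: sum_distrib_right)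
        also have "(\<Sum>n=1..N. \<phi> n v - \<phi> (n - 1) v) = \<phi> N v - \<phi> 0 v"
          by (induction N) auto
        also have "(\<phi> N v - \<phi> 0 v) * (Y v / (b - a)) \<le> Z v / (b - a)"
        proof -
          have "0 \<le> \<bar>v \<bullet> u 1\<bar> / norm v" by simp
          also have "\<dots> \<le> Y v" using N v by (intro Y) auto
          finally have "0 \<le> Y v" .
          then have "(\<phi> N v - \<phi> 0 v) * Y v \<le> \<phi> N v * Y v" using nonneg[of 0 v] v by (intro mult_right_mono) auto
          also have "\<dots> \<le> Z v" using Z v by auto
          finally show ?thesis using ab by (simp add: divide_right_mono)
        qed
        finally show ?thesis using True by simp
      qed
    qed
    also have "\<dots> \<le> B * V" using ZB[OF ab] ab by (simp add: V_def pos_divide_le_eq mult_ac)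
    finally show ?thesis .
  qed
  have "(\<lambda>j. \<Sum>n=1..N. \<integral>v. ?S n j v \<partial>lebesgue) \<longlonglongrightarrow> (\<Sum>n=1..N. V * norm (ball_average (m n) - ball_average (m (n - 1))))"
    by (intro tendsto_sum lim)
  then have "(\<Sum>n=1..N. V * norm (ball_average (m n) - ball_average (m (n - 1)))) \<le> B * V"
    by (rule LIMSEQ_le_const2) (use bound in auto)
  then show ?thesis using V by (simp add: sum_distrib_left[symmetric] mult.commute)
qed

text \<open>The affine bound \<open>P - v \<bullet> w\<close> is what an offline play of cost
  \<open>P\<close> ending at \<open>w\<close> imposes on the conjugate. Against the weight 1 its odd
  part integrates to 0 over a shell, so the first factor is exactly \<open>DIM('a)\<close>. Against
  the weight \<open>Y\<close> it is estimated by \<open>2 * P\<close>, which doubles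
  \<open>17 / 4\<close>.\<close>

lemma movement_bound:
  fixes \<phi> :: "nat \<Rightarrow> 'a::euclidean_space \<Rightarrow> real" and m :: "nat \<Rightarrow> 'a \<Rightarrow> 'a" and P :: real
  assumes N: "0 < N" and dp: "\<And>n. n \<le> N \<Longrightarrow> dual_pair (\<phi> n) (m n) (C n)"
    and mono: "\<And>n v. n \<in> {1..N} \<Longrightarrow> norm v < 1 \<Longrightarrow> \<phi> (n - 1) v \<le> \<phi> n v"
    and top: "\<And>v. norm v < 1 \<Longrightarrow> \<phi> N v \<le> P - v \<bullet> w" and w: "norm w \<le> P"
  shows "(\<Sum>n=1..N. norm (ball_average (m n) - ball_average (m (n - 1)))) \<le> DIM('a) * P"
    and "(\<Sum>n=1..N. norm (ball_average (m n) - ball_average (m (n - 1))))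
      \<le> 17 / 2 * sqrt (DIM('a) * ln (real (max 2 N))) * P"
proof -
  have P: "0 \<le> P" using w norm_ge_zero[of w] by linarith
  obtain e :: 'a where e: "norm e = 1" using vector_choose_size[of 1] by auto
  \<comment> \<open>Unit vectors in the directions of displacement; \<open>e\<close> fills in where
    the displacement is 0 and \<open>sgn\<close> would not have norm 1.\<close>
  define u where "u = (\<lambda>n. if ball_average (m n) = ball_average (m (n - 1)) then e
    else sgn (ball_average (m n) - ball_average (m (n - 1))))"
  have u1: "norm (u n) = 1" for n by (simp add: u_def e norm_sgn)
  have u2: "(ball_average (m n) - ball_average (m (n - 1))) \<bullet> u n = norm (ball_average (m n) - ball_average (m (n - 1)))" for n
    by (simp add: u_def sgn_div_norm power2_norm_eq_inner[symmetric] power2_eq_square)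
  show "(\<Sum>n=1..N. norm (ball_average (m n) - ball_average (m (n - 1)))) \<le> DIM('a) * P"
  proof (rule movement_shell_bound[where \<phi> = \<phi> and m = m and C = C and u = u and N = N, OF N dp mono _ u2, where Y = "\<lambda>v. 1" and Z = "\<lambda>v. P - v \<bullet> w"])
    show "\<bar>v \<bullet> u n\<bar> / norm v \<le> 1" if "v \<noteq> 0" for n and v :: 'a
      using Cauchy_Schwarz_ineq2[of v "u n"] that by (simp add: u1 divide_simps)
    show "\<phi> N v * 1 \<le> P - v \<bullet> w" if "norm v < 1" for v using top[OF that] by simp
    fix a b :: real assume ab: "0 < a" "a < b" "b < 1"
    have odd: "(\<integral>v. indicat_real (shell a b) v * (v \<bullet> w) \<partial>lebesgue) = 0"
      by (rule integral_lebesgue_odd) (auto simp: shell_def indicator_def)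
    have i1: "integrable lebesgue (\<lambda>v::'a. indicat_real (shell a b) v * P)"
      using integrable_indicator_shell[of UNIV a b P] by simp
    have i2: "integrable lebesgue (\<lambda>v. indicat_real (shell a b) v * (v \<bullet> w))"
    proof (rule integrable_lebesgue_bounded[where r = 1 and K = "norm w"])
      show "(\<lambda>v. indicat_real (shell a b) v * (v \<bullet> w)) \<in> borel_measurable lebesgue"
        by (intro borel_measurable_lebesgueI) measurable
      show "norm (indicat_real (shell a b) v * (v \<bullet> w)) \<le> norm w" for v
      proof (cases "v \<in> shell a b")
        case True
        then have "norm v * norm w \<le> 1 * norm w" using ab by (intro mult_right_mono) (auto simp: shell_def)
        then show ?thesis using True Cauchy_Schwarz_ineq2[of v w] by simp
      qed simp
      show "indicat_real (shell a b) v * (v \<bullet> w) = 0" if "1 \<le> norm v" for v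
        using that ab by (auto simp: shell_def indicator_def)
    qed
    show "integrable lebesgue (\<lambda>v. indicat_real (shell a b) v * (P - v \<bullet> w))"
      using i1 i2 by (simp add: right_diff_distrib)
    have "(\<integral>v. indicat_real (shell a b) v * (P - v \<bullet> w) \<partial>lebesgue) = measure lebesgue (shell a b :: 'a set) * P"
      using i1 i2 odd by (simp add: right_diff_distrib)
    also have "\<dots> \<le> (DIM('a) * (b - a) * measure lebesgue (ball (0::'a) 1)) * P"
      using ab P by (intro mult_right_mono measure_shell_le; simp)
    finally show "(\<integral>v. indicat_real (shell a b) v * (P - v \<bullet> w) \<partial>lebesgue)
       \<le> DIM('a) * P * (b - a) * measure lebesgue (ball (0::'a) 1)" by (simp only: mult_ac)
  qed
  define \<epsilon> where "\<epsilon> = 2 * sqrt (ln (real (max 2 N)) / DIM('a))"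
  define Y where "Y = (\<lambda>v::'a. \<epsilon> * (1 + (\<Sum>j=1..nat \<lfloor>1 / \<epsilon>\<rfloor>. \<Sum>n=1..N. indicat_real (double_cone (real j * \<epsilon>) (u n)) v)))"
  have Y1: "integrable lebesgue (\<lambda>v. indicat_real (shell a b) v * Y v)"
    and Y3: "(\<integral>v. indicat_real (shell a b) v * Y v \<partial>lebesgue)
       \<le> 17 / 4 * sqrt (DIM('a) * ln (real (max 2 N))) * (b - a) * measure lebesgue (ball (0::'a) 1)"
    if "0 < a" "a < b" "b < 1" for a b
    unfolding Y_def \<epsilon>_def using that by (intro integral_shell_max_le u1; simp)+
  have Y2: "\<bar>v \<bullet> u n\<bar> / norm v \<le> Y v" if "n \<in> {1..N}" "v \<noteq> 0" for n v
    unfolding Y_def \<epsilon>_def by (rule integral_shell_max_le(2)[where a = "1 / 2" and b = 1]) (use that u1 in auto)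
  have "0 \<le> \<epsilon>" by (auto simp: \<epsilon>_def intro!: divide_nonneg_nonneg ln_ge_zero)
  then have Y0: "0 \<le> Y v" for v by (auto simp: Y_def intro!: mult_nonneg_nonneg add_nonneg_nonneg sum_nonneg)
  show "(\<Sum>n=1..N. norm (ball_average (m n) - ball_average (m (n - 1))))
      \<le> 17 / 2 * sqrt (DIM('a) * ln (real (max 2 N))) * P"
  proof (rule movement_shell_bound[where \<phi> = \<phi> and m = m and C = C and u = u and N = N, OF N dp mono _ u2, where Y = Y and Z = "\<lambda>v. 2 * P * Y v"])
    show "\<bar>v \<bullet> u n\<bar> / norm v \<le> Y v" if "n \<in> {1..N}" "v \<noteq> 0" for n v
      using that by (rule Y2)
    show "\<phi> N v * Y v \<le> 2 * P * Y v" if v: "norm v < 1" for v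
    proof -
      have "norm v * norm w \<le> 1 * P" using v w by (intro mult_mono) auto
      then have "\<bar>v \<bullet> w\<bar> \<le> P" using Cauchy_Schwarz_ineq2[of v w] by simp
      then have "\<phi> N v \<le> 2 * P" using top[OF v] by linarith
      then show ?thesis using Y0 by (intro mult_right_mono)
    qed
    fix a b :: real assume ab: "0 < a" "a < b" "b < 1"
    have e: "indicat_real (shell a b) v * (2 * P * Y v) = 2 * P * (indicat_real (shell a b) v * Y v)" for v by simp
    show "integrable lebesgue (\<lambda>v. indicat_real (shell a b) v * (2 * P * Y v))"
      unfolding e using ab by (intro integrable_mult_right Y1)
    have "(\<integral>v. indicat_real (shell a b) v * (2 * P * Y v) \<partial>lebesgue) = 2 * P * (\<integral>v. indicat_real (shell a b) v * Y v \<partial>lebesgue)"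
      unfolding e by (rule Bochner_Integration.integral_mult_right_zero)
    also have "\<dots> \<le> 2 * P * (17 / 4 * sqrt (DIM('a) * ln (real (max 2 N))) * (b - a) * measure lebesgue (ball (0::'a) 1))"
      using ab P by (intro mult_left_mono Y3) auto
    finally show "(\<integral>v. indicat_real (shell a b) v * (2 * P * Y v) \<partial>lebesgue)
       \<le> 17 / 2 * sqrt (DIM('a) * ln (real (max 2 N))) * P * (b - a) * measure lebesgue (ball (0::'a) 1)"
      by (simp add: mult_ac)
  qed
qed

section \<open>Work functions\<close>

text \<open>Half-open intervals make length and service additive and match the periods of the
  requests.\<close>

definition path_length :: "(real \<Rightarrow> 'a::real_normed_vector) \<Rightarrow> real \<Rightarrow> real \<Rightarrow> ennreal" where
  "path_length p a b = (\<integral>\<^sup>+ s\<in>{a..<b}. ennreal (norm (vector_derivative p (at s))) \<partial>lborel)"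

definition service :: "(nat \<Rightarrow> 'a \<Rightarrow> real) \<Rightarrow> (real \<Rightarrow> 'a) \<Rightarrow> real \<Rightarrow> real \<Rightarrow> ennreal" where
  "service f p a b = (\<integral>\<^sup>+ s\<in>{a..<b}. ennreal (request_at f s (p s)) \<partial>lborel)"

lemma measurable_vector_derivative_piecewise_C1:
  fixes p :: "real \<Rightarrow> 'a::euclidean_space"
  assumes "p piecewise_C1_differentiable_on {a..b}"
  shows "(\<lambda>s. indicat_real {a..b} s *\<^sub>R vector_derivative p (at s)) \<in> borel_measurable borel"
proof -
  obtain T D where T: "finite T" and D: "\<And>s. s \<in> {a..b} - T \<Longrightarrow> (p has_vector_derivative D s) (at s)"
    "continuous_on ({a..b} - T) D"
    using assms unfolding piecewise_C1_differentiable_on_def C1_differentiable_on_def by blast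
  have "(\<lambda>s. indicat_real ({a..b} - T) s *\<^sub>R D s) \<in> borel_measurable borel"
    using D(2) T by (intro borel_measurable_continuous_on_indicator) (auto intro: sets.Diff borel_closed finite_imp_closed)
  then show ?thesis
  proof (rule measurable_discrete_difference[where X = T])
    fix s assume "s \<notin> T"
    then show "indicat_real ({a..b} - T) s *\<^sub>R D s = indicat_real {a..b} s *\<^sub>R vector_derivative p (at s)"
      using vector_derivative_at[OF D(1), of s] by (auto simp: indicator_def)
  qed (use T in \<open>auto intro: countable_finite\<close>)
qed

lemma nn_integral_half_open_split:
  fixes g :: "real \<Rightarrow> ennreal"
  assumes m: "(\<lambda>s. g s * indicator {0..<t} s) \<in> borel_measurable lborel" and "0 \<le> a" "a \<le> b" "b \<le> c" "c \<le> t"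
  shows "(\<integral>\<^sup>+ s\<in>{a..<c}. g s \<partial>lborel) = (\<integral>\<^sup>+ s\<in>{a..<b}. g s \<partial>lborel) + (\<integral>\<^sup>+ s\<in>{b..<c}. g s \<partial>lborel)"
proof -
  have e: "g s * indicator {x..<y} s = (g s * indicator {0..<t} s) * indicator {x..<y} s"
    if "0 \<le> x" "y \<le> t" for x y s
    using that by (auto simp: indicator_def)
  have "(\<integral>\<^sup>+ s\<in>{a..<c}. g s \<partial>lborel)
      = (\<integral>\<^sup>+ s. (g s * indicator {0..<t} s) * indicator {a..<b} s + (g s * indicator {0..<t} s) * indicator {b..<c} s \<partial>lborel)"
    using assms by (intro nn_integral_cong) (auto simp: indicator_def)
  also have "\<dots> = (\<integral>\<^sup>+ s. (g s * indicator {0..<t} s) * indicator {a..<b} s \<partial>lborel)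
      + (\<integral>\<^sup>+ s. (g s * indicator {0..<t} s) * indicator {b..<c} s \<partial>lborel)"
    using m by (intro nn_integral_add) (auto intro: borel_measurable_times_ennreal)
  also have "(\<integral>\<^sup>+ s. (g s * indicator {0..<t} s) * indicator {a..<b} s \<partial>lborel) = (\<integral>\<^sup>+ s\<in>{a..<b}. g s \<partial>lborel)"
    by (intro nn_integral_cong e[symmetric]) (use assms in auto)
  also have "(\<integral>\<^sup>+ s. (g s * indicator {0..<t} s) * indicator {b..<c} s \<partial>lborel) = (\<integral>\<^sup>+ s\<in>{b..<c}. g s \<partial>lborel)"
    by (intro nn_integral_cong e[symmetric]) (use assms in auto)
  finally show ?thesis .
qed

lemma path_length_measurable:
  fixes p :: "real \<Rightarrow> 'a::euclidean_space"
  assumes "p piecewise_C1_differentiable_on {0..t}"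
  shows "(\<lambda>s. ennreal (norm (vector_derivative p (at s))) * indicator {0..<t} s) \<in> borel_measurable lborel"
proof -
  have "(\<lambda>s. ennreal (norm (indicat_real {0..t} s *\<^sub>R vector_derivative p (at s))) * indicator {0..<t} s) \<in> borel_measurable lborel"
    using measurable_vector_derivative_piecewise_C1[OF assms]
    by (intro borel_measurable_times_ennreal measurable_compose[OF _ measurable_ennreal]
        measurable_compose[OF _ borel_measurable_norm]) auto
  also have "(\<lambda>s. ennreal (norm (indicat_real {0..t} s *\<^sub>R vector_derivative p (at s))) * indicator {0..<t} s)
     = (\<lambda>s. ennreal (norm (vector_derivative p (at s))) * indicator {0..<t} s)"
    by (auto simp: indicator_def)
  finally show ?thesis .
qed

lemma path_length_split:
  fixes p :: "real \<Rightarrow> 'a::euclidean_space"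
  assumes "p piecewise_C1_differentiable_on {0..t}" "0 \<le> a" "a \<le> b" "b \<le> c" "c \<le> t"
  shows "path_length p a c = path_length p a b + path_length p b c"
  unfolding path_length_def by (rule nn_integral_half_open_split[OF path_length_measurable]) (use assms in auto)

text \<open>If the length is finite, the derivative is Lebesgue integrable, so its integral agrees
  with the gauge integral of the fundamental theorem of calculus, which tolerates the finitely many
  exceptional points.\<close>

lemma norm_diff_le_path_length:
  fixes p :: "real \<Rightarrow> 'a::euclidean_space"
  assumes p: "p piecewise_C1_differentiable_on {0..t}" and ab: "0 \<le> a" "a \<le> b" "b \<le> t"
  shows "ennreal (norm (p b - p a)) \<le> path_length p a b"
proof (cases "path_length p a b = \<infinity>")
  case False
  define D where "D = (\<lambda>s. indicat_real {a..<b} s *\<^sub>R vector_derivative p (at s))"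
  obtain T where T: "finite T" "p C1_differentiable_on ({0..t} - T)" "continuous_on {0..t} p"
    using p by (auto simp: piecewise_C1_differentiable_on_def)
  have D_eq: "D = (\<lambda>s. indicat_real {a..<b} s *\<^sub>R (indicat_real {0..t} s *\<^sub>R vector_derivative p (at s)))"
    using ab by (auto simp: D_def indicator_def)
  have m: "D \<in> borel_measurable lborel"
    unfolding D_eq measurable_lborel2
    by (rule borel_measurable_scaleR[OF _ measurable_vector_derivative_piecewise_C1[OF p]]) simp
  have n: "(\<integral>\<^sup>+ s. ennreal (norm (D s)) \<partial>lborel) = path_length p a b"
    unfolding path_length_def D_def by (intro nn_integral_cong) (auto simp: indicator_def)
  have int: "integrable lborel D"
    using False by (intro integrableI_bounded m) (auto simp: n less_top)
  have "(vector_derivative p \<circ> at has_integral p b - p a) {a..b}"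
  proof (rule fundamental_theorem_of_calculus_interior_strong[OF T(1)])
    show "continuous_on {a..b} p" using T(3) ab by (auto elim: continuous_on_subset)
    fix s assume "s \<in> {a<..<b} - T"
    then have "p differentiable at s" using T(2) ab by (auto simp: C1_differentiable_on_eq)
    then show "(p has_vector_derivative (vector_derivative p \<circ> at) s) (at s)" by (simp add: vector_derivative_works)
  qed (use ab in auto)
  then have "((\<lambda>s. if s \<in> {a..b} then (vector_derivative p \<circ> at) s else 0) has_integral p b - p a) UNIV"
    by (subst has_integral_restrict_UNIV)
  then have "(D has_integral p b - p a) UNIV"
    by (rule has_integral_spike[where S = "{b}", rotated 2]) (auto simp: D_def indicator_def)
  then have "p b - p a = integral\<^sup>L lborel D"
    using has_integral_integral_lborel[OF int] by (rule has_integral_unique)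
  then show ?thesis using integral_norm_bound_ennreal[OF int] by (simp add: n)
qed simp

lemma request_at_eq:
  assumes "1 \<le> n" "real n - 1 \<le> s" "s < real n" shows "request_at f s = f n"
proof -
  have "\<lfloor>s\<rfloor> = int n - 1" using assms by (intro floor_unique) auto
  then have "nat \<lfloor>s\<rfloor> + 1 = n" using assms by simp
  then show ?thesis by (simp add: request_at_def)
qed

lemma exists_period:
  fixes s :: real assumes "0 \<le> s" "s < real N"
  obtains n where "n \<in> {1..N}" "real n - 1 \<le> s" "s < real n"
proof (rule that[of "nat \<lfloor>s\<rfloor> + 1"])
  have "nat \<lfloor>s\<rfloor> < N" using assms by (simp add: floor_less_iff nat_less_iff)
  then show "nat \<lfloor>s\<rfloor> + 1 \<in> {1..N}" by simp
qed (use assms in linarith)+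

lemma has_vector_derivative_linear: "((\<lambda>s. y + (s - a) *\<^sub>R d) has_vector_derivative d) (at s)"
  by (auto intro!: derivative_eq_intros)

lemma piecewise_C1_linear: "(\<lambda>s. y + (s - a) *\<^sub>R d) piecewise_C1_differentiable_on S"
  by (intro C1_differentiable_imp_piecewise)
    (auto simp: C1_differentiable_on_def intro!: exI[of _ "\<lambda>s. d"] has_vector_derivative_linear)

text \<open>Subtracting the finite constant moves it through the infimum. The empty family, whose
  infimum is \<open>\<infinity>\<close>, is included; it occurs for \<open>work_paths\<close> at
  time 0.\<close>

lemma INF_le_add_constI:
  fixes x c :: ennreal
  assumes "\<And>p. p \<in> A \<Longrightarrow> x \<le> g p + c" "c \<noteq> \<infinity>"
  shows "x \<le> (INF p\<in>A. g p) + c"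
proof -
  have "x - c \<le> (INF p\<in>A. g p)"
    using assms by (intro INF_greatest) (simp add: ennreal_minus_le_iff add.commute)
  then show ?thesis using assms(2) by (simp add: ennreal_minus_le_iff add.commute)
qed

section \<open>Work functions of convex requests\<close>

locale requests =
  fixes f :: "nat \<Rightarrow> 'a::euclidean_space \<Rightarrow> real" and N :: nat
  assumes convex_request: "n \<in> {1..N} \<Longrightarrow> convex_on UNIV (f n)"
    and request_nonneg: "n \<in> {1..N} \<Longrightarrow> 0 \<le> f n y"
begin

lemma continuous_request: "n \<in> {1..N} \<Longrightarrow> continuous_on S (f n)"
  using convex_on_continuous[OF open_UNIV convex_request] continuous_on_subset by blast

lemma request_bounded:
  assumes "n \<in> {1..N}" "compact S" obtains M where "0 \<le> M" "\<And>y. y \<in> S \<Longrightarrow> f n y \<le> M"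
proof -
  have "bounded (f n ` S)"
    using assms by (intro compact_imp_bounded compact_continuous_image continuous_request)
  then obtain M where "\<And>y. y \<in> S \<Longrightarrow> \<bar>f n y\<bar> \<le> M" by (auto simp: bounded_iff)
  then show ?thesis by (intro that[of "max 0 M"]) (auto simp: le_max_iff_disj abs_le_iff)
qed

lemma service_measurable:
  assumes p: "continuous_on {0..t} p" and t: "t \<le> real N"
  shows "(\<lambda>s. ennreal (request_at f s (p s)) * indicator {0..<t} s) \<in> borel_measurable lborel"
proof -
  \<comment> \<open>The request jumps at integer times, so the integrand is written as a finite sum
    over periods, each term being continuous on its interval.\<close>
  have "(\<lambda>s. ennreal (\<Sum>n=1..N. indicat_real {real n - 1..<real n} s * (indicat_real {0..t} s *\<^sub>R f n (p s))) * indicator {0..<t} s)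
      \<in> borel_measurable lborel"
  proof (intro borel_measurable_times_ennreal measurable_compose[OF _ measurable_ennreal] borel_measurable_sum borel_measurable_times)
    fix n assume n: "n \<in> {1..N}"
    have "continuous_on {0..t} (\<lambda>s. f n (p s))"
      by (rule continuous_on_compose2[OF continuous_request[OF n, of UNIV] p]) auto
    then show "(\<lambda>s. indicat_real {0..t} s *\<^sub>R f n (p s)) \<in> borel_measurable lborel"
      using borel_measurable_continuous_on_indicator[of "{0..t}" "\<lambda>s. f n (p s)"] by simp
  qed auto
  also have "(\<lambda>s. ennreal (\<Sum>n=1..N. indicat_real {real n - 1..<real n} s * (indicat_real {0..t} s *\<^sub>R f n (p s))) * indicator {0..<t} s)
      = (\<lambda>s. ennreal (request_at f s (p s)) * indicator {0..<t} s)"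
  proof
    fix s
    show "ennreal (\<Sum>n=1..N. indicat_real {real n - 1..<real n} s * (indicat_real {0..t} s *\<^sub>R f n (p s))) * indicator {0..<t} s
      = ennreal (request_at f s (p s)) * indicator {0..<t} s"
    proof (cases "s \<in> {0..<t}")
      case True
      then obtain k where k: "k \<in> {1..N}" "real k - 1 \<le> s" "s < real k"
        using t exists_period[of s N] by auto
      have "(\<Sum>n=1..N. indicat_real {real n - 1..<real n} s * (indicat_real {0..t} s *\<^sub>R f n (p s)))
          = (\<Sum>n=1..N. if n = k then f k (p s) else 0)"
      proof (rule sum.cong)
        fix n
        have "s \<in> {real n - 1..<real n} \<longleftrightarrow> n = k" using k by auto
        then show "indicat_real {real n - 1..<real n} s * (indicat_real {0..t} s *\<^sub>R f n (p s)) = (if n = k then f k (p s) else 0)"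
          using True by (auto simp: indicator_def)
      qed simp
      also have "\<dots> = request_at f s (p s)" using k request_at_eq[of k s f] by simp
      finally show ?thesis by simp
    qed simp
  qed
  finally show ?thesis .
qed

lemma service_split:
  assumes "continuous_on {0..t} p" "t \<le> real N" "0 \<le> a" "a \<le> b" "b \<le> c" "c \<le> t"
  shows "service f p a c = service f p a b + service f p b c"
  unfolding service_def by (rule nn_integral_half_open_split[OF service_measurable]) (use assms in auto)

lemma request_at_nonneg: "0 \<le> s \<Longrightarrow> s < real N \<Longrightarrow> 0 \<le> request_at f s y"
  by (metis exists_period request_at_eq request_nonneg atLeastAtMost_iff)

text \<open>The right endpoint is dropped since \<open>request_at f N\<close> is the unrestricted function \<open>f (N + 1)\<close>.\<close>

lemma path_cost_eq:
  assumes p: "p piecewise_C1_differentiable_on {0..t}" and t: "t \<le> real N"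
  shows "(\<integral>\<^sup>+ s\<in>{0..t}. ennreal (request_at f s (p s) + norm (vector_derivative p (at s))) \<partial>lborel)
      = path_length p 0 t + service f p 0 t"
proof -
  have "(\<integral>\<^sup>+ s\<in>{0..t}. ennreal (request_at f s (p s) + norm (vector_derivative p (at s))) \<partial>lborel)
     = (\<integral>\<^sup>+ s. ennreal (norm (vector_derivative p (at s))) * indicator {0..<t} s
        + ennreal (request_at f s (p s)) * indicator {0..<t} s \<partial>lborel)"
  proof (rule nn_integral_cong_AE)
    show "AE s in lborel. ennreal (request_at f s (p s) + norm (vector_derivative p (at s))) * indicator {0..t} s
       = ennreal (norm (vector_derivative p (at s))) * indicator {0..<t} s + ennreal (request_at f s (p s)) * indicator {0..<t} s"
      using AE_lborel_singleton[of t]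
    proof eventually_elim
      case (elim s)
      show ?case
      proof (cases "s \<in> {0..<t}")
        case True
        then show ?thesis using t request_at_nonneg[of s "p s"] by (simp add: ennreal_plus add.commute)
      qed (use elim in auto)
    qed
  qed
  also have "\<dots> = path_length p 0 t + service f p 0 t"
    unfolding path_length_def service_def
    using p by (intro nn_integral_add path_length_measurable service_measurable t)
      (auto simp: piecewise_C1_differentiable_on_def)
  finally show ?thesis .
qed

lemma work_function_eq:
  "t \<le> real N \<Longrightarrow> work_function f t y = (INF p\<in>work_paths t y. path_length p 0 t + service f p 0 t)"
  unfolding work_function_def by (intro INF_cong) (auto simp: work_paths_def path_cost_eq)

lemma work_function_le:
  "t \<le> real N \<Longrightarrow> p \<in> work_paths t y \<Longrightarrow> work_function f t y \<le> path_length p 0 t + service f p 0 t"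
  by (auto simp: work_function_eq intro: INF_lower)

lemma work_paths_cut: "p \<in> work_paths t y \<Longrightarrow> 0 \<le> \<tau> \<Longrightarrow> \<tau> \<le> t \<Longrightarrow> p \<in> work_paths \<tau> (p \<tau>)"
  by (auto simp: work_paths_def elim: piecewise_C1_differentiable_on_subset)

text \<open>One half of dynamic programming: the initial piece of a path competes in the work
  function at the earlier time.\<close>

lemma work_function_cut:
  assumes t: "t \<le> real N" and p: "p \<in> work_paths t y" and \<tau>: "0 \<le> \<tau>" "\<tau> \<le> t"
  shows "work_function f \<tau> (p \<tau>) + path_length p \<tau> t + service f p \<tau> t \<le> path_length p 0 t + service f p 0 t"
proof -
  have C1: "p piecewise_C1_differentiable_on {0..t}" and c: "continuous_on {0..t} p"
    using p by (auto simp: work_paths_def piecewise_C1_differentiable_on_def)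
  have "work_function f \<tau> (p \<tau>) \<le> path_length p 0 \<tau> + service f p 0 \<tau>"
    using t \<tau> p by (intro work_function_le work_paths_cut) auto
  then have "work_function f \<tau> (p \<tau>) + (path_length p \<tau> t + service f p \<tau> t)
      \<le> path_length p 0 \<tau> + service f p 0 \<tau> + (path_length p \<tau> t + service f p \<tau> t)"
    by (rule add_right_mono)
  then show ?thesis
    using path_length_split[OF C1, of 0 \<tau> t] service_split[OF c t, of 0 \<tau> t] \<tau> by (simp add: ac_simps)
qed

lemma norm_le_work_function: "0 \<le> t \<Longrightarrow> t \<le> real N \<Longrightarrow> ennreal (norm y) \<le> work_function f t y"
  unfolding work_function_eq
proof (rule INF_greatest)
  fix p assume t: "0 \<le> t" and p: "p \<in> work_paths t y"
  have "ennreal (norm (p t - p 0)) \<le> path_length p 0 t"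
    using p t by (intro norm_diff_le_path_length[where t = t]) (auto simp: work_paths_def)
  then show "ennreal (norm y) \<le> path_length p 0 t + service f p 0 t"
    using p by (auto simp: work_paths_def intro: order_trans[OF _ le_iff_add[THEN iffD2]])
qed

lemma work_function_0: "work_function f 0 0 = 0" "y \<noteq> 0 \<Longrightarrow> work_function f 0 y = \<infinity>"
proof -
  have "(\<lambda>s. 0::'a) \<in> work_paths 0 0" by (simp add: work_paths_def piecewise_C1_differentiable_const)
  from work_function_le[OF _ this] have "work_function f 0 0 \<le> path_length (\<lambda>s. 0::'a) 0 0 + service f (\<lambda>s. 0) 0 0"
    by simp
  then show "work_function f 0 0 = 0" by (simp add: path_length_def service_def)
  assume "y \<noteq> 0"
  then have "work_paths 0 y = {}" by (auto simp: work_paths_def)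
  then show "work_function f 0 y = \<infinity>" by (simp add: work_function_def)
qed

text \<open>The other half of dynamic programming: a path is prolonged by a segment from
  \<open>y\<close> to \<open>z\<close> at constant speed. Within one period this pays at most
  \<open>M\<close> per unit of time, so a fast move costs little beyond its length, and
  \<open>y = z\<close> is waiting.\<close>

lemma work_function_extend:
  assumes n: "n \<in> {1..N}" and \<tau>: "real n - 1 \<le> \<tau>" "\<tau> < t" "t \<le> real n"
    and M: "0 \<le> M" "\<And>x. x \<in> closed_segment y z \<Longrightarrow> f n x \<le> M"
  shows "work_function f t z \<le> work_function f \<tau> y + ennreal (norm (z - y) + (t - \<tau>) * M)"
proof -
  have N: "real n \<le> real N" "1 \<le> real n" using n by auto
  have tN: "t \<le> real N" "\<tau> \<le> real N" "0 \<le> \<tau>" using N \<tau> by linarith+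
  show ?thesis
    unfolding work_function_eq[OF tN(2)]
  proof (rule INF_le_add_constI)
    fix p assume p: "p \<in> work_paths \<tau> y"
    define l where "l = (\<lambda>s. y + (s - \<tau>) *\<^sub>R ((1 / (t - \<tau>)) *\<^sub>R (z - y)))"
    define q where "q = (\<lambda>s. if s \<le> \<tau> then p s else l s)"
    have "q piecewise_C1_differentiable_on {0..t}"
      unfolding q_def using p \<tau> tN piecewise_C1_linear[of y \<tau> "(1 / (t - \<tau>)) *\<^sub>R (z - y)"]
      by (intro piecewise_C1_differentiable_cases) (auto simp: work_paths_def l_def)
    then have q: "q \<in> work_paths t z"
      using p \<tau> tN by (auto simp: work_paths_def q_def l_def)
    then have qC: "q piecewise_C1_differentiable_on {0..t}" "continuous_on {0..t} q"
      by (auto simp: work_paths_def piecewise_C1_differentiable_on_def)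
    have "vector_derivative q (at s) = vector_derivative p (at s)" if "s < \<tau>" for s
      by (rule vector_derivative_cong_eq) (use that in \<open>auto simp: q_def eventually_nhds intro!: exI[of _ "{..<\<tau>}"]\<close>)
    then have len1: "path_length q 0 \<tau> = path_length p 0 \<tau>"
      unfolding path_length_def by (intro nn_integral_cong) (auto simp: indicator_def)
    have svc1: "service f q 0 \<tau> = service f p 0 \<tau>"
      unfolding service_def by (intro nn_integral_cong) (auto simp: indicator_def q_def)
    have vl: "vector_derivative q (at s) = (1 / (t - \<tau>)) *\<^sub>R (z - y)" if "\<tau> < s" for s
    proof (rule vector_derivative_at)
      have "(l has_vector_derivative (1 / (t - \<tau>)) *\<^sub>R (z - y)) (at s)"
        unfolding l_def by (rule has_vector_derivative_linear)
      then show "(q has_vector_derivative (1 / (t - \<tau>)) *\<^sub>R (z - y)) (at s)"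
        by (rule has_vector_derivative_transform_within_open[of _ _ _ "{\<tau><..}"]) (use that in \<open>auto simp: q_def\<close>)
    qed
    have len2: "path_length q \<tau> t = ennreal (norm (z - y))"
    proof -
      have "path_length q \<tau> t = (\<integral>\<^sup>+ s. ennreal (norm (z - y) / (t - \<tau>)) * indicator {\<tau>..<t} s \<partial>lborel)"
        unfolding path_length_def using AE_lborel_singleton[of \<tau>] \<tau>
        by (intro nn_integral_cong_AE) (auto simp: vl indicator_def elim!: eventually_mono)
      also have "\<dots> = ennreal (norm (z - y) / (t - \<tau>)) * ennreal (t - \<tau>)"
        using \<tau> by (simp add: nn_integral_cmult_indicator)
      also have "\<dots> = ennreal (norm (z - y))" using \<tau> by (simp flip: ennreal_mult)
      finally show ?thesis .
    qed
    have svc2: "service f q \<tau> t \<le> ennreal ((t - \<tau>) * M)"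
    proof -
      have "service f q \<tau> t \<le> (\<integral>\<^sup>+ s. ennreal M * indicator {\<tau>..<t} s \<partial>lborel)"
        unfolding service_def
      proof (rule nn_integral_mono)
        fix s
        show "ennreal (request_at f s (q s)) * indicator {\<tau>..<t} s \<le> ennreal M * indicator {\<tau>..<t} s"
        proof (cases "s \<in> {\<tau>..<t}")
          case True
          have "q s = l s" using True p by (auto simp: q_def l_def work_paths_def)
          moreover have "l s = (1 - (s - \<tau>) / (t - \<tau>)) *\<^sub>R y + ((s - \<tau>) / (t - \<tau>)) *\<^sub>R z"
            by (simp add: l_def algebra_simps)
          moreover have "0 \<le> (s - \<tau>) / (t - \<tau>)" "(s - \<tau>) / (t - \<tau>) \<le> 1" using True by auto
          ultimately have "q s \<in> closed_segment y z" by (auto simp: closed_segment_def)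
          moreover have "request_at f s = f n" using True \<tau> n by (intro request_at_eq) auto
          ultimately show ?thesis using M True by (simp add: ennreal_leI)
        qed simp
      qed
      also have "\<dots> = ennreal ((t - \<tau>) * M)"
        using \<tau> M by (simp add: nn_integral_cmult_indicator ennreal_mult'' mult.commute)
      finally show ?thesis .
    qed
    have "work_function f t z \<le> path_length q 0 t + service f q 0 t" by (rule work_function_le[OF tN(1) q])
    also have "\<dots> = (path_length q 0 \<tau> + path_length q \<tau> t) + (service f q 0 \<tau> + service f q \<tau> t)"
      using path_length_split[OF qC(1), of 0 \<tau> t] service_split[OF qC(2) tN(1), of 0 \<tau> t] \<tau> tN by simp
    also have "\<dots> \<le> (path_length p 0 \<tau> + ennreal (norm (z - y))) + (service f p 0 \<tau> + ennreal ((t - \<tau>) * M))"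
      unfolding len1 len2 svc1 by (intro add_mono svc2 order_refl)
    also have "\<dots> = path_length p 0 \<tau> + service f p 0 \<tau> + ennreal (norm (z - y) + (t - \<tau>) * M)"
      using \<tau> M by (simp add: ennreal_plus ac_simps)
    finally show "work_function f t z \<le> path_length p 0 \<tau> + service f p 0 \<tau> + ennreal (norm (z - y) + (t - \<tau>) * M)" .
  qed simp
qed

end

text \<open>In contrast to \<open>exists_period\<close>, the time \<open>real n\<close> belongs to
  period \<open>n\<close>, the one in force just before it.\<close>

lemma exists_period_left_open:
  fixes t :: real assumes "0 < t" "t \<le> real N"
  obtains n where "n \<in> {1..N}" "real n - 1 < t" "t \<le> real n"
proof (rule that[of "nat \<lceil>t\<rceil>"])
  have "1 \<le> nat \<lceil>t\<rceil>" "nat \<lceil>t\<rceil> \<le> N" using assms by linarith+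
  then show "nat \<lceil>t\<rceil> \<in> {1..N}" by auto
qed (use assms in linarith)+

section \<open>Conjugates of work functions\<close>

context requests
begin

text \<open>\<open>enn2real\<close> sends \<open>\<infinity>\<close> to 0, so at time 0 this is
  meaningful only at the origin; hence the finiteness hypotheses below.\<close>

definition work :: "real \<Rightarrow> 'a \<Rightarrow> real" where
  "work t y = enn2real (work_function f t y)"

definition dual_point :: "real \<Rightarrow> 'a \<Rightarrow> 'a" where
  "dual_point t = conjugate_point (work_function f t)"

text \<open>The concave conjugate \<open>\<phi>\<^sub>t\<close> of the overview.\<close>

definition dual :: "real \<Rightarrow> 'a \<Rightarrow> real" where
  "dual t v = work t (dual_point t v) - v \<bullet> dual_point t v"

lemma ennreal_work: "work_function f t y \<noteq> \<infinity> \<Longrightarrow> ennreal (work t y) = work_function f t y"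
  by (simp add: work_def less_top)

lemma work_nonneg: "0 \<le> work t y"
  by (simp add: work_def)

text \<open>Induction on the period: from any point where the work function is finite at the start
  of the period, a segment reaches every other point in positive time at finite cost.\<close>

lemma work_function_finite:
  assumes "0 < t" "t \<le> real N" shows "work_function f t y \<noteq> \<infinity>"
proof -
  have *: "work_function f t y \<noteq> \<infinity>" if "n \<in> {1..N}" "real n - 1 < t" "t \<le> real n" for n t y
    using that
  proof (induction n arbitrary: t y)
    case (Suc n)
    have "\<exists>y0. work_function f (real n) y0 \<noteq> \<infinity>"
    proof (cases "n = 0")
      case True
      then show ?thesis using work_function_0(1) by (intro exI[of _ 0]) simp
    next
      case False
      then show ?thesis using Suc by (intro exI[of _ 0] Suc.IH) auto
    qed
    then obtain y0 where y0: "work_function f (real n) y0 \<noteq> \<infinity>" by blast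
    obtain M where M: "0 \<le> M" "\<And>x. x \<in> closed_segment y0 y \<Longrightarrow> f (Suc n) x \<le> M"
      using Suc.prems by (elim request_bounded[OF _ compact_segment]) blast
    have "work_function f t y \<le> work_function f (real n) y0 + ennreal (norm (y - y0) + (t - real n) * M)"
      using Suc.prems by (intro work_function_extend[where n = "Suc n"] M) auto
    also have "\<dots> < \<infinity>" using y0 by (simp add: less_top)
    finally show ?case by simp
  qed simp
  obtain n where "n \<in> {1..N}" "real n - 1 < t" "t \<le> real n"
    using exists_period_left_open[OF assms] .
  then show ?thesis by (rule *)
qed

lemma norm_le_work: "0 \<le> t \<Longrightarrow> t \<le> real N \<Longrightarrow> work_function f t y \<noteq> \<infinity> \<Longrightarrow> norm y \<le> work t y"
  using norm_le_work_function[of t y] by (simp add: work_nonneg flip: ennreal_work)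

lemma work_function_at_0_finite: "0 \<le> t \<Longrightarrow> t \<le> real N \<Longrightarrow> work_function f t 0 \<noteq> \<infinity>"
  using work_function_finite[of t 0] work_function_0(1) by (cases "t = 0") auto

text \<open>A path to \<open>y\<close> is left shortly before \<open>t\<close> and continued
  straight to \<open>z\<close>. The requests are bounded on a ball containing the path and
  \<open>z\<close>, so the service during the detour vanishes with its duration and only the
  distance remains.\<close>

lemma work_function_Lipschitz:
  assumes t: "0 < t" "t \<le> real N"
  shows "work_function f t z \<le> work_function f t y + ennreal (norm (z - y))"
  unfolding work_function_eq[OF t(2), of y]
proof (rule INF_le_add_constI)
  fix p assume p: "p \<in> work_paths t y"
  then have p': "continuous_on {0..t} p" "p t = y"
    by (auto simp: work_paths_def piecewise_C1_differentiable_on_def)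
  let ?cost = "path_length p 0 t + service f p 0 t"
  obtain n where nN: "n \<in> {1..N}" and n: "real n - 1 < t" "t \<le> real n"
    using exists_period_left_open[OF t] .
  then have n0: "0 \<le> real n - 1" by simp
  have "compact (p ` {0..t})" using p' by (intro compact_continuous_image) auto
  then have "bounded (insert z (p ` {0..t}))" by (simp add: compact_imp_bounded)
  then obtain R where "\<forall>x\<in>insert z (p ` {0..t}). norm x \<le> R" unfolding bounded_iff by blast
  then have R: "insert z (p ` {0..t}) \<subseteq> cball 0 R" by auto
  obtain M where M: "0 \<le> M" "\<And>x. x \<in> cball 0 R \<Longrightarrow> f n x \<le> M"
    by (rule request_bounded[OF nN compact_cball[of 0 R]]) blast
  \<comment> \<open>Times in the current period that start at \<open>real n - 1\<close> and increase
    to \<open>t\<close>.\<close>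
  define \<tau> where "\<tau> = (\<lambda>k. t - (t - (real n - 1)) * (1 / real (Suc k)))"
  have \<tau>: "real n - 1 \<le> \<tau> k" "\<tau> k < t" for k
  proof -
    define X where "X = (t - (real n - 1)) * (1 / real (Suc k))"
    have "X \<le> (t - (real n - 1)) * 1" "0 < X"
      unfolding X_def using n by (intro mult_left_mono mult_pos_pos; simp)+
    moreover have eq: "\<tau> k = t - X" by (simp only: \<tau>_def X_def)
    ultimately show "real n - 1 \<le> \<tau> k" "\<tau> k < t" unfolding eq by simp_all
  qed
  have \<tau>lim: "\<tau> \<longlonglongrightarrow> t"
  proof -
    have "(\<lambda>k. t - (t - (real n - 1)) * (1 / real (Suc k))) \<longlonglongrightarrow> t - (t - (real n - 1)) * 0"
      by (intro tendsto_intros LIMSEQ_Suc[OF lim_1_over_n])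
    then show ?thesis by (simp add: \<tau>_def)
  qed
  have "\<tau> k \<in> {0..t}" for k using order_trans[OF n0 \<tau>(1)[of k]] \<tau>(2)[of k] by simp
  then have plim: "(\<lambda>k. p (\<tau> k)) \<longlonglongrightarrow> y"
    using continuous_on_tendsto_compose[OF p'(1) \<tau>lim] t p'(2) by simp
  have le: "work_function f t z \<le> ?cost + ennreal (norm (z - p (\<tau> k)) + (t - \<tau> k) * M)" for k
  proof -
    have \<tau>0: "0 \<le> \<tau> k" "\<tau> k \<le> t" using \<tau>[of k] n n0 by linarith+
    have "work_function f t z \<le> work_function f (\<tau> k) (p (\<tau> k)) + ennreal (norm (z - p (\<tau> k)) + (t - \<tau> k) * M)"
    proof (rule work_function_extend[OF nN \<tau> n(2) M(1)])
      fix x assume x: "x \<in> closed_segment (p (\<tau> k)) z"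
      have "p (\<tau> k) \<in> cball 0 R" "z \<in> cball 0 R" using R \<tau>0 by (auto simp: image_subset_iff)
      then have "closed_segment (p (\<tau> k)) z \<subseteq> cball 0 R"
        by (intro closed_segment_subset) auto
      then show "f n x \<le> M" using x by (intro M) auto
    qed
    also have "work_function f (\<tau> k) (p (\<tau> k)) \<le> ?cost"
      using work_function_cut[OF t(2) p \<tau>0] by (auto intro: order_trans[rotated])
    finally show ?thesis by (simp add: add_right_mono)
  qed
  have "(\<lambda>k. ?cost + ennreal (norm (z - p (\<tau> k)) + (t - \<tau> k) * M)) \<longlonglongrightarrow> ?cost + ennreal (norm (z - y) + (t - t) * M)"
    by (intro tendsto_intros tendsto_ennrealI plim \<tau>lim)
  then have "(\<lambda>k. ?cost + ennreal (norm (z - p (\<tau> k)) + (t - \<tau> k) * M)) \<longlonglongrightarrow> ?cost + ennreal (norm (z - y))" by simp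
  then show "work_function f t z \<le> ?cost + ennreal (norm (z - y))"
    by (rule LIMSEQ_le_const) (use le in blast)
qed simp

lemma work_Lipschitz:
  assumes t: "0 < t" "t \<le> real N" shows "\<bar>work t z - work t y\<bar> \<le> norm (z - y)"
proof -
  have "work t z \<le> work t y + norm (z - y)" for y z
    using work_function_Lipschitz[OF t, of z y]
    by (simp add: ennreal_work[OF work_function_finite[OF t], symmetric] work_nonneg del: ennreal_plus flip: ennreal_plus)
  from this[of z y] this[of y z] show ?thesis by (simp add: abs_le_iff norm_minus_commute)
qed

lemma enn2ereal_work: "work_function f t y \<noteq> \<infinity> \<Longrightarrow> enn2ereal (work_function f t y) = ereal (work t y)"
  by (subst ennreal_work[symmetric]) (auto simp: work_nonneg)

text \<open>Since work functions dominate the norm, the objective is at least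
  \<open>(1 - norm v) * norm w\<close>, which exceeds its value at \<open>0\<close> outside the ball
  of radius \<open>R\<close>; inside, compactness applies. At time 0 the origin is the only point
  with a finite value.\<close>

lemma conjugate_minimizer_exists:
  assumes t: "0 \<le> t" "t \<le> real N" and v: "norm v < 1"
  shows "\<exists>m. \<forall>w. enn2ereal (work_function f t m) - ereal (v \<bullet> m) \<le> enn2ereal (work_function f t w) - ereal (v \<bullet> w)"
proof (cases "t = 0")
  case True
  show ?thesis
  proof (intro exI[of _ 0] allI)
    fix w
    show "enn2ereal (work_function f t 0) - ereal (v \<bullet> 0) \<le> enn2ereal (work_function f t w) - ereal (v \<bullet> w)"
      using True work_function_0 by (cases "w = 0") auto
  qed
next
  case False
  then have t0: "0 < t" using t by simp
  define g where "g = (\<lambda>w. work t w - v \<bullet> w)"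
  have "continuous_on UNIV (work t)"
    by (rule lipschitz_on_continuous_on[where L = 1], rule lipschitz_onI)
      (use work_Lipschitz[OF t0 t(2)] in \<open>auto simp: dist_norm\<close>)
  then have g: "continuous_on (cball 0 R) g" for R
    unfolding g_def by (intro continuous_intros) (auto elim: continuous_on_subset)
  define R where "R = work t 0 / (1 - norm v)"
  have R: "0 \<le> R" using v by (simp add: R_def work_nonneg)
  then obtain m where m: "m \<in> cball 0 R" "\<And>w. w \<in> cball 0 R \<Longrightarrow> g m \<le> g w"
    using continuous_attains_inf[OF compact_cball _ g] by (metis centre_in_cball empty_iff)
  have "g m \<le> g w" for w
  proof (cases "w \<in> cball 0 R")
    case False
    then have "R < norm w" by simp
    then have "work t 0 \<le> (1 - norm v) * norm w"
      using v by (simp add: R_def pos_divide_less_eq mult.commute)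
    also have "\<dots> \<le> g w"
      using norm_le_work[OF t work_function_finite[OF t0 t(2)], of w] norm_cauchy_schwarz[of v w]
      by (simp add: g_def algebra_simps)
    also have "work t 0 = g 0" by (simp add: g_def)
    finally show ?thesis using m(2)[of 0] R by simp
  qed (rule m)
  then show ?thesis
    by (intro exI[of _ m]) (simp add: enn2ereal_work[OF work_function_finite[OF t0 t(2)]] g_def)
qed

lemma conjugate_point_minimal:
  assumes "0 \<le> t" "t \<le> real N" "norm v < 1"
  shows "enn2ereal (work_function f t (dual_point t v)) - ereal (v \<bullet> dual_point t v)
    \<le> enn2ereal (work_function f t w) - ereal (v \<bullet> w)"
proof -
  let ?F = "\<lambda>w. enn2ereal (work_function f t w) - ereal (v \<bullet> w)"
  have "\<exists>m. is_arg_min ?F (\<lambda>w. True) m"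
    using conjugate_minimizer_exists[OF assms] by (auto simp: is_arg_min_linorder)
  then have "is_arg_min ?F (\<lambda>w. True) (dual_point t v)"
    unfolding dual_point_def conjugate_point_def arg_min_def by (rule someI_ex)
  then show ?thesis by (auto simp: is_arg_min_linorder)
qed

lemma dual_point_finite:
  assumes "0 \<le> t" "t \<le> real N" "norm v < 1" shows "work_function f t (dual_point t v) \<noteq> \<infinity>"
proof
  assume "work_function f t (dual_point t v) = \<infinity>"
  with conjugate_point_minimal[OF assms, of 0] enn2ereal_work[OF work_function_at_0_finite[OF assms(1,2)]]
  show False by simp
qed

lemma dual_le:
  assumes "0 \<le> t" "t \<le> real N" "norm v < 1" "work_function f t w \<noteq> \<infinity>"
  shows "dual t v \<le> work t w - v \<bullet> w"
  using conjugate_point_minimal[OF assms(1-3), of w] enn2ereal_work[OF assms(4)]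
    enn2ereal_work[OF dual_point_finite[OF assms(1-3)]] by (simp add: dual_def)

lemma dual_pair_dual:
  assumes t: "0 \<le> t" "t \<le> real N"
  shows "dual_pair (dual t) (dual_point t) (work t 0)"
proof
  fix v w :: 'a assume v: "norm v < 1"
  note fin = dual_point_finite[OF t v]
  show "dual t w \<le> dual t v + (v - w) \<bullet> dual_point t v" if "norm w < 1"
    using dual_le[OF t that fin] by (simp add: dual_def inner_diff_left)
  show "norm (dual_point t v) \<le> dual t v + v \<bullet> dual_point t v"
    using norm_le_work[OF t fin] by (simp add: dual_def)
  show "dual t v \<le> work t 0" using dual_le[OF t v work_function_at_0_finite[OF t]] by simp
  have "v \<bullet> dual_point t v \<le> norm v * norm (dual_point t v)" by (rule norm_cauchy_schwarz)
  also have "\<dots> \<le> 1 * norm (dual_point t v)" using v by (intro mult_right_mono) auto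
  finally show "0 \<le> dual t v" using norm_le_work[OF t fin] by (simp add: dual_def)
qed

text \<open>The infimum over paths need not be attained, hence the slack \<open>\<eta>\<close>.
  Finiteness of the total allows real numbers for its three parts: work up to \<open>\<tau>\<close>,
  then length \<open>L\<close> and service \<open>S\<close>.\<close>

lemma near_optimal_path:
  assumes \<tau>: "0 \<le> \<tau>" "\<tau> \<le> t" and t: "t \<le> real N" and y: "work_function f t y \<noteq> \<infinity>" and \<eta>: "0 < \<eta>"
  obtains p L S where "p t = y" "work_function f \<tau> (p \<tau>) \<noteq> \<infinity>" "0 \<le> S" "service f p \<tau> t = ennreal S"
    "work \<tau> (p \<tau>) + L + S \<le> work t y + \<eta>" "\<And>s. \<tau> \<le> s \<Longrightarrow> s \<le> t \<Longrightarrow> norm (p s - p \<tau>) \<le> L"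
proof -
  have "work_function f t y < work_function f t y + ennreal \<eta>"
    using \<eta> work_nonneg[of t y]
    by (simp add: ennreal_work[OF y, symmetric] ennreal_less_iff del: ennreal_plus flip: ennreal_plus)
  then have "\<exists>p\<in>work_paths t y. path_length p 0 t + service f p 0 t < work_function f t y + ennreal \<eta>"
    unfolding work_function_eq[OF t] by (simp add: INF_less_iff)
  then obtain p where p: "p \<in> work_paths t y"
    and c: "path_length p 0 t + service f p 0 t < work_function f t y + ennreal \<eta>" by blast
  have "work_function f \<tau> (p \<tau>) + path_length p \<tau> t + service f p \<tau> t < ennreal (work t y + \<eta>)"
    using le_less_trans[OF work_function_cut[OF t p \<tau>] c] y \<eta> by (simp add: ennreal_work work_nonneg)
  then have fin: "work_function f \<tau> (p \<tau>) \<noteq> \<infinity>" "path_length p \<tau> t \<noteq> \<infinity>" "service f p \<tau> t \<noteq> \<infinity>"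
    and le: "work_function f \<tau> (p \<tau>) + path_length p \<tau> t + service f p \<tau> t \<le> ennreal (work t y + \<eta>)"
    by auto
  define L S where "L = enn2real (path_length p \<tau> t)" and "S = enn2real (service f p \<tau> t)"
  have L: "ennreal L = path_length p \<tau> t" "0 \<le> L" and S: "ennreal S = service f p \<tau> t" "0 \<le> S"
    using fin by (auto simp: L_def S_def less_top)
  show ?thesis
  proof (rule that[of p S L])
    show "p t = y" using p by (simp add: work_paths_def)
    show "work \<tau> (p \<tau>) + L + S \<le> work t y + \<eta>"
      using le unfolding ennreal_work[OF fin(1), symmetric] L(1)[symmetric] S(1)[symmetric]
      using L(2) S(2) \<eta> work_nonneg by (simp del: ennreal_plus flip: ennreal_plus)
    fix s assume s: "\<tau> \<le> s" "s \<le> t"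
    have C1: "p piecewise_C1_differentiable_on {0..t}" using p by (simp add: work_paths_def)
    have "ennreal (norm (p s - p \<tau>)) \<le> path_length p \<tau> s"
      using s \<tau> by (intro norm_diff_le_path_length[OF C1]) auto
    also have "\<dots> \<le> path_length p \<tau> t"
      using path_length_split[OF C1, of \<tau> s t] s \<tau> by simp
    finally show "norm (p s - p \<tau>) \<le> L" using L(2) unfolding L(1)[symmetric] by simp
  qed (use fin S in auto)
qed

text \<open>Going back along a near optimal path from time \<open>t\<close> to \<open>\<tau>\<close>
  saves its length \<open>L\<close>, while the linear term changes by at most
  \<open>norm v * L\<close>.\<close>

lemma dual_mono:
  assumes \<tau>: "0 \<le> \<tau>" "\<tau> \<le> t" and t: "t \<le> real N" and v: "norm v < 1"
  shows "dual \<tau> v \<le> dual t v"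
proof (rule field_le_epsilon)
  fix \<eta> :: real assume "0 < \<eta>"
  have tt: "0 \<le> t" "\<tau> \<le> real N" using \<tau> t by auto
  obtain p L S where p: "p t = dual_point t v" "work_function f \<tau> (p \<tau>) \<noteq> \<infinity>" "0 \<le> S" "service f p \<tau> t = ennreal S"
    "work \<tau> (p \<tau>) + L + S \<le> work t (dual_point t v) + \<eta>" "\<And>s. \<tau> \<le> s \<Longrightarrow> s \<le> t \<Longrightarrow> norm (p s - p \<tau>) \<le> L"
    by (rule near_optimal_path[OF \<tau> t dual_point_finite[OF tt(1) t v] \<open>0 < \<eta>\<close>]) (rule that)
  have "v \<bullet> (p t - p \<tau>) \<le> norm v * norm (p t - p \<tau>)" by (rule norm_cauchy_schwarz)
  also have "\<dots> \<le> 1 * norm (p t - p \<tau>)" using v by (intro mult_right_mono) auto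
  also have "\<dots> \<le> L" using p(6)[of t] \<tau> by simp
  finally have "v \<bullet> dual_point t v - v \<bullet> p \<tau> \<le> L" by (simp add: p(1) inner_diff_right)
  then show "dual \<tau> v \<le> dual t v + \<eta>"
    using dual_le[OF \<tau>(1) tt(2) v p(2)] p(3,5) unfolding dual_def[of t] by linarith
qed

text \<open>A discrete play becomes a path that performs each jump during the first
  \<open>\<delta>\<close> of the period and then waits at the new point. Service during the jump is
  at most \<open>\<delta> * M\<close> and disappears as \<open>\<delta>\<close> tends to 0.\<close>

lemma work_le_total_cost:
  assumes x: "x 0 = 0" and n: "n \<le> N"
  shows "work_function f (real n) (x n) \<noteq> \<infinity> \<and> work (real n) (x n) \<le> (\<Sum>k=1..n. f k (x k) + norm (x k - x (k - 1)))"
  using n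
proof (induction n)
  case 0
  then show ?case using x work_function_0(1) by (simp add: work_def)
next
  case (Suc n)
  then have IH: "work_function f (real n) (x n) \<noteq> \<infinity>"
    "work (real n) (x n) \<le> (\<Sum>k=1..n. f k (x k) + norm (x k - x (k - 1)))" by auto
  have nN: "Suc n \<in> {1..N}" using Suc by auto
  have fin: "work_function f (real (Suc n)) (x (Suc n)) \<noteq> \<infinity>"
    using Suc by (intro work_function_finite) auto
  obtain M where M: "0 \<le> M" "\<And>y. y \<in> closed_segment (x n) (x (Suc n)) \<Longrightarrow> f (Suc n) y \<le> M"
    by (rule request_bounded[OF nN compact_segment]) blast
  have f0: "0 \<le> f (Suc n) (x (Suc n))" by (rule request_nonneg[OF nN])
  have step: "work (real (Suc n)) (x (Suc n)) \<le> work (real n) (x n) + norm (x (Suc n) - x n) + f (Suc n) (x (Suc n)) + \<delta> * M"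
    if \<delta>: "0 < \<delta>" "\<delta> < 1" for \<delta>
  proof -
    have "work_function f (real n + \<delta>) (x (Suc n)) \<le> work_function f (real n) (x n) + ennreal (norm (x (Suc n) - x n) + (real n + \<delta> - real n) * M)"
      using \<delta> by (intro work_function_extend[OF nN] M) auto
    moreover have "work_function f (real (Suc n)) (x (Suc n)) \<le> work_function f (real n + \<delta>) (x (Suc n))
        + ennreal (norm (x (Suc n) - x (Suc n)) + (real (Suc n) - (real n + \<delta>)) * f (Suc n) (x (Suc n)))"
      using \<delta> f0 by (intro work_function_extend[OF nN]) auto
    ultimately have "work_function f (real (Suc n)) (x (Suc n)) \<le> work_function f (real n) (x n)
        + ennreal (norm (x (Suc n) - x n) + (real n + \<delta> - real n) * M)
        + ennreal (norm (x (Suc n) - x (Suc n)) + (real (Suc n) - (real n + \<delta>)) * f (Suc n) (x (Suc n)))"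
      by (meson add_right_mono order_trans)
    then have "ennreal (work (real (Suc n)) (x (Suc n))) \<le> ennreal (work (real n) (x n))
        + ennreal (norm (x (Suc n) - x n) + \<delta> * M) + ennreal ((1 - \<delta>) * f (Suc n) (x (Suc n)))"
      unfolding ennreal_work[OF fin, symmetric] ennreal_work[OF IH(1), symmetric] by (simp add: algebra_simps)
    also have "\<dots> = ennreal (work (real n) (x n) + (norm (x (Suc n) - x n) + \<delta> * M) + (1 - \<delta>) * f (Suc n) (x (Suc n)))"
      using \<delta> M f0 work_nonneg[of "real n" "x n"] by (subst ennreal_plus; simp?)+
    finally have "work (real (Suc n)) (x (Suc n)) \<le> work (real n) (x n) + (norm (x (Suc n) - x n) + \<delta> * M) + (1 - \<delta>) * f (Suc n) (x (Suc n))"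
      using \<delta> M f0 work_nonneg[of "real n" "x n"] by (subst (asm) ennreal_le_iff) (auto intro!: add_nonneg_nonneg)
    moreover have "(1 - \<delta>) * f (Suc n) (x (Suc n)) \<le> f (Suc n) (x (Suc n))"
      using \<delta> f0 by (simp add: algebra_simps)
    ultimately show ?thesis by linarith
  qed
  have "work (real (Suc n)) (x (Suc n)) \<le> work (real n) (x n) + norm (x (Suc n) - x n) + f (Suc n) (x (Suc n)) + 0 * M"
  proof (rule tendsto_lowerbound)
    show "((\<lambda>\<delta>. work (real n) (x n) + norm (x (Suc n) - x n) + f (Suc n) (x (Suc n)) + \<delta> * M)
      \<longlongrightarrow> work (real n) (x n) + norm (x (Suc n) - x n) + f (Suc n) (x (Suc n)) + 0 * M) (at_right 0)"
      by (intro tendsto_intros)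
    show "\<forall>\<^sub>F \<delta> in at_right 0. work (real (Suc n)) (x (Suc n)) \<le> work (real n) (x n) + norm (x (Suc n) - x n) + f (Suc n) (x (Suc n)) + \<delta> * M"
      unfolding eventually_at_right_field using step by (intro exI[of _ 1]) auto
  qed simp
  then show ?case using IH fin by simp
qed

end

section \<open>Service cost and the main bound\<close>

text \<open>A hyperplane separates \<open>(x, f x)\<close> from the strict epigraph. It is not
  vertical because \<open>f\<close> is finite everywhere, so its slope is a subgradient.\<close>

lemma convex_subgradient:
  fixes f :: "'a::euclidean_space \<Rightarrow> real"
  assumes f: "convex_on UNIV f"
  obtains g where "\<And>y. f x + g \<bullet> (y - x) \<le> f y"
proof -
  define E where "E = {(y, r). f y < r}"
  have "convex E"
    unfolding convex_def E_def
  proof clarsimp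
    fix y1 r1 y2 r2 and u v :: real
    assume le: "f y1 < r1" "f y2 < r2" and uv: "0 \<le> u" "0 \<le> v" "u + v = 1"
    have "f (u *\<^sub>R y1 + v *\<^sub>R y2) \<le> u * f y1 + v * f y2"
      using f uv by (auto simp: convex_on_def)
    also have "\<dots> < u * r1 + v * r2"
    proof (cases "u = 0")
      case True
      then show ?thesis using uv le by simp
    next
      case False
      then have "u * f y1 < u * r1" "v * f y2 \<le> v * r2"
        using le uv by (auto intro!: mult_strict_left_mono mult_left_mono)
      then show ?thesis by linarith
    qed
    finally show "f (u *\<^sub>R y1 + v *\<^sub>R y2) < u * r1 + v * r2" .
  qed
  moreover have "(x, f x) \<notin> E" by (simp add: E_def)
  moreover have "(x, f x + 1) \<in> E" by (simp add: E_def)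
  ultimately obtain a c where ac: "a \<noteq> 0" "\<And>z. z \<in> {(x, f x)} \<Longrightarrow> a \<bullet> z \<le> c" "\<And>z. z \<in> E \<Longrightarrow> c \<le> a \<bullet> z"
    using separating_hyperplane_sets[of "{(x, f x)}" E] by fastforce
  obtain h k where a: "a = (h, k)" by (cases a)
  have sep: "h \<bullet> x + k * f x \<le> h \<bullet> y + k * r" if "f y < r" for y r
    using ac(2)[of "(x, f x)"] ac(3)[of "(y, r)"] that by (simp add: a E_def)
  have k: "0 < k"
  proof -
    have "0 \<le> k" using sep[of x "f x + 1"] by (simp add: algebra_simps)
    moreover have "k \<noteq> 0"
    proof
      assume "k = 0"
      \<comment> \<open>A vertical hyperplane is refuted by the point above
        \<open>x - h\<close>.\<close>
      then have "h \<bullet> x \<le> h \<bullet> (x - h)" using sep[of "x - h" "f (x - h) + 1"] by simp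
      then have "h \<bullet> h \<le> 0" by (simp add: inner_diff_right)
      then have "h = 0" using inner_gt_zero_iff[of h] by linarith
      then show False using ac(1) \<open>k = 0\<close> a by (simp add: zero_prod_def)
    qed
    ultimately show ?thesis by simp
  qed
  show ?thesis
  proof (rule that[of "- (1 / k) *\<^sub>R h"])
    fix y
    have "h \<bullet> x + k * f x \<le> h \<bullet> y + k * f y"
    proof (rule field_le_epsilon)
      fix e :: real assume "0 < e"
      then show "h \<bullet> x + k * f x \<le> h \<bullet> y + k * f y + e"
        using sep[of y "f y + e / k"] k by (simp add: algebra_simps)
    qed
    then show "f x + (- (1 / k) *\<^sub>R h) \<bullet> (y - x) \<le> f y"
      using k by (simp add: field_simps inner_diff_right)
  qed
qed

text \<open>The affine minorant of a request in \<open>potential_growth\<close> may be negative;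
  \<open>ennreal\<close> truncates it at 0.\<close>

lemma ennreal_integral_le_nn_integral:
  fixes g :: "'b \<Rightarrow> real"
  assumes "integrable M g" shows "ennreal (integral\<^sup>L M g) \<le> (\<integral>\<^sup>+ x. ennreal (g x) \<partial>M)"
proof -
  have "integral\<^sup>L M g \<le> integral\<^sup>L M (\<lambda>x. max 0 (g x))"
    using assms by (intro Bochner_Integration.integral_mono integrable_max) auto
  then have "ennreal (integral\<^sup>L M g) \<le> ennreal (integral\<^sup>L M (\<lambda>x. max 0 (g x)))" by (rule ennreal_leI)
  also have "\<dots> = (\<integral>\<^sup>+ x. ennreal (max 0 (g x)) \<partial>M)"
    using assms by (intro nn_integral_eq_integral[symmetric] integrable_max) auto
  also have "\<dots> = (\<integral>\<^sup>+ x. ennreal (g x) \<partial>M)"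
    by (intro nn_integral_cong) (simp add: max_def ennreal_neg)
  finally show ?thesis .
qed

lemma integral_ball_inner:
  fixes w :: "'a::euclidean_space"
  shows "(\<integral>v. indicat_real (ball 0 1) v * (v \<bullet> w) \<partial>lebesgue) = 0"
proof (rule integral_lebesgue_odd)
  show "(\<lambda>v. indicat_real (ball 0 1) v * (v \<bullet> w)) \<in> borel_measurable borel"
    by (intro borel_measurable_times borel_measurable_indicator borel_measurable_inner) simp_all
qed (auto simp: indicator_def)

lemma integrable_ball_inner:
  fixes w :: "'a::euclidean_space"
  shows "integrable lebesgue (\<lambda>v. indicat_real (ball 0 1) v * (v \<bullet> w))"
proof (rule integrable_lebesgue_bounded[where r = 1 and K = "norm w"])
  show "(\<lambda>v. indicat_real (ball 0 1) v * (v \<bullet> w)) \<in> borel_measurable lebesgue"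
    by (intro borel_measurable_lebesgueI borel_measurable_times borel_measurable_indicator borel_measurable_inner) simp_all
  show "norm (indicat_real (ball 0 1) v * (v \<bullet> w)) \<le> norm w" for v
  proof (cases "v \<in> ball 0 1")
    case True
    then have "norm v * norm w \<le> 1 * norm w" by (intro mult_right_mono) auto
    then show ?thesis using True Cauchy_Schwarz_ineq2[of v w] by simp
  qed simp
qed auto

section \<open>Growth of the conjugate and of its integral\<close>

context requests
begin

text \<open>A near optimal path up to time \<open>t + h\<close> is short on \<open>[t, t + h]\<close> since \<open>norm v < 1\<close>. Its position at
  time \<open>t\<close> is a near minimizer, hence close to \<open>dual_point t v\<close> by stability, so that the path
  pays almost \<open>f n (dual_point t v)\<close> during this time.\<close>

lemma dual_growth:
  assumes n: "n \<in> {1..N}" and t: "real n - 1 \<le> t" "t < real n" and v: "norm v < 1"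
    and stable: "\<And>\<epsilon>. \<epsilon> > 0 \<Longrightarrow> \<exists>\<delta>>0. \<forall>z. (\<forall>w. norm w < 1 \<longrightarrow> dual t w \<le> dual t v + \<delta> + (v - w) \<bullet> z)
            \<longrightarrow> norm (z - dual_point t v) \<le> \<epsilon>"
    and c: "0 \<le> c" "c < f n (dual_point t v)"
  obtains h0 where "0 < h0" "\<And>h. 0 < h \<Longrightarrow> h < h0 \<Longrightarrow> c * h \<le> dual (t + h) v - dual t v"
proof -
  have tN: "0 \<le> t" "t \<le> real N" using n t by auto
  \<comment> \<open>A rate strictly between \<open>c\<close> and the request: the margin above
    \<open>c\<close> pays for the slack of the near optimal path, the margin below the request
    leaves room for continuity.\<close>
  define \<gamma> where "\<gamma> = (c + f n (dual_point t v)) / 2"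
  have \<gamma>: "c < \<gamma>" "\<gamma> < f n (dual_point t v)" "0 < \<gamma>" using c by (auto simp: \<gamma>_def)
  have "isCont (f n) (dual_point t v)"
    using continuous_request[OF n, of UNIV] by (simp add: continuous_on_eq_continuous_at)
  then have "eventually (\<lambda>x. \<gamma> < f n x) (nhds (dual_point t v))"
    using \<gamma>(2) by (intro order_tendstoD(1)[where y = "f n (dual_point t v)"])
      (simp_all add: continuous_at tendsto_at_iff_tendsto_nhds)
  then obtain \<epsilon> where \<epsilon>: "0 < \<epsilon>" "\<And>x. dist x (dual_point t v) < \<epsilon> \<Longrightarrow> \<gamma> < f n x"
    unfolding eventually_nhds_metric by blast
  obtain \<delta> where \<delta>: "0 < \<delta>" "\<And>z. (\<And>w. norm w < 1 \<Longrightarrow> dual t w \<le> dual t v + \<delta> + (v - w) \<bullet> z)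
      \<Longrightarrow> norm (z - dual_point t v) \<le> \<epsilon> / 2"
    using stable[of "\<epsilon> / 2"] \<epsilon> by auto
  \<comment> \<open>The three bounds keep \<open>t + h\<close> in the period, the path length below
    \<open>\<epsilon> / 2\<close>, and the value at the position of time \<open>t\<close> within
    \<open>\<delta>\<close> of the minimum.\<close>
  define h0 where "h0 = Min {real n - t, \<epsilon> / 2 * (1 - norm v) / \<gamma>, \<delta> / \<gamma>}"
  have h0: "0 < h0" "h0 \<le> real n - t" "h0 \<le> \<epsilon> / 2 * (1 - norm v) / \<gamma>" "h0 \<le> \<delta> / \<gamma>"
    unfolding h0_def using t \<epsilon> \<delta> \<gamma> v by auto
  show ?thesis
  proof (rule that[OF h0(1)])
    fix h assume h: "0 < h" "h < h0"
    have thN: "t + h \<le> real N" "t + h < real n" using h h0 n by auto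
    show "c * h \<le> dual (t + h) v - dual t v"
    proof (rule ccontr)
      assume "\<not> c * h \<le> dual (t + h) v - dual t v"
      then have less: "dual (t + h) v < dual t v + c * h" by simp
      have \<eta>: "0 < (\<gamma> - c) * h" using \<gamma> h by simp
      have tth: "t \<le> t + h" "0 \<le> t + h" using h tN by auto
      obtain p L S where p: "p (t + h) = dual_point (t + h) v" "work_function f t (p t) \<noteq> \<infinity>" "0 \<le> S"
        "service f p t (t + h) = ennreal S"
        "work t (p t) + L + S \<le> work (t + h) (dual_point (t + h) v) + (\<gamma> - c) * h"
        "\<And>s. t \<le> s \<Longrightarrow> s \<le> t + h \<Longrightarrow> norm (p s - p t) \<le> L"
        by (rule near_optimal_path[OF tN(1) tth(1) thN(1) dual_point_finite[OF tth(2) thN(1) v] \<eta>]) (rule that)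
      have "v \<bullet> (p (t + h) - p t) \<le> norm v * norm (p (t + h) - p t)" by (rule norm_cauchy_schwarz)
      also have "\<dots> \<le> norm v * L" using p(6)[of "t + h"] h by (intro mult_left_mono) auto
      finally have vL: "v \<bullet> dual_point (t + h) v - v \<bullet> p t \<le> norm v * L" by (simp add: p(1) inner_diff_right)
      have L0: "0 \<le> L" using p(6)[of t] h by simp
      have main: "work t (p t) - v \<bullet> p t + (1 - norm v) * L + S < dual t v + \<gamma> * h"
        using p(5) vL less unfolding dual_def[of "t + h"] by (simp add: algebra_simps)
      have low: "dual t v \<le> work t (p t) - v \<bullet> p t" by (rule dual_le[OF tN v p(2)])
      have vL0: "0 \<le> (1 - norm v) * L" using v L0 by simp
      have "(1 - norm v) * L < \<gamma> * h" using main low p(3) by linarith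
      also have "\<gamma> * h < \<epsilon> / 2 * (1 - norm v)"
        using less_le_trans[OF h(2) h0(3)] \<gamma> by (simp add: pos_less_divide_eq mult_ac)
      finally have "(1 - norm v) * L < (1 - norm v) * (\<epsilon> / 2)" by (simp add: mult.commute)
      then have L: "L < \<epsilon> / 2" using v by simp
      have "\<gamma> * h < \<delta>" using less_le_trans[OF h(2) h0(4)] \<gamma> by (simp add: pos_less_divide_eq mult.commute)
      then have near: "work t (p t) - v \<bullet> p t \<le> dual t v + \<delta>" using main vL0 p(3) by linarith
      have "norm (p t - dual_point t v) \<le> \<epsilon> / 2"
      proof (rule \<delta>(2))
        fix w :: 'a assume "norm w < 1"
        from dual_le[OF tN this p(2)] near show "dual t w \<le> dual t v + \<delta> + (v - w) \<bullet> p t"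
          by (simp add: inner_diff_left)
      qed
      then have big: "\<gamma> \<le> f n (p s)" if "t \<le> s" "s \<le> t + h" for s
        using p(6)[OF that] L norm_triangle_ineq[of "p s - p t" "p t - dual_point t v"]
        by (intro less_imp_le \<epsilon>(2)) (simp add: dist_norm)
      have "ennreal (\<gamma> * h) = (\<integral>\<^sup>+ s. ennreal \<gamma> * indicator {t..<t + h} s \<partial>lborel)"
        using \<gamma> h by (simp add: nn_integral_cmult_indicator ennreal_mult)
      also have "\<dots> \<le> service f p t (t + h)"
        unfolding service_def
      proof (rule nn_integral_mono)
        fix s
        show "ennreal \<gamma> * indicator {t..<t + h} s \<le> ennreal (request_at f s (p s)) * indicator {t..<t + h} s"
        proof (cases "s \<in> {t..<t + h}")
          case True
          then have "request_at f s = f n" using t thN n by (intro request_at_eq) auto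
          then show ?thesis using big[of s] True by (simp add: ennreal_leI)
        qed simp
      qed
      finally have "\<gamma> * h \<le> S" using p(3,4) by simp
      then show False using main low vL0 by linarith
    qed
  qed
qed

text \<open>The mean of the conjugate over the ball, times the volume of the ball.\<close>

definition potential :: "real \<Rightarrow> real" where
  "potential t = (\<integral>v. ball_ext (dual t) v \<partial>lebesgue)"

lemma integrable_dual:
  assumes "0 \<le> t" "t \<le> real N" shows "integrable lebesgue (ball_ext (dual t))"
proof -
  interpret dual_pair "dual t" "dual_point t" "work t 0" by (rule dual_pair_dual[OF assms])
  show ?thesis
    using abs_ball_ext_le by (intro integrable_lebesgue_bounded[where r = 1] borel_measurable_lebesgueI ball_ext_measurable)
      (auto simp: ball_ext_outside)
qed

lemma potential_mono:
  assumes "0 \<le> \<tau>" "\<tau> \<le> t" "t \<le> real N" shows "potential \<tau> \<le> potential t"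
  unfolding potential_def
proof (rule Bochner_Integration.integral_mono)
  show "ball_ext (dual \<tau>) v \<le> ball_ext (dual t) v" for v
    using dual_mono[OF assms, of v] by (cases "norm v < 1") (auto simp: ball_ext_inside ball_ext_outside)
qed (use assms in \<open>auto intro: integrable_dual\<close>)

text \<open>Fatou's lemma turns the pointwise growth of the conjugate into growth of its integral,
  and Jensen's inequality compares the latter with the request at the Steiner point.\<close>

lemma potential_growth:
  assumes n: "n \<in> {1..N}" and t: "real n - 1 \<le> t" "t < real n"
    and c: "0 \<le> c" "c < f n (ball_average (dual_point t))" and e: "0 < e"
  obtains h where "0 < h" "h < e" "measure lebesgue (ball (0::'a) 1) * c * h \<le> potential (t + h) - potential t"
proof -
  define V where "V = measure lebesgue (ball (0::'a) 1)"
  have V: "0 < V" by (simp add: V_def ball_volume_pos del: measure_completion)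
  have tN: "0 \<le> t" "t \<le> real N" using n t by auto
  interpret dual_pair "dual t" "dual_point t" "work t 0" by (rule dual_pair_dual[OF tN])
  let ?s = "ball_average (dual_point t)"
  \<comment> \<open>Jensen's inequality in the form of an affine minorant that touches
    \<open>f n\<close> at the mean \<open>?s\<close>.\<close>
  obtain g where g: "\<And>y. f n ?s + g \<bullet> (y - ?s) \<le> f n y"
    using convex_subgradient[OF convex_request[OF n]] by blast
  define e' where "e' = min e (real n - t)"
  have e': "0 < e'" "e' \<le> e" "e' \<le> real n - t" using e t by (auto simp: e'_def)
  define h where "h = (\<lambda>k. e' / (real k + 2))"
  have h: "0 < h k" "h k < e'" for k using e' by (auto simp: h_def divide_simps)
  have hlim: "h \<longlonglongrightarrow> 0"
  proof -
    have "(\<lambda>k. e' * (1 / real (k + 2))) \<longlonglongrightarrow> e' * 0"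
      by (intro tendsto_intros LIMSEQ_ignore_initial_segment[OF lim_1_over_n])
    then show ?thesis by (simp add: h_def[abs_def] add.commute)
  qed
  have thN: "0 \<le> t + h k" "t + h k \<le> real N" for k using tN h[of k] e' n by auto
  define G where "G = (\<lambda>k v. (ball_ext (dual (t + h k)) v - ball_ext (dual t) v) / h k)"
  have Gi: "integrable lebesgue (G k)" for k
    unfolding G_def by (intro integrable_divide_zero impI Bochner_Integration.integrable_diff integrable_dual tN thN)
  have G0: "0 \<le> G k v" for k v
    using dual_mono[of t "t + h k" v] tN thN[of k] h[of k] by (cases "norm v < 1") (auto simp: G_def ball_ext_inside ball_ext_outside)
  have Gint: "(\<integral>\<^sup>+ v. ennreal (G k v) \<partial>lebesgue) = ennreal ((potential (t + h k) - potential t) / h k)" for k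
  proof -
    have "(\<integral>\<^sup>+ v. ennreal (G k v) \<partial>lebesgue) = ennreal (integral\<^sup>L lebesgue (G k))"
      using G0 by (intro nn_integral_eq_integral Gi) auto
    also have "integral\<^sup>L lebesgue (G k) = (potential (t + h k) - potential t) / h k"
      unfolding G_def potential_def
      by (simp add: Bochner_Integration.integral_diff[OF integrable_dual[OF thN] integrable_dual[OF tN]])
    finally show ?thesis .
  qed
  define l where "l = (\<lambda>v. indicat_real (ball 0 1) v * (f n ?s + g \<bullet> (dual_point t v - ?s)))"
  have l_eq: "l v = indicat_real (ball 0 1) v * (f n ?s - g \<bullet> ?s) + g \<bullet> (indicat_real (ball 0 1) v *\<^sub>R dual_point t v)" for v
    by (simp add: l_def inner_diff_right algebra_simps)
  have li: "integrable lebesgue l"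
    unfolding l_eq[abs_def] by (intro Bochner_Integration.integrable_add integrable_indicator_ball integrable_inner_right integrable_ball_m)
  have lint: "integral\<^sup>L lebesgue l = V * f n ?s"
  proof -
    have "integral\<^sup>L lebesgue l = V * (f n ?s - g \<bullet> ?s) + g \<bullet> (\<integral>v. indicat_real (ball 0 1) v *\<^sub>R dual_point t v \<partial>lebesgue)"
      unfolding l_eq[abs_def] V_def
      by (subst Bochner_Integration.integral_add[OF integrable_indicator_ball integrable_inner_right])
        (simp_all only: integrable_ball_m integral_indicator_ball integral_inner_right simp_thms)
    also have "(\<integral>v. indicat_real (ball 0 1) v *\<^sub>R dual_point t v \<partial>lebesgue) = V *\<^sub>R ?s"
      using V by (simp add: ball_average_def V_def del: measure_completion)
    finally show ?thesis by (simp add: algebra_simps)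
  qed
  have "ennreal (V * f n ?s) \<le> (\<integral>\<^sup>+ v. ennreal (l v) \<partial>lebesgue)"
    using ennreal_integral_le_nn_integral[OF li] by (simp add: lint)
  also have "\<dots> \<le> (\<integral>\<^sup>+ v. liminf (\<lambda>k. ennreal (G k v)) \<partial>lebesgue)"
  proof (rule nn_integral_mono_AE)
    show "AE v in lebesgue. ennreal (l v) \<le> liminf (\<lambda>k. ennreal (G k v))"
      using AE_supergradient_stable
    proof eventually_elim
      case (elim v)
      show ?case
      proof (cases "norm v < 1")
        case False
        then show ?thesis by (simp add: l_def)
      next
        case True
        have "ennreal (f n (dual_point t v)) \<le> liminf (\<lambda>k. ennreal (G k v))"
        \<comment> \<open>\<open>dual_growth\<close> provides only rates strictly below the
          request.\<close>
        proof (rule dense_le)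
          fix y assume y: "y < ennreal (f n (dual_point t v))"
          then have "y \<noteq> \<infinity>" by auto
          define q where "q = enn2real y"
          have q: "0 \<le> q" "y = ennreal q" using \<open>y \<noteq> \<infinity>\<close> by (auto simp: q_def less_top)
          then have "q < f n (dual_point t v)" using y by (simp add: ennreal_less_iff)
          then obtain h0 where h0: "0 < h0" "\<And>h. 0 < h \<Longrightarrow> h < h0 \<Longrightarrow> q * h \<le> dual (t + h) v - dual t v"
            using dual_growth[OF n t True _ q(1)] elim True by metis
          have "eventually (\<lambda>k. h k < h0) sequentially" using order_tendstoD(2)[OF hlim h0(1)] .
          then have "eventually (\<lambda>k. y \<le> ennreal (G k v)) sequentially"
          proof eventually_elim
            case (elim k)
            then show ?case using h0(2)[OF h(1)[of k]] h(1)[of k] True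
              by (auto simp: G_def q(2) ball_ext_inside pos_le_divide_eq intro!: ennreal_leI)
          qed
          then show "y \<le> liminf (\<lambda>k. ennreal (G k v))" by (rule Liminf_bounded)
        qed
        moreover have "l v \<le> f n (dual_point t v)" using g[of "dual_point t v"] True by (simp add: l_def)
        ultimately show ?thesis by (meson ennreal_leI order_trans)
      qed
    qed
  qed
  also have "\<dots> \<le> liminf (\<lambda>k. \<integral>\<^sup>+ v. ennreal (G k v) \<partial>lebesgue)"
    using Gi by (intro nn_integral_liminf measurable_compose[OF _ measurable_ennreal]) auto
  finally have "ennreal (V * f n ?s) \<le> liminf (\<lambda>k. ennreal ((potential (t + h k) - potential t) / h k))" by (simp only: Gint)
  moreover have "ennreal (V * c) < ennreal (V * f n ?s)" using V c by (intro ennreal_lessI) auto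
  ultimately have "eventually (\<lambda>k. ennreal (V * c) < ennreal ((potential (t + h k) - potential t) / h k)) sequentially"
    by (intro less_LiminfD) (rule less_le_trans)
  then obtain k where "ennreal (V * c) < ennreal ((potential (t + h k) - potential t) / h k)"
    using eventually_happens'[OF sequentially_bot] by blast
  then have "V * c < (potential (t + h k) - potential t) / h k" using V c by (simp add: ennreal_less_iff)
  then have "V * c * h k \<le> potential (t + h k) - potential t" using h[of k] by (simp add: pos_less_divide_eq)
  then show ?thesis using h[of k] e' by (intro that[of "h k"]) (auto simp: V_def)
qed

text \<open>\<open>potential_growth\<close> gives one small step to the right of each time, and no
  continuity of \<open>potential\<close> has been established. A supremum argument chains the steps:
  the times up to which the rate \<open>c\<close> holds have a largest element because
  \<open>potential\<close> is increasing, and a further step rules out everything but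
  \<open>real n\<close>.\<close>

lemma potential_increment:
  assumes n: "n \<in> {1..N}" and q: "0 \<le> q" "\<And>t. real n - 1 \<le> t \<Longrightarrow> t < real n \<Longrightarrow> q \<le> f n (ball_average (dual_point t))"
  shows "measure lebesgue (ball (0::'a) 1) * q \<le> potential (real n) - potential (real n - 1)"
proof -
  define V where "V = measure lebesgue (ball (0::'a) 1)"
  have V: "0 < V" by (simp add: V_def ball_volume_pos del: measure_completion)
  have nN: "0 \<le> real n - 1" "real n \<le> real N" using n by auto
  have mono: "potential \<tau> \<le> potential t" if "real n - 1 \<le> \<tau>" "\<tau> \<le> t" "t \<le> real n" for \<tau> t
    using that nN by (intro potential_mono) auto
  have *: "V * c \<le> potential (real n) - potential (real n - 1)" if c: "0 \<le> c" "c < q" for c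
  proof -
    define A where "A = {t \<in> {real n - 1..real n}. V * c * (t - (real n - 1)) \<le> potential t - potential (real n - 1)}"
    have A0: "real n - 1 \<in> A" by (simp add: A_def)
    have bdd: "bdd_above A" by (intro bdd_aboveI[of _ "real n"]) (auto simp: A_def)
    define T where "T = Sup A"
    have T: "real n - 1 \<le> T" "T \<le> real n"
      unfolding T_def using A0 bdd by (auto intro!: cSup_upper cSup_least simp: A_def)
    have TA: "V * c * (T - (real n - 1)) \<le> potential T - potential (real n - 1)"
    proof (rule field_le_epsilon)
      fix e :: real assume "0 < e"
      \<comment> \<open>The summand 1 keeps the denominator positive when
        \<open>c = 0\<close>.\<close>
      have "T - e / (V * c + 1) < T" using \<open>0 < e\<close> V c by (simp add: add_nonneg_pos)
      then obtain t where t: "t \<in> A" "T - e / (V * c + 1) < t"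
        using less_cSup_iff[of A "T - e / (V * c + 1)"] A0 bdd unfolding T_def by auto
      have tT: "t \<le> T" unfolding T_def using t bdd by (intro cSup_upper)
      have "V * c * (T - t) \<le> (V * c + 1) * (T - t)" using tT by (intro mult_right_mono) auto
      also have "\<dots> \<le> e" 
      proof -
        have "T - t < e / (V * c + 1)" "0 < V * c + 1" using t(2) V c by (auto intro: add_nonneg_pos)
        then show ?thesis by (simp add: pos_less_divide_eq mult.commute)
      qed
      finally have "V * c * (T - (real n - 1)) \<le> V * c * (t - (real n - 1)) + e" by (simp add: algebra_simps)
      also have "V * c * (t - (real n - 1)) \<le> potential t - potential (real n - 1)" using t by (simp add: A_def)
      also have "potential t \<le> potential T" using t tT T by (intro mono) (auto simp: A_def)
      finally show "V * c * (T - (real n - 1)) \<le> potential T - potential (real n - 1) + e" by simp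
    qed
    have "T = real n"
    proof (rule ccontr)
      assume "T \<noteq> real n"
      then have Tn: "T < real n" using T by simp
      obtain h where h: "0 < h" "h < real n - T" "V * c * h \<le> potential (T + h) - potential T"
        using potential_growth[OF n T(1) Tn c(1) less_le_trans[OF c(2) q(2)[OF T(1) Tn]], of "real n - T"] Tn
        unfolding V_def by auto
      have "V * c * (T + h - (real n - 1)) \<le> potential (T + h) - potential (real n - 1)"
        using TA h(3) by (simp add: algebra_simps)
      then have "T + h \<in> A" using T h by (simp add: A_def)
      then have "T + h \<le> T" unfolding T_def using bdd by (intro cSup_upper)
      then show False using h by simp
    qed
    then show ?thesis using TA by simp
  qed
  show ?thesis
  proof (cases "q = 0")
    case True
    then show ?thesis using mono[of "real n - 1" "real n"] by simp
  next
    case False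
    have "V * q \<le> potential (real n) - potential (real n - 1)"
    proof (rule field_le_epsilon)
      fix e :: real assume e: "0 < e"
      define c where "c = max 0 (q - e / V)"
      have "0 \<le> c" "c < q" using e V False q(1) by (auto simp: c_def)
      from *[OF this] have "V * c \<le> potential (real n) - potential (real n - 1)" .
      moreover have "V * (q - e / V) \<le> V * c" using V by (intro mult_left_mono) (auto simp: c_def)
      moreover have "V * (q - e / V) = V * q - e" using V by (simp add: algebra_simps)
      ultimately show "V * q \<le> potential (real n) - potential (real n - 1) + e" by linarith
    qed
    then show ?thesis by (simp add: V_def)
  qed
qed

text \<open>The linear part of the affine bound for the conjugate is odd and integrates to 0 over
  the ball.\<close>

lemma potential_le:
  fixes P :: real
  assumes w: "work_function f (real N) w \<noteq> \<infinity>" "work (real N) w \<le> P"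
  shows "potential (real N) \<le> measure lebesgue (ball (0::'a) 1) * P"
proof -
  have "potential (real N) \<le> (\<integral>v. indicat_real (ball 0 1) v * P - indicat_real (ball 0 1) v * (v \<bullet> w) \<partial>lebesgue)"
    unfolding potential_def
  proof (rule Bochner_Integration.integral_mono)
    fix v :: 'a
    show "ball_ext (dual (real N)) v \<le> indicat_real (ball 0 1) v * P - indicat_real (ball 0 1) v * (v \<bullet> w)"
      using dual_le[OF _ _ _ w(1), of v] w(2) by (cases "norm v < 1") (auto simp: ball_ext_inside ball_ext_outside)
  qed (auto intro!: integrable_dual Bochner_Integration.integrable_diff integrable_indicator_ball integrable_ball_inner)
  also have "\<dots> = measure lebesgue (ball (0::'a) 1) * P"
    by (subst Bochner_Integration.integral_diff[OF integrable_indicator_ball integrable_ball_inner])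
      (simp only: integral_indicator_ball integral_ball_inner diff_0_right)
  finally show ?thesis .
qed

lemma steiner_path_eq: "steiner_path f t = ball_average (dual_point t)"
  by (simp add: steiner_path_def functional_steiner_point_def ball_average_def dual_point_def set_lebesgue_integral_def)

lemma steiner_path_0: "steiner_path f 0 = 0"
proof -
  have "dual_point 0 v = 0" if "norm v < 1" for v
    using dual_point_finite[of 0 v] work_function_0(2)[of "dual_point 0 v"] that by auto
  then have "indicat_real (ball 0 1) v *\<^sub>R dual_point 0 v = 0" for v by (cases "norm v < 1") auto
  then show ?thesis by (simp only: steiner_path_eq ball_average_def) simp
qed

text \<open>The sampling times lie in successive periods and therefore increase, so the telescoping
  of the conjugates applies to them as they are. As \<open>x n\<close> does at least as well as the
  whole path during period \<open>n\<close>, its service is a legitimate rate in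
  \<open>potential_increment\<close>.\<close>

lemma discrete_steiner_play_bounds:
  fixes x y :: "nat \<Rightarrow> 'a" and P :: real
  assumes N: "0 < N" and play: "discrete_steiner_play f N x" and y: "y 0 = 0"
  defines "P \<equiv> total_cost f N y"
  shows "movement_cost N x \<le> DIM('a) * P"
    "movement_cost N x \<le> 17 / 2 * sqrt (DIM('a) * ln (real (max 2 N))) * P"
    "(\<Sum>n=1..N. f n (x n)) \<le> P"
proof -
  have x0: "x 0 = 0" using play by (simp add: discrete_steiner_play_def)
  have "\<exists>T. \<forall>n\<in>{1..N}. T n \<in> {real n - 1..real n} \<and> x n = steiner_path f (T n) \<and>
      (\<forall>u\<in>{real n - 1..<real n}. f n (steiner_path f (T n)) \<le> f n (steiner_path f u))"
    using play unfolding discrete_steiner_play_def by (intro bchoice) blast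
  then obtain T where T: "\<And>n. n \<in> {1..N} \<Longrightarrow> T n \<in> {real n - 1..real n}"
    "\<And>n. n \<in> {1..N} \<Longrightarrow> x n = steiner_path f (T n)"
    "\<And>n u. n \<in> {1..N} \<Longrightarrow> u \<in> {real n - 1..<real n} \<Longrightarrow> f n (steiner_path f (T n)) \<le> f n (steiner_path f u)"
    by blast
  \<comment> \<open>The start of the play is the Steiner point at time 0, which makes the first move
    a displacement like the others.\<close>
  define T' where "T' = T(0 := 0)"
  have T'b: "0 \<le> T' n" "T' n \<le> real n" if "n \<le> N" for n
    using T(1)[of n] that by (cases "n = 0"; auto simp: T'_def; linarith)+
  have T'N: "T' n \<le> real N" if "n \<le> N" for n using T'b(2)[OF that] that by linarith
  have T'mono: "T' (n - 1) \<le> T' n" if n: "n \<in> {1..N}" for n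
  proof -
    have "T' (n - 1) \<le> real (n - 1)" using n by (intro T'b) auto
    also have "\<dots> \<le> T' n" using T(1)[OF n] n by (auto simp: T'_def of_nat_diff)
    finally show ?thesis .
  qed
  have xT: "x n = ball_average (dual_point (T' n))" if "n \<le> N" for n
    using T(2)[of n] that x0 steiner_path_0 by (cases "n = 0") (auto simp: T'_def steiner_path_eq)
  have w: "work_function f (real N) (y N) \<noteq> \<infinity>" "work (real N) (y N) \<le> P"
    using work_le_total_cost[of y N] y by (auto simp: P_def total_cost_def)
  have mv: "movement_cost N x = (\<Sum>n=1..N. norm (ball_average (dual_point (T' n)) - ball_average (dual_point (T' (n - 1)))))"
    unfolding movement_cost_def
  proof (rule sum.cong)
    fix n assume "n \<in> {1..N}"
    then have "n \<le> N" "n - 1 \<le> N" by auto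
    then show "norm (x n - x (n - 1)) = norm (ball_average (dual_point (T' n)) - ball_average (dual_point (T' (n - 1))))"
      using xT by presburger
  qed simp
  note bounds = movement_bound[where \<phi> = "\<lambda>n. dual (T' n)" and m = "\<lambda>n. dual_point (T' n)"
      and C = "\<lambda>n. work (T' n) 0" and P = P and w = "y N", OF N]
  have top: "dual (T' N) v \<le> P - v \<bullet> y N" if v: "norm v < 1" for v
    using dual_mono[OF T'b(1)[of N] T'N[of N] _ v] dual_le[OF _ _ v w(1)] w(2) by simp
  have mono: "dual (T' (n - 1)) v \<le> dual (T' n) v" if "n \<in> {1..N}" "norm v < 1" for n v
    using that T'b(1)[of "n - 1"] T'N[of n] T'mono[of n] by (intro dual_mono) auto
  have norm_y: "norm (y N) \<le> P" using norm_le_work[OF _ _ w(1)] w(2) by simp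
  show "movement_cost N x \<le> DIM('a) * P"
    unfolding mv using T'b T'N mono top norm_y by (intro bounds(1) dual_pair_dual) auto
  show "movement_cost N x \<le> 17 / 2 * sqrt (DIM('a) * ln (real (max 2 N))) * P"
    unfolding mv using T'b T'N mono top norm_y by (intro bounds(2) dual_pair_dual) auto
  define V where "V = measure lebesgue (ball (0::'a) 1)"
  have V: "0 < V" by (simp add: V_def ball_volume_pos del: measure_completion)
  have "V * (\<Sum>n=1..N. f n (x n)) = (\<Sum>n=1..N. V * f n (x n))" by (rule sum_distrib_left)
  also have "\<dots> \<le> (\<Sum>n=1..N. potential (real n) - potential (real (n - 1)))"
  proof (rule sum_mono)
    fix n assume n: "n \<in> {1..N}"
    have "V * f n (x n) \<le> potential (real n) - potential (real n - 1)"
      unfolding V_def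
    proof (rule potential_increment[OF n])
      show "0 \<le> f n (x n)" by (rule request_nonneg[OF n])
      show "f n (x n) \<le> f n (ball_average (dual_point t))" if "real n - 1 \<le> t" "t < real n" for t
        using T(3)[OF n, of t] T(2)[OF n] that by (simp add: steiner_path_eq)
    qed
    then show "V * f n (x n) \<le> potential (real n) - potential (real (n - 1))" using n by (simp add: of_nat_diff)
  qed
  also have "\<dots> = potential (real N) - potential 0" by (induction N) auto
  also have "\<dots> \<le> V * P"
  proof -
    have "0 \<le> ball_ext (dual 0) v" for v
      using dual_pair.nonneg[OF dual_pair_dual, of 0 v] by (cases "norm v < 1") (auto simp: ball_ext_inside ball_ext_outside)
    then have "0 \<le> potential 0" unfolding potential_def by (intro Bochner_Integration.integral_nonneg) auto
    then show ?thesis using potential_le[OF w] by (simp add: V_def)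
  qed
  finally show "(\<Sum>n=1..N. f n (x n)) \<le> P" using V by simp
qed

end

section \<open>The competitive ratio\<close>

theorem theorem5p3:
  fixes f :: "nat \<Rightarrow> real ^ 'd \<Rightarrow> real" and N :: nat and x :: "nat \<Rightarrow> real ^ 'd"
  assumes "\<And>n. n \<in> {1..N} \<Longrightarrow> convex_on UNIV (f n)"
    and "\<And>n y. n \<in> {1..N} \<Longrightarrow> 0 \<le> f n y"
    and "discrete_steiner_play f N x"
  shows "movement_cost N x
           \<le> min (real CARD('d)) (10 * sqrt (real CARD('d) * ln (real (max 2 N)))) * offline_opt f N
       \<and> total_cost f N x
           \<le> min (real CARD('d) + 1) (10 * sqrt (real CARD('d) * ln (real (max 2 N)))) * offline_opt f N"
proof (cases "N = 0")
  case True
  have "{x :: nat \<Rightarrow> real ^ 'd. x 0 = 0} \<noteq> {}" by (auto intro: exI[of _ "\<lambda>n. 0"])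
  then show ?thesis using True by (simp add: movement_cost_def total_cost_def offline_opt_def)
next
  case False
  interpret requests f N by unfold_locales (use assms in auto)
  define d K where "d = real CARD('d)" and "K = sqrt (d * ln (real (max 2 N)))"
  have d: "1 \<le> d" using zero_less_card_finite[where 'a = 'd] by (simp add: d_def Suc_le_eq)
  \<comment> \<open>From \<open>d \<ge> 1\<close> and \<open>ln 2 \<ge> 2 / 3\<close>. It lets
    \<open>3 / 2 * K\<close> absorb the additional 1 for the service cost, and
    \<open>17 / 2 + 3 / 2 = 10\<close>.\<close>
  have K: "2 / 3 \<le> K"
  proof -
    have "(2 / 3)\<^sup>2 \<le> 1 * (2 / 3 :: real)" by (simp add: power2_eq_square)
    also have "\<dots> \<le> d * ln (real (max 2 N))"
    proof (intro mult_mono d)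
      have "ln 2 \<le> ln (real (max 2 N))" by simp
      then show "2 / 3 \<le> ln (real (max 2 N))" using ln2_ge_two_thirds by linarith
    qed (use d in auto)
    finally show ?thesis unfolding K_def by (rule real_le_rsqrt)
  qed
  have total: "total_cost f N x = (\<Sum>n=1..N. f n (x n)) + movement_cost N x"
    by (simp add: total_cost_def movement_cost_def sum.distrib)
  \<comment> \<open>The offline optimum is an infimum that need not be attained; bounds against
    every single play carry over to it.\<close>
  have opt: "B \<le> k * offline_opt f N" if k: "0 < k" and B: "\<And>y. y 0 = 0 \<Longrightarrow> B \<le> k * total_cost f N y" for B k
  proof -
    have "B / k \<le> offline_opt f N"
      unfolding offline_opt_def
    proof (rule cINF_greatest)
      show "{x :: nat \<Rightarrow> real ^ 'd. x 0 = 0} \<noteq> {}" by (auto intro: exI[of _ "\<lambda>n. 0"])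
      show "B / k \<le> total_cost f N y" if "y \<in> {x. x 0 = 0}" for y
        using B[of y] k that by (simp add: pos_divide_le_eq mult.commute)
    qed
    then show ?thesis using k by (simp add: pos_divide_le_eq mult.commute)
  qed
  have bounds: "movement_cost N x \<le> d * total_cost f N y" "movement_cost N x \<le> 17 / 2 * K * total_cost f N y"
    "(\<Sum>n=1..N. f n (x n)) \<le> total_cost f N y" "0 \<le> total_cost f N y" if "y 0 = 0" for y
  proof -
    show "movement_cost N x \<le> d * total_cost f N y" "movement_cost N x \<le> 17 / 2 * K * total_cost f N y"
      "(\<Sum>n=1..N. f n (x n)) \<le> total_cost f N y"
      using discrete_steiner_play_bounds[of x y, OF _ assms(3) that] False by (simp_all add: d_def K_def)
    show "0 \<le> total_cost f N y" using assms(2) by (auto simp: total_cost_def intro!: sum_nonneg)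
  qed
  have "movement_cost N x \<le> min d (10 * K) * offline_opt f N"
  proof (rule opt)
    show "0 < min d (10 * K)" using d K by auto
    fix y :: "nat \<Rightarrow> real ^ 'd" assume y: "y 0 = 0"
    have "17 / 2 * K * total_cost f N y \<le> 10 * K * total_cost f N y"
      using K bounds(4)[of y, OF y] by (intro mult_right_mono) auto
    then show "movement_cost N x \<le> min d (10 * K) * total_cost f N y"
      using bounds[of y, OF y] by (auto simp: min_def)
  qed
  moreover have "total_cost f N x \<le> min (d + 1) (10 * K) * offline_opt f N"
  proof (rule opt)
    show "0 < min (d + 1) (10 * K)" using d K by auto
    fix y :: "nat \<Rightarrow> real ^ 'd" assume y: "y 0 = 0"
    have "(17 / 2 * K + 1) * total_cost f N y \<le> 10 * K * total_cost f N y"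
      using K bounds(4)[of y, OF y] by (intro mult_right_mono) auto
    then show "total_cost f N x \<le> min (d + 1) (10 * K) * total_cost f N y"
      using bounds[of y, OF y] by (auto simp: min_def total distrib_right)
  qed
  ultimately show ?thesis by (simp add: d_def K_def)
qed

end
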